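(* Let $(A,B,P)$ be an $\mathbb E$-contraction on a Hilbert space $\mathcal H$. Let $\mathcal T$ be the strong operator limit of $\{P^{*k}P^k\}_{k\ge1}$ and $\mathcal T_*$ the strong operator limit of $\{P^kP^{*k}\}_{k\ge1}$. If $\mathcal T=\mathcal T^2$, then: (1) $\mathrm{Ker}(\mathcal T)$, $\mathrm{Ker}(I-\mathcal T)\cap\mathrm{Ker}(\mathcal T_* )$ and $\mathrm{Ker}(I-\mathcal T)\cap\mathrm{Ker}(I-\mathcal T_* )$ reduce $A$ and $B$; (2) the restriction of $(A,B,P)$ to $\mathrm{Ker}(\mathcal T)$ is a strongly stable $\mathbb E$-contraction; (3) the restriction of $(A,B,P)$ to $\mathrm{Ker}(I-\mathcal T)\cap\mathrm{Ker}(\mathcal T_* )$ is a pure $\mathbb E$-isometry; (4) the restriction of $(A,B,P)$ to $\mathrm{Ker}(I-\mathcal T)\cap\mathrm{Ker}(I-\mathcal T_* )$ is an $\mathbb E$-unitary. Moreover, if $\mathcal T=\mathcal T^2$ and $\mathcal T_*=\mathcal T_*^2$, then: (1') the restriction of $(A,B,P)$ to $\mathrm{Ker}(\mathcal T)\cap\mathrm{Ker}(\mathcal T_* )$ is a $\mathcal C_{00}$ $\mathbb E$-contraction; (2') the restriction of $(A^*,B^*,P^* )$ to $\mathrm{Ker}(\mathcal T)\cap\mathrm{Ker}(I-\mathcal T_* )$ is a pure $\mathbb E$-isometry. Furthermore, if $\mathcal T=\mathcal T_*$, then: (1'') the restriction of $(A,B,P)$ to $\mathrm{Ker}(\mathcal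 T)$ is a $\mathcal C_{00}$ $\mathbb E$-contraction; (2'') the restriction of $(A,B,P)$ to $\mathrm{Ker}(I-\mathcal T)$ is an $\mathbb E$-unitary.
   Context: All operators are bounded linear operators on complex Hilbert spaces; subspaces are closed. A subspace reduces $T$ if it is invariant under $T$ and $T^*$. The subspaces occurring may be $\{0\}$. The tetrablock is $\mathbb E=\{(x_1,x_2,x_3)\in\mathbb C^3:1-zx_1-wx_2+zwx_3\ne0\ \ \forall z,w\in\overline{\mathbb D}\}$, and $b\mathbb E=\{(a,b,p)\in\overline{\mathbb E}:|p|=1\}$. A compact set $K\subset\mathbb C^3$ is a spectral set for a commuting triple $\underline T$ if the Taylor joint spectrum of $\underline T$ lies in $K$ and $\|f(\underline T)\|\le\sup_K|f|$ for every rational function $f$ with poles off $K$. An $\mathbb E$-contraction is a commuting triple $(A,B,P)$ having $\overline{\mathbb E}$ as a spectral set (then $P$ is a contraction, so $\{P^{*k}P^k\}$ and $\{P^kP^{*k}\}$ are non-increasing sequences of positive contractions and converge strongly). An $\mathbb E$-unitary is a commuting triple of normal operators with Taylor joint spectrum contained in $b\mathbb E$. An $\mathbb E$-isometry is the restriction of an $\mathbb E$-unitary to a joint invariant subspace. An operator $P$ is strongly stable if $\|P^kx\|\to0$ for all $x$. An $\mathbb E$-contraction $(A,B,P)$ is strongly stable if $P$ is strongly stable; pure if $P^*$ is strongly stable; $\mathcal C_{00}$ if both $P$ and $P^*$ are strongly stable. A pure $\mathbb E$-isometry is an $\mathbb E$-isometry that is a pure $\mathbb E$-contraction. *)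

theory Defs
  imports "HOL-Analysis.Analysis" "HOL-Library.Poly_Mapping"
begin

section \<open>Complex Hilbert spaces\<close>

text \<open>
  The real inner product that carries norm and topology is the real part of the complex one;
  the complex inner product is linear in its first argument.  The zero space is allowed.
\<close>

class complex_inner = real_inner +
  fixes scaleC :: "complex \<Rightarrow> 'a \<Rightarrow> 'a" (infixr "*\<^sub>C" 75)
    and cinner :: "'a \<Rightarrow> 'a \<Rightarrow> complex"
  assumes scaleC_add_right: "c *\<^sub>C (x + y) = c *\<^sub>C x + c *\<^sub>C y"
    and scaleC_add_left: "(c + d) *\<^sub>C x = c *\<^sub>C x + d *\<^sub>C x"
    and scaleC_scaleC: "c *\<^sub>C d *\<^sub>C x = (c * d) *\<^sub>C x"
    and scaleC_of_real: "complex_of_real r *\<^sub>C x = r *\<^sub>R x"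
    and cinner_commute: "cinner x y = cnj (cinner y x)"
    and cinner_add_left: "cinner (x + y) z = cinner x z + cinner y z"
    and cinner_scaleC_left: "cinner (c *\<^sub>C x) y = c * cinner x y"
    and Re_cinner: "Re (cinner x y) = inner x y"

class chilbert_space = complex_inner + complete_space

subclass (in chilbert_space) banach ..

lemma cinner_same: "cinner x x = complex_of_real ((norm x)\<^sup>2)"
  for x :: "'a::complex_inner"
proof -
  have "Im (cinner x x) = 0"
    using arg_cong[OF cinner_commute[of x x], of Im] by simp
  then show ?thesis
    by (simp add: complex_eq_iff Re_cinner power2_norm_eq_inner)
qed

lemma cinner_scaleC_right: "cinner x (c *\<^sub>C y) = cnj c * cinner x y"
  for x :: "'a::complex_inner"
  by (metis cinner_commute cinner_scaleC_left complex_cnj_cnj complex_cnj_mult)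

lemma norm_scaleC: "norm (c *\<^sub>C x) = cmod c * norm x"
  for x :: "'a::complex_inner"
proof -
  have "complex_of_real ((norm (c *\<^sub>C x))\<^sup>2) = c * cnj c * complex_of_real ((norm x)\<^sup>2)"
    by (simp only: cinner_same[symmetric] cinner_scaleC_left cinner_scaleC_right ac_simps)
  also have "\<dots> = complex_of_real ((cmod c * norm x)\<^sup>2)"
    by (simp add: complex_norm_square[symmetric] power_mult_distrib)
  finally have "(norm (c *\<^sub>C x))\<^sup>2 = (cmod c * norm x)\<^sup>2"
    by (simp only: of_real_eq_iff)
  then show ?thesis by simp
qed

lemma cmod_cinner_le: "cmod (cinner x y) \<le> norm x * norm y"
  for x :: "'a::complex_inner"
proof (cases "cinner x y = 0")
  case False
  define u where "u = cnj (cinner x y) / complex_of_real (cmod (cinner x y))"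
  have "cinner (u *\<^sub>C x) y = complex_of_real (cmod (cinner x y))"
    using False
    by (simp add: cinner_scaleC_left u_def mult.commute[of "cnj _"]
        complex_norm_square[symmetric] power2_eq_square)
  then have "cmod (cinner x y) = inner (u *\<^sub>C x) y"
    by (metis Re_cinner Re_complex_of_real)
  also have "\<dots> \<le> norm (u *\<^sub>C x) * norm y"
    by (rule norm_cauchy_schwarz)
  also have "norm (u *\<^sub>C x) = norm x"
    using False by (simp add: norm_scaleC u_def norm_divide)
  finally show ?thesis .
qed simp

instantiation complex :: chilbert_space
begin
definition "scaleC_complex c x = c * (x :: complex)"
definition "cinner_complex x y = x * cnj (y :: complex)"
instance
  by standard
    (auto simp: scaleC_complex_def cinner_complex_def algebra_simps complex_eq_iff inner_complex_def)
end


section \<open>The Hilbert space of square-summable bilateral sequences\<close>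

typedef (overloaded) 'a ell2 =
  "{f :: int \<Rightarrow> 'a::complex_inner. (\<lambda>n. (norm (f n))\<^sup>2) summable_on UNIV}"
  by (rule exI[of _ "\<lambda>_. 0"]) simp

setup_lifting type_definition_ell2

lemma summable_on_bound_finite:
  fixes f :: "'i \<Rightarrow> real"
  assumes "\<And>n. f n \<ge> 0" and "\<And>F. finite F \<Longrightarrow> sum f F \<le> B"
  shows "f summable_on UNIV" and "infsum f UNIV \<le> B"
proof -
  show *: "f summable_on UNIV"
    using assms by (intro nonneg_bdd_above_summable_on) (auto simp: bdd_above_def)
  show "infsum f UNIV \<le> B"
    using * assms by (intro infsum_le_finite_sums) auto
qed

lemma sq_summable_add:
  fixes f g :: "int \<Rightarrow> 'a::complex_inner"
  assumes "(\<lambda>n. (norm (f n))\<^sup>2) summable_on UNIV" "(\<lambda>n. (norm (g n))\<^sup>2) summable_on UNIV"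
  shows "(\<lambda>n. (norm (f n + g n))\<^sup>2) summable_on UNIV"
proof (rule summable_on_comparison_test)
  show "(\<lambda>n. 2 * (norm (f n))\<^sup>2 + 2 * (norm (g n))\<^sup>2) summable_on UNIV"
    using assms by (intro summable_on_add summable_on_cmult_right)
next
  fix n
  have "(norm (f n + g n))\<^sup>2 \<le> (norm (f n) + norm (g n))\<^sup>2"
    by (intro power_mono norm_triangle_ineq) auto
  also have "\<dots> \<le> 2 * (norm (f n))\<^sup>2 + 2 * (norm (g n))\<^sup>2"
    using zero_le_power2[of "norm (f n) - norm (g n)"] by (simp add: power2_eq_square algebra_simps)
  finally show "(norm (f n + g n))\<^sup>2 \<le> 2 * (norm (f n))\<^sup>2 + 2 * (norm (g n))\<^sup>2" .
qed auto

lemma sq_summable_scaleC: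
  fixes f :: "int \<Rightarrow> 'a::complex_inner"
  assumes "(\<lambda>n. (norm (f n))\<^sup>2) summable_on UNIV"
  shows "(\<lambda>n. (norm (c *\<^sub>C f n))\<^sup>2) summable_on UNIV"
  using assms by (simp add: norm_scaleC power_mult_distrib summable_on_cmult_right)

lemma sq_summable_mult:
  fixes f g :: "int \<Rightarrow> 'a::complex_inner"
  assumes "(\<lambda>n. (norm (f n))\<^sup>2) summable_on UNIV" "(\<lambda>n. (norm (g n))\<^sup>2) summable_on UNIV"
  shows "(\<lambda>n. norm (f n) * norm (g n)) summable_on UNIV"
proof (rule summable_on_comparison_test)
  show "(\<lambda>n. (norm (f n))\<^sup>2 + (norm (g n))\<^sup>2) summable_on UNIV"
    using assms by (intro summable_on_add)
next
  fix n
  show "norm (f n) * norm (g n) \<le> (norm (f n))\<^sup>2 + (norm (g n))\<^sup>2"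
    using zero_le_power2[of "norm (f n) - norm (g n)"]
      zero_le_power2[of "norm (f n)"] zero_le_power2[of "norm (g n)"]
    unfolding power2_diff by linarith
qed auto

lemma cinner_summable:
  fixes f g :: "int \<Rightarrow> 'a::complex_inner"
  assumes "(\<lambda>n. (norm (f n))\<^sup>2) summable_on UNIV" "(\<lambda>n. (norm (g n))\<^sup>2) summable_on UNIV"
  shows "(\<lambda>n. cinner (f n) (g n)) summable_on UNIV"
  by (rule abs_summable_summable,
      rule summable_on_comparison_test[OF sq_summable_mult[OF assms]])
    (auto intro: cmod_cinner_le)

lemma inner_summable:
  fixes f g :: "int \<Rightarrow> 'a::complex_inner"
  assumes "(\<lambda>n. (norm (f n))\<^sup>2) summable_on UNIV" "(\<lambda>n. (norm (g n))\<^sup>2) summable_on UNIV"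
  shows "(\<lambda>n. inner (f n) (g n)) summable_on UNIV"
  using summable_on_Re[OF cinner_summable[OF assms]] by (simp add: Re_cinner)

instantiation ell2 :: (complex_inner) real_vector
begin

lift_definition zero_ell2 :: "'a ell2" is "\<lambda>_. 0" by simp
lift_definition plus_ell2 :: "'a ell2 \<Rightarrow> 'a ell2 \<Rightarrow> 'a ell2" is "\<lambda>f g n. f n + g n"
  by (rule sq_summable_add)
lift_definition uminus_ell2 :: "'a ell2 \<Rightarrow> 'a ell2" is "\<lambda>f n. - f n" by simp
lift_definition minus_ell2 :: "'a ell2 \<Rightarrow> 'a ell2 \<Rightarrow> 'a ell2" is "\<lambda>f g n. f n - g n"
  using sq_summable_add[where g = "\<lambda>n. - g n" for g] by simp
lift_definition scaleR_ell2 :: "real \<Rightarrow> 'a ell2 \<Rightarrow> 'a ell2" is "\<lambda>r f n. r *\<^sub>R f n"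
  by (simp add: power_mult_distrib summable_on_cmult_right)

instance
proof
  fix x y z :: "'a ell2" and r s :: real
  show "x + y + z = x + (y + z)" by transfer (simp add: add.assoc)
  show "x + y = y + x" by transfer (simp add: add.commute)
  show "0 + x = x" by transfer simp
  show "- x + x = 0" by transfer simp
  show "x - y = x + - y" by transfer simp
  show "r *\<^sub>R (x + y) = r *\<^sub>R x + r *\<^sub>R y" by transfer (simp add: scaleR_add_right)
  show "(r + s) *\<^sub>R x = r *\<^sub>R x + s *\<^sub>R x" by transfer (simp add: scaleR_add_left)
  show "r *\<^sub>R s *\<^sub>R x = (r * s) *\<^sub>R x" by transfer simp
  show "1 *\<^sub>R x = x" by transfer simp
qed

end

instantiation ell2 :: (complex_inner) complex_inner
begin

lift_definition scaleC_ell2 :: "complex \<Rightarrow> 'a ell2 \<Rightarrow> 'a ell2" is "\<lambda>c f n. c *\<^sub>C f n"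
  by (rule sq_summable_scaleC)
lift_definition cinner_ell2 :: "'a ell2 \<Rightarrow> 'a ell2 \<Rightarrow> complex"
  is "\<lambda>f g. \<Sum>\<^sub>\<infinity>n. cinner (f n) (g n)" .
lift_definition inner_ell2 :: "'a ell2 \<Rightarrow> 'a ell2 \<Rightarrow> real"
  is "\<lambda>f g. \<Sum>\<^sub>\<infinity>n. inner (f n) (g n)" .

definition norm_ell2 :: "'a ell2 \<Rightarrow> real" where "norm_ell2 x = sqrt (inner x x)"
definition sgn_ell2 :: "'a ell2 \<Rightarrow> 'a ell2" where "sgn_ell2 x = x /\<^sub>R norm x"
definition dist_ell2 :: "'a ell2 \<Rightarrow> 'a ell2 \<Rightarrow> real" where "dist_ell2 x y = norm (x - y)"
definition uniformity_ell2 :: "('a ell2 \<times> 'a ell2) filter"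
  where "uniformity_ell2 = (INF e\<in>{0<..}. principal {(x, y). dist x y < e})"
definition open_ell2 :: "'a ell2 set \<Rightarrow> bool"
  where "open_ell2 U = (\<forall>x\<in>U. eventually (\<lambda>(x', y). x' = x \<longrightarrow> y \<in> U) uniformity)"

instance
proof
  fix x y z :: "'a ell2" and c d :: complex and r :: real
  show "sgn x = x /\<^sub>R norm x" by (rule sgn_ell2_def)
  show "dist x y = norm (x - y)" by (rule dist_ell2_def)
  show "uniformity = (INF e\<in>{0<..}. principal {(x :: 'a ell2, y). dist x y < e})"
    by (rule uniformity_ell2_def)
  show "open U = (\<forall>x\<in>U. \<forall>\<^sub>F (x', y) in uniformity. x' = x \<longrightarrow> y \<in> U)" for U :: "'a ell2 set"
    by (rule open_ell2_def)
  show "inner x y = inner y x" by transfer (simp add: inner_commute)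
  show "inner (x + y) z = inner x z + inner y z"
    by transfer (simp add: inner_add_left infsum_add inner_summable)
  show "inner (r *\<^sub>R x) y = r * inner x y"
    by transfer (simp add: infsum_cmult_right inner_summable)
  show "0 \<le> inner x x"
    by transfer (simp add: infsum_nonneg)
  show "inner x x = 0 \<longleftrightarrow> x = 0"
  proof transfer
    fix f :: "int \<Rightarrow> 'a"
    assume f: "(\<lambda>n. (norm (f n))\<^sup>2) summable_on UNIV"
    show "(\<Sum>\<^sub>\<infinity>n. inner (f n) (f n)) = 0 \<longleftrightarrow> f = (\<lambda>_. 0)"
    proof
      assume "(\<Sum>\<^sub>\<infinity>n. inner (f n) (f n)) = 0"
      then have "inner (f n) (f n) = 0" for n
        by (intro nonneg_infsum_le_0D[of "\<lambda>n. inner (f n) (f n)" UNIV]) (auto simp: inner_summable f)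
      then show "f = (\<lambda>_. 0)" by auto
    qed simp
  qed
  show "norm x = sqrt (inner x x)" by (rule norm_ell2_def)
  show "c *\<^sub>C (x + y) = c *\<^sub>C x + c *\<^sub>C y" by transfer (simp add: scaleC_add_right)
  show "(c + d) *\<^sub>C x = c *\<^sub>C x + d *\<^sub>C x" by transfer (simp add: scaleC_add_left)
  show "c *\<^sub>C d *\<^sub>C x = (c * d) *\<^sub>C x" by transfer (simp add: scaleC_scaleC)
  show "complex_of_real r *\<^sub>C x = r *\<^sub>R x" by transfer (simp add: scaleC_of_real)
  show "cinner x y = cnj (cinner y x)"
    by transfer (simp add: infsum_cnj[symmetric] cinner_commute[symmetric] del: infsum_cnj)
  show "cinner (x + y) z = cinner x z + cinner y z"
    by transfer (simp add: cinner_add_left infsum_add cinner_summable)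
  show "cinner (c *\<^sub>C x) y = c * cinner x y"
    by transfer (simp add: cinner_scaleC_left infsum_cmult_right cinner_summable)
  show "Re (cinner x y) = inner x y"
    by transfer (simp add: infsum_Re[symmetric] Re_cinner cinner_summable)
qed

end

lemma norm_ell2_sq: "(norm x)\<^sup>2 = (\<Sum>\<^sub>\<infinity>n. (norm (Rep_ell2 x n))\<^sup>2)"
  for x :: "'a::complex_inner ell2"
  by (simp add: power2_norm_eq_inner inner_ell2.rep_eq)

lemma sum_norm_ell2_le: "finite F \<Longrightarrow> (\<Sum>n\<in>F. (norm (Rep_ell2 x n))\<^sup>2) \<le> (norm x)\<^sup>2"
  for x :: "'a::complex_inner ell2"
  unfolding norm_ell2_sq using Rep_ell2[of x] by (intro finite_sum_le_infsum) auto

instance ell2 :: (chilbert_space) chilbert_space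
proof
  fix X :: "nat \<Rightarrow> 'a ell2"
  assume X: "Cauchy X"
  have coord: "norm (Rep_ell2 x n) \<le> norm x" for x :: "'a ell2" and n
    using sum_norm_ell2_le[of "{n}" x] by simp
  have "Cauchy (\<lambda>k. Rep_ell2 (X k) n)" for n
  proof (rule metric_CauchyI)
    fix e :: real
    assume "e > 0"
    then obtain M where "\<forall>i\<ge>M. \<forall>j\<ge>M. dist (X i) (X j) < e"
      using metric_CauchyD[OF X] by meson
    moreover have "dist (Rep_ell2 (X i) n) (Rep_ell2 (X j) n) \<le> dist (X i) (X j)" for i j
      using coord[of "X i - X j" n] by (simp add: dist_norm minus_ell2.rep_eq)
    ultimately show "\<exists>M. \<forall>i\<ge>M. \<forall>j\<ge>M. dist (Rep_ell2 (X i) n) (Rep_ell2 (X j) n) < e"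
      by (meson le_less_trans)
  qed
  then have "\<exists>g. \<forall>n. (\<lambda>k. Rep_ell2 (X k) n) \<longlonglongrightarrow> g n"
    by (intro choice allI) (simp add: Cauchy_convergent_iff convergent_def)
  then obtain g where g: "\<And>n. (\<lambda>k. Rep_ell2 (X k) n) \<longlonglongrightarrow> g n" by blast
  have tail: "\<exists>M. \<forall>k\<ge>M. \<forall>F. finite F \<longrightarrow> (\<Sum>n\<in>F. (norm (Rep_ell2 (X k) n - g n))\<^sup>2) \<le> e\<^sup>2"
    if "e > 0" for e
  proof -
    obtain M where M: "\<And>i j. i \<ge> M \<Longrightarrow> j \<ge> M \<Longrightarrow> dist (X i) (X j) < e"
      using metric_CauchyD[OF X \<open>e > 0\<close>] by meson
    have "(\<Sum>n\<in>F. (norm (Rep_ell2 (X k) n - g n))\<^sup>2) \<le> e\<^sup>2" if "k \<ge> M" "finite F" for k F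
    proof (rule tendsto_upperbound)
      show "(\<lambda>j. \<Sum>n\<in>F. (norm (Rep_ell2 (X k) n - Rep_ell2 (X j) n))\<^sup>2)
          \<longlonglongrightarrow> (\<Sum>n\<in>F. (norm (Rep_ell2 (X k) n - g n))\<^sup>2)"
        by (intro tendsto_intros g)
      show "\<forall>\<^sub>F j in sequentially. (\<Sum>n\<in>F. (norm (Rep_ell2 (X k) n - Rep_ell2 (X j) n))\<^sup>2) \<le> e\<^sup>2"
      proof (rule eventually_sequentiallyI[of M])
        fix j
        assume "j \<ge> M"
        have "(\<Sum>n\<in>F. (norm (Rep_ell2 (X k) n - Rep_ell2 (X j) n))\<^sup>2) \<le> (norm (X k - X j))\<^sup>2"
          using sum_norm_ell2_le[OF \<open>finite F\<close>, of "X k - X j"] by (simp add: minus_ell2.rep_eq)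
        also have "\<dots> \<le> e\<^sup>2"
          using M[OF \<open>k \<ge> M\<close> \<open>j \<ge> M\<close>] by (intro power_mono) (auto simp: dist_norm)
        finally show "(\<Sum>n\<in>F. (norm (Rep_ell2 (X k) n - Rep_ell2 (X j) n))\<^sup>2) \<le> e\<^sup>2" .
      qed
    qed auto
    then show ?thesis by (intro exI[of _ M]) simp
  qed
  have g_sq: "(\<lambda>n. (norm (g n))\<^sup>2) summable_on UNIV"
  proof -
    obtain M where M: "\<And>F. finite F \<Longrightarrow> (\<Sum>n\<in>F. (norm (Rep_ell2 (X M) n - g n))\<^sup>2) \<le> 1\<^sup>2"
      using tail[of 1] by (metis order_refl zero_less_one)
    have "(\<lambda>n. (norm (Rep_ell2 (X M) n - g n))\<^sup>2) summable_on UNIV"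
      by (rule summable_on_bound_finite(1)[OF _ M]) auto
    then have "(\<lambda>n. (norm (g n - Rep_ell2 (X M) n))\<^sup>2) summable_on UNIV"
      by (simp add: norm_minus_commute)
    from sq_summable_add[OF this, of "Rep_ell2 (X M)"] show ?thesis
      using Rep_ell2[of "X M"] by simp
  qed
  then have rep: "Rep_ell2 (Abs_ell2 g) = g"
    by (simp add: Abs_ell2_inverse)
  have "X \<longlonglongrightarrow> Abs_ell2 g"
  proof (rule metric_LIMSEQ_I)
    fix e :: real
    assume "e > 0"
    then obtain M where M:
      "\<And>k F. k \<ge> M \<Longrightarrow> finite F \<Longrightarrow> (\<Sum>n\<in>F. (norm (Rep_ell2 (X k) n - g n))\<^sup>2) \<le> (e/2)\<^sup>2"
      using tail[of "e/2"] by (metis half_gt_zero)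
    have "dist (X k) (Abs_ell2 g) < e" if "k \<ge> M" for k
    proof -
      have "(norm (X k - Abs_ell2 g))\<^sup>2 \<le> (e/2)\<^sup>2"
        unfolding norm_ell2_sq minus_ell2.rep_eq rep
        by (rule summable_on_bound_finite(2)[OF _ M[OF that]]) auto
      then have "norm (X k - Abs_ell2 g) \<le> e/2"
        by (rule power2_le_imp_le) (use \<open>e > 0\<close> in simp)
      then show ?thesis using \<open>e > 0\<close> by (simp add: dist_norm)
    qed
    then show "\<exists>M. \<forall>k\<ge>M. dist (X k) (Abs_ell2 g) < e" by (intro exI[of _ M]) simp
  qed
  then show "convergent X" by (rule convergentI)
qed


section \<open>Operators on closed subspaces\<close>

text \<open>
  An operator on a closed subspace \<open>M\<close> is a function on the ambient type that is only considered
  on \<open>M\<close>.  The restriction of an operator to an invariant subspace \<open>M\<close> is thus the same function,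
  now regarded as an operator on \<open>M\<close>, and the whole space is \<open>UNIV\<close>.
\<close>

definition closed_csubspace :: "'a::complex_inner set \<Rightarrow> bool" where
  "closed_csubspace M \<longleftrightarrow>
     0 \<in> M \<and> (\<forall>x\<in>M. \<forall>y\<in>M. x + y \<in> M) \<and> (\<forall>c. \<forall>x\<in>M. c *\<^sub>C x \<in> M) \<and> closed M"

definition clinear_on :: "'a::complex_inner set \<Rightarrow> ('a \<Rightarrow> 'b::complex_inner) \<Rightarrow> bool" where
  "clinear_on M T \<longleftrightarrow>
     (\<forall>x\<in>M. \<forall>y\<in>M. T (x + y) = T x + T y) \<and> (\<forall>c. \<forall>x\<in>M. T (c *\<^sub>C x) = c *\<^sub>C T x)"

definition bounded_op_on :: "'a::complex_inner set \<Rightarrow> ('a \<Rightarrow> 'a) \<Rightarrow> bool" where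
  "bounded_op_on M T \<longleftrightarrow>
     T ` M \<subseteq> M \<and> clinear_on M T \<and> (\<exists>C. \<forall>x\<in>M. norm (T x) \<le> C * norm x)"

text \<open>The Hilbert space adjoint of \<open>T\<close> as an operator on \<open>M\<close>.\<close>

definition adj_on :: "'a::complex_inner set \<Rightarrow> ('a \<Rightarrow> 'a) \<Rightarrow> 'a \<Rightarrow> 'a" where
  "adj_on M T x = (THE y. y \<in> M \<and> (\<forall>z\<in>M. cinner (T z) x = cinner z y))"

abbreviation adj :: "('a::complex_inner \<Rightarrow> 'a) \<Rightarrow> 'a \<Rightarrow> 'a" where
  "adj T \<equiv> adj_on UNIV T"

definition reduces :: "'a::complex_inner set \<Rightarrow> ('a \<Rightarrow> 'a) \<Rightarrow> bool" where
  "reduces M T \<longleftrightarrow> closed_csubspace M \<and> T ` M \<subseteq> M \<and> adj T ` M \<subseteq> M"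

definition Ker :: "('a::complex_inner \<Rightarrow> 'a) \<Rightarrow> 'a set" where
  "Ker T = {x. T x = 0}"

definition normal_on :: "'a::complex_inner set \<Rightarrow> ('a \<Rightarrow> 'a) \<Rightarrow> bool" where
  "normal_on M T \<longleftrightarrow> (\<forall>x\<in>M. adj_on M T (T x) = T (adj_on M T x))"

definition commuting_triple_on ::
    "'a::complex_inner set \<Rightarrow> ('a \<Rightarrow> 'a) \<Rightarrow> ('a \<Rightarrow> 'a) \<Rightarrow> ('a \<Rightarrow> 'a) \<Rightarrow> bool" where
  "commuting_triple_on M A B P \<longleftrightarrow>
     closed_csubspace M \<and> bounded_op_on M A \<and> bounded_op_on M B \<and> bounded_op_on M P \<and>
     (\<forall>x\<in>M. A (B x) = B (A x) \<and> A (P x) = P (A x) \<and> B (P x) = P (B x))"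

definition strong_op_limit :: "(nat \<Rightarrow> 'a::complex_inner \<Rightarrow> 'a) \<Rightarrow> ('a \<Rightarrow> 'a) \<Rightarrow> bool" where
  "strong_op_limit S T \<longleftrightarrow> (\<forall>x. (\<lambda>k. S k x) \<longlonglongrightarrow> T x)"


section \<open>Taylor joint spectrum and spectral sets of triples\<close>

text \<open>
  The Koszul complex \<open>0 \<rightarrow> M \<rightarrow> M\<^sup>3 \<rightarrow> M\<^sup>3 \<rightarrow> M \<rightarrow> 0\<close> of a commuting triple.  Degree one is
  indexed by \<open>e\<^sub>1, e\<^sub>2, e\<^sub>3\<close>, degree two by \<open>e\<^sub>1 \<and> e\<^sub>2, e\<^sub>1 \<and> e\<^sub>3, e\<^sub>2 \<and> e\<^sub>3\<close>.
\<close>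

context
  fixes S\<^sub>1 S\<^sub>2 S\<^sub>3 :: "'a::complex_inner \<Rightarrow> 'a"
begin

definition koszul0 :: "'a \<Rightarrow> 'a \<times> 'a \<times> 'a" where
  "koszul0 x = (S\<^sub>1 x, S\<^sub>2 x, S\<^sub>3 x)"

definition koszul1 :: "'a \<times> 'a \<times> 'a \<Rightarrow> 'a \<times> 'a \<times> 'a" where
  "koszul1 = (\<lambda>(x\<^sub>1, x\<^sub>2, x\<^sub>3). (S\<^sub>1 x\<^sub>2 - S\<^sub>2 x\<^sub>1, S\<^sub>1 x\<^sub>3 - S\<^sub>3 x\<^sub>1, S\<^sub>2 x\<^sub>3 - S\<^sub>3 x\<^sub>2))"

definition koszul2 :: "'a \<times> 'a \<times> 'a \<Rightarrow> 'a" where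
  "koszul2 = (\<lambda>(y\<^sub>1\<^sub>2, y\<^sub>1\<^sub>3, y\<^sub>2\<^sub>3). S\<^sub>1 y\<^sub>2\<^sub>3 - S\<^sub>2 y\<^sub>1\<^sub>3 + S\<^sub>3 y\<^sub>1\<^sub>2)"

definition koszul_exact :: "'a set \<Rightarrow> bool" where
  "koszul_exact M \<longleftrightarrow>
     {x \<in> M. koszul0 x = 0} = {0} \<and>
     {y \<in> M \<times> M \<times> M. koszul1 y = 0} = koszul0 ` M \<and>
     {y \<in> M \<times> M \<times> M. koszul2 y = 0} = koszul1 ` (M \<times> M \<times> M) \<and>
     koszul2 ` (M \<times> M \<times> M) = M"

end

definition taylor_spectrum ::
    "'a::complex_inner set \<Rightarrow> ('a \<Rightarrow> 'a) \<Rightarrow> ('a \<Rightarrow> 'a) \<Rightarrow> ('a \<Rightarrow> 'a) \<Rightarrow> (complex \<times> complex \<times> complex) set"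
  where
  "taylor_spectrum M A B P =
     {(a, b, p). \<not> koszul_exact (\<lambda>x. A x - a *\<^sub>C x) (\<lambda>x. B x - b *\<^sub>C x) (\<lambda>x. P x - p *\<^sub>C x) M}"

text \<open>Polynomials in three variables are finitely supported families of coefficients.\<close>

type_synonym poly3 = "(nat \<times> nat \<times> nat) \<Rightarrow>\<^sub>0 complex"

definition poly3_eval :: "poly3 \<Rightarrow> complex \<times> complex \<times> complex \<Rightarrow> complex" where
  "poly3_eval f = (\<lambda>(x\<^sub>1, x\<^sub>2, x\<^sub>3).
     \<Sum>(i, j, k)\<in>Poly_Mapping.keys f. Poly_Mapping.lookup f (i, j, k) * x\<^sub>1 ^ i * x\<^sub>2 ^ j * x\<^sub>3 ^ k)"

definition poly3_op ::
    "poly3 \<Rightarrow> ('a::complex_inner \<Rightarrow> 'a) \<Rightarrow> ('a \<Rightarrow> 'a) \<Rightarrow> ('a \<Rightarrow> 'a) \<Rightarrow> 'a \<Rightarrow> 'a" where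
  "poly3_op f A B P x =
     (\<Sum>(i, j, k)\<in>Poly_Mapping.keys f.
        Poly_Mapping.lookup f (i, j, k) *\<^sub>C (A ^^ i) ((B ^^ j) ((P ^^ k) x)))"

text \<open>
  A rational function with poles off \<open>K\<close> is \<open>f/g\<close> with \<open>g\<close> zero-free on \<open>K\<close>, and its value at the
  triple is the operator \<open>f(A,B,P) g(A,B,P)\<^sup>-\<^sup>1\<close>.  The invertibility of \<open>g(A,B,P)\<close>, without which that
  operator is undefined, is recorded explicitly; it is automatic once the Taylor
  joint spectrum lies in \<open>K\<close>, by the spectral mapping theorem.
\<close>

definition spectral_set_on ::
    "'a::complex_inner set \<Rightarrow> (complex \<times> complex \<times> complex) set \<Rightarrow>
     ('a \<Rightarrow> 'a) \<Rightarrow> ('a \<Rightarrow> 'a) \<Rightarrow> ('a \<Rightarrow> 'a) \<Rightarrow> bool" where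
  "spectral_set_on M K A B P \<longleftrightarrow>
     compact K \<and> taylor_spectrum M A B P \<subseteq> K \<and>
     (\<forall>f g. (\<forall>z\<in>K. poly3_eval g z \<noteq> 0) \<longrightarrow>
        bij_betw (poly3_op g A B P) M M \<and>
        (\<forall>x\<in>M. norm (poly3_op f A B P (inv_into M (poly3_op g A B P) x))
                 \<le> (SUP z\<in>K. cmod (poly3_eval f z / poly3_eval g z)) * norm x))"


section \<open>The tetrablock and its operator classes\<close>

definition tetrablock :: "(complex \<times> complex \<times> complex) set" where
  "tetrablock = {(x\<^sub>1, x\<^sub>2, x\<^sub>3).
     \<forall>z\<in>cball 0 1. \<forall>w\<in>cball 0 1. 1 - z * x\<^sub>1 - w * x\<^sub>2 + z * w * x\<^sub>3 \<noteq> 0}"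

definition tetrablock_bd :: "(complex \<times> complex \<times> complex) set" where
  "tetrablock_bd = {(a, b, p). (a, b, p) \<in> closure tetrablock \<and> cmod p = 1}"

definition E_contraction ::
    "'a::complex_inner set \<Rightarrow> ('a \<Rightarrow> 'a) \<Rightarrow> ('a \<Rightarrow> 'a) \<Rightarrow> ('a \<Rightarrow> 'a) \<Rightarrow> bool" where
  "E_contraction M A B P \<longleftrightarrow>
     commuting_triple_on M A B P \<and> spectral_set_on M (closure tetrablock) A B P"

definition E_unitary ::
    "'a::complex_inner set \<Rightarrow> ('a \<Rightarrow> 'a) \<Rightarrow> ('a \<Rightarrow> 'a) \<Rightarrow> ('a \<Rightarrow> 'a) \<Rightarrow> bool" where
  "E_unitary M A B P \<longleftrightarrow>
     commuting_triple_on M A B P \<and> normal_on M A \<and> normal_on M B \<and> normal_on M P \<and>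
     taylor_spectrum M A B P \<subseteq> tetrablock_bd"

text \<open>
  The space \<open>K\<close> of the extending \<open>E\<close>-unitary is taken among the closed subspaces of \<open>\<ell>\<^sup>2(\<int>; \<H>)\<close>,
  \<open>\<H>\<close> being the ambient space of \<open>M\<close>, and \<open>M\<close> is identified with the subspace \<open>V ` M\<close> of \<open>K\<close>.
  This covers extensions to arbitrary Hilbert spaces: restricting an extension \<open>(U\<^sub>1, U\<^sub>2, U\<^sub>3)\<close> of
  a triple on \<open>M\<close> to the closed span of the spaces \<open>U\<^sub>3\<^sup>-\<^sup>n M\<close> gives an extension to a space unitarily
  equivalent to \<open>M\<^sub>0 \<oplus> \<ell>\<^sup>2(\<int>; E)\<close> with \<open>M = M\<^sub>0 \<oplus> (\<Oplus>n\<ge>0. P\<^sup>n E)\<close> the Wold decomposition of \<open>P\<close>.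
\<close>

definition E_isometry ::
    "'a::complex_inner set \<Rightarrow> ('a \<Rightarrow> 'a) \<Rightarrow> ('a \<Rightarrow> 'a) \<Rightarrow> ('a \<Rightarrow> 'a) \<Rightarrow> bool" where
  "E_isometry M A B P \<longleftrightarrow>
     commuting_triple_on M A B P \<and>
     (\<exists>(K :: 'a ell2 set) U\<^sub>1 U\<^sub>2 U\<^sub>3 V.
        E_unitary K U\<^sub>1 U\<^sub>2 U\<^sub>3 \<and>
        V ` M \<subseteq> K \<and> clinear_on M V \<and> (\<forall>x\<in>M. norm (V x) = norm x) \<and>
        (\<forall>x\<in>M. V (A x) = U\<^sub>1 (V x) \<and> V (B x) = U\<^sub>2 (V x) \<and> V (P x) = U\<^sub>3 (V x)))"

definition strongly_stable_on :: "'a::complex_inner set \<Rightarrow> ('a \<Rightarrow> 'a) \<Rightarrow> bool" where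
  "strongly_stable_on M P \<longleftrightarrow> (\<forall>x\<in>M. (\<lambda>k. norm ((P ^^ k) x)) \<longlonglongrightarrow> 0)"

definition strongly_stable_E_contraction ::
    "'a::complex_inner set \<Rightarrow> ('a \<Rightarrow> 'a) \<Rightarrow> ('a \<Rightarrow> 'a) \<Rightarrow> ('a \<Rightarrow> 'a) \<Rightarrow> bool" where
  "strongly_stable_E_contraction M A B P \<longleftrightarrow>
     E_contraction M A B P \<and> strongly_stable_on M P"

definition pure_E_contraction ::
    "'a::complex_inner set \<Rightarrow> ('a \<Rightarrow> 'a) \<Rightarrow> ('a \<Rightarrow> 'a) \<Rightarrow> ('a \<Rightarrow> 'a) \<Rightarrow> bool" where
  "pure_E_contraction M A B P \<longleftrightarrow>
     E_contraction M A B P \<and> strongly_stable_on M (adj_on M P)"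

definition C00_E_contraction ::
    "'a::complex_inner set \<Rightarrow> ('a \<Rightarrow> 'a) \<Rightarrow> ('a \<Rightarrow> 'a) \<Rightarrow> ('a \<Rightarrow> 'a) \<Rightarrow> bool" where
  "C00_E_contraction M A B P \<longleftrightarrow>
     E_contraction M A B P \<and> strongly_stable_on M P \<and> strongly_stable_on M (adj_on M P)"

definition pure_E_isometry ::
    "'a::complex_inner set \<Rightarrow> ('a \<Rightarrow> 'a) \<Rightarrow> ('a \<Rightarrow> 'a) \<Rightarrow> ('a \<Rightarrow> 'a) \<Rightarrow> bool" where
  "pure_E_isometry M A B P \<longleftrightarrow> E_isometry M A B P \<and> pure_E_contraction M A B P"

end

theory Submission
  imports Defs
begin

text \<open>
  The decomposition rests on two observations.

  First, a point \<open>(a, b, p)\<close> off the closed tetrablock is a zero of \<open>1 - z x\<^sub>1 - w x\<^sub>2 + z w x\<^sub>3\<close> for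
  some \<open>z, w\<close> in the open unit disc (\<open>closure_tetrablock_iff\<close>).  At a commuting triple this
  polynomial is a linear combination of \<open>A - a\<close>, \<open>B - b\<close>, \<open>P - p\<close>, so that its invertibility makes
  the Koszul complex contractible.  Hence \<open>\<parallel>B x\<parallel> \<le> \<parallel>x\<parallel>\<close> and \<open>\<parallel>(A - w P) x\<parallel> \<le> \<parallel>(1 - w B) x\<parallel>\<close> for
  \<open>|w| < 1\<close> already place the Taylor spectrum in the closed tetrablock
  (\<open>taylor_spectrum_subset_closure_tetrablock\<close>).  As \<open>|x\<^sub>1 - w x\<^sub>3| \<le> |1 - w x\<^sub>2|\<close> on the closed
  tetrablock, these estimates follow from the von Neumann inequality, which passes to reducing
  subspaces and to adjoints (\<open>E_contraction_restrict\<close>, \<open>E_contraction_adj\<close>); and they carry over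
  from a pure isometric triple to its bilateral extension.

  Second, \<open>\<parallel>(1 - w B) y\<parallel>\<^sup>2 - \<parallel>(A - w P) y\<parallel>\<^sup>2\<close> is a positive quadratic form in \<open>y\<close> for \<open>|w| = 1\<close>, and
  likewise with \<open>A\<close> and \<open>B\<close> exchanged.  At a vector \<open>x\<close> with \<open>\<parallel>P x\<parallel> = \<parallel>x\<parallel>\<close> both vanish, so their
  polar forms vanish too, which says \<open>B x = A\<^sup>* P x\<close> and \<open>A x = B\<^sup>* P x\<close>
  (\<open>E_contraction_eq_adj_where_isometric\<close>).

  Let \<open>T\<close> be a projection.  Its kernel, the space where \<open>P\<^sup>k x \<rightarrow> 0\<close>, is invariant under all operators
  commuting with \<open>P\<close>, so its range is invariant under \<open>A\<^sup>*\<close> and \<open>B\<^sup>*\<close>.  On the range \<open>P\<close> is isometric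
  and leaves it invariant; by the second observation the range is then invariant under \<open>A\<close> and \<open>B\<close>
  as well.  The same two equations make the pure part and the unitary part of the isometry reducing
  for \<open>A\<close> and \<open>B\<close>.  On the unitary part they read \<open>A\<^sup>* = P\<^sup>-\<^sup>1 B\<close> and \<open>B\<^sup>* = P\<^sup>-\<^sup>1 A\<close>, which gives
  normality (\<open>E_unitaryI\<close>).  On the pure part the Wold decomposition turns \<open>P\<close> into a unilateral
  shift and \<open>A\<close>, \<open>B\<close> into Toeplitz operators with symbols of degree one, and the bilateral
  extension of the same symbols is the unitary triple that is required
  (\<open>E_unitary_bilateral\<close>).

  The statements about \<open>T\<^sub>s\<close> are those about \<open>T\<close> for the adjoint triple.  If \<open>T = T\<^sub>s\<close>, then \<open>T\<close>
  commutes with \<open>P\<close> and is a projection (\<open>idempotent_if_asymptotic_limits_coincide\<close>).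
\<close>


section \<open>Complex inner products\<close>

lemma scaleC_zero_left [simp]: "0 *\<^sub>C x = 0"
  for x :: "'a::complex_inner"
  using scaleC_of_real[of 0 x] by simp

lemma scaleC_one [simp]: "1 *\<^sub>C x = x"
  for x :: "'a::complex_inner"
  using scaleC_of_real[of 1 x] by simp

lemma scaleC_zero_right [simp]: "c *\<^sub>C 0 = 0"
  for c :: complex
  using scaleC_add_right[of c 0 0] by simp

lemma scaleC_minus_left [simp]: "(- c) *\<^sub>C x = - (c *\<^sub>C x)"
  for x :: "'a::complex_inner"
  using scaleC_add_left[of c "- c" x] by (simp add: eq_neg_iff_add_eq_0 add.commute)

lemma scaleC_minus_right [simp]: "c *\<^sub>C (- x) = - (c *\<^sub>C x)"
  for x :: "'a::complex_inner"
  using scaleC_add_right[of c x "- x"] by (simp add: eq_neg_iff_add_eq_0 add.commute)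

lemma scaleC_diff_left: "(c - d) *\<^sub>C x = c *\<^sub>C x - d *\<^sub>C x"
  for x :: "'a::complex_inner"
  using scaleC_add_left[of c "- d" x] by simp

lemma scaleC_diff_right: "c *\<^sub>C (x - y) = c *\<^sub>C x - c *\<^sub>C y"
  for x :: "'a::complex_inner"
  using scaleC_add_right[of c x "- y"] by simp

lemmas scaleC_algebra =
  scaleC_add_right scaleC_add_left scaleC_diff_right scaleC_diff_left scaleC_scaleC

lemma cinner_add_right: "cinner x (y + z) = cinner x y + cinner x z"
  for x :: "'a::complex_inner"
  by (metis cinner_add_left cinner_commute complex_cnj_add)

lemma cinner_zero_left [simp]: "cinner 0 x = 0"
  for x :: "'a::complex_inner"
  using cinner_add_left[of 0 0 x] by simp

lemma cinner_zero_right [simp]: "cinner x 0 = 0"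
  for x :: "'a::complex_inner"
  using cinner_add_right[of x 0 0] by simp

lemma cinner_minus_left [simp]: "cinner (- x) y = - cinner x y"
  for x :: "'a::complex_inner"
  using cinner_add_left[of x "- x" y] by (simp add: eq_neg_iff_add_eq_0 add.commute)

lemma cinner_minus_right [simp]: "cinner x (- y) = - cinner x y"
  for x :: "'a::complex_inner"
  using cinner_add_right[of x y "- y"] by (simp add: eq_neg_iff_add_eq_0 add.commute)

lemma cinner_diff_left: "cinner (x - y) z = cinner x z - cinner y z"
  for x :: "'a::complex_inner"
  using cinner_add_left[of x "- y" z] by simp

lemma cinner_diff_right: "cinner x (y - z) = cinner x y - cinner x z"
  for x :: "'a::complex_inner"
  using cinner_add_right[of x y "- z"] by simp

lemma cinner_sum_left: "cinner (\<Sum>i\<in>I. f i) y = (\<Sum>i\<in>I. cinner (f i) y)"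
  for f :: "'i \<Rightarrow> 'a::complex_inner"
  by (induction I rule: infinite_finite_induct) (auto simp: cinner_add_left)

lemma cinner_sum_right: "cinner y (\<Sum>i\<in>I. f i) = (\<Sum>i\<in>I. cinner y (f i))"
  for f :: "'i \<Rightarrow> 'a::complex_inner"
  by (induction I rule: infinite_finite_induct) (auto simp: cinner_add_right)

lemmas cinner_algebra = cinner_add_left cinner_add_right cinner_diff_left cinner_diff_right
  cinner_scaleC_left cinner_scaleC_right

lemma cinner_self_eq_0 [simp]: "cinner x x = 0 \<longleftrightarrow> x = 0"
  for x :: "'a::complex_inner"
  by (simp add: cinner_same)

lemma cinner_eqI:
  fixes x y :: "'a::complex_inner"
  assumes "\<And>z. cinner z x = cinner z y"
  shows "x = y"
  using assms[of "x - y"] by (metis cinner_diff_right cinner_self_eq_0 eq_iff_diff_eq_0)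

text \<open>The imaginary part of \<open>cinner x y\<close> is the real part of \<open>cinner (- \<i> *\<^sub>C x) y\<close>.\<close>

lemma cinner_eq_from_inner:
  fixes x x' y y' :: "'a::complex_inner"
  assumes "\<And>c. inner (c *\<^sub>C x) y = inner (c *\<^sub>C x') y'"
  shows "cinner x y = cinner x' y'"
proof (rule complex_eqI)
  show "Re (cinner x y) = Re (cinner x' y')"
    using assms[of 1] by (simp add: Re_cinner)
  show "Im (cinner x y) = Im (cinner x' y')"
    using assms[of "- \<i>"] by (simp add: Re_cinner[symmetric] cinner_scaleC_left)
qed

lemma norm_diff_sq:
  fixes x y :: "'a::complex_inner"
  shows "(norm (x - y))\<^sup>2 = (norm x)\<^sup>2 - 2 * Re (cinner x y) + (norm y)\<^sup>2"
  by (simp add: Re_cinner power2_norm_eq_inner inner_simps inner_commute)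

lemma Re_cinner_commute: "Re (cinner x y) = Re (cinner y x)"
  for x :: "'a::complex_inner"
  by (simp add: Re_cinner inner_commute)

lemma tendsto_cinner [tendsto_intros]:
  fixes f g :: "'b \<Rightarrow> 'a::complex_inner"
  assumes "(f \<longlongrightarrow> x) F" "(g \<longlongrightarrow> y) F"
  shows "((\<lambda>t. cinner (f t) (g t)) \<longlongrightarrow> cinner x y) F"
proof -
  have Im: "Im (cinner u v) = inner ((- \<i>) *\<^sub>C u) v" for u v :: 'a
    by (simp add: Re_cinner[symmetric] cinner_scaleC_left)
  have "((\<lambda>t. (- \<i>) *\<^sub>C f t) \<longlongrightarrow> (- \<i>) *\<^sub>C x) F"
  proof -
    have "dist ((- \<i>) *\<^sub>C u) ((- \<i>) *\<^sub>C v) = dist u v" for u v :: 'a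
      unfolding dist_norm scaleC_diff_right[symmetric] norm_scaleC by simp
    then show ?thesis using assms(1) unfolding tendsto_iff by simp
  qed
  then show ?thesis
    using assms unfolding tendsto_complex_iff Im Re_cinner by (intro conjI tendsto_intros) auto
qed


section \<open>Orthogonal projections and adjoints\<close>

text \<open>A minimising sequence for the distance is Cauchy by the parallelogram law.\<close>

lemma closed_subspace_projection:
  fixes M :: "'a::{real_inner, complete_space} set"
  assumes "closed M" "subspace M"
  obtains y where "y \<in> M" "\<And>z. z \<in> M \<Longrightarrow> inner (x - y) z = 0"
proof -
  define d where "d = infdist x M"
  have ne: "M \<noteq> {}" using assms(2) subspace_0 by blast
  have d0: "d \<ge> 0" by (simp add: d_def infdist_nonneg)
  have "\<exists>y\<in>M. (norm (x - y))\<^sup>2 < d\<^sup>2 + 1 / Suc n" for n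
  proof -
    have "infdist x M < sqrt (d\<^sup>2 + 1 / Suc n)"
      using d0 unfolding d_def[symmetric] by (intro real_less_rsqrt) auto
    then obtain y where "y \<in> M" "dist x y < sqrt (d\<^sup>2 + 1 / Suc n)"
      using ne by (auto simp: infdist_def cINF_less_iff)
    moreover have "sqrt ((norm (x - y))\<^sup>2) = dist x y" by (simp add: dist_norm)
    ultimately show ?thesis by (metis real_sqrt_less_iff)
  qed
  then obtain Y where Y: "\<And>n. Y n \<in> M" "\<And>n. (norm (x - Y n))\<^sup>2 < d\<^sup>2 + 1 / Suc n" by metis
  have dle: "d \<le> norm (x - z)" if "z \<in> M" for z
    unfolding d_def using infdist_le[OF that, of x] by (simp add: dist_norm)
  have close: "(norm (Y m - Y n))\<^sup>2 \<le> 2 / Suc m + 2 / Suc n" for m n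
  proof -
    define c where "c = (1/2) *\<^sub>R (Y m + Y n)"
    have "c \<in> M" unfolding c_def using assms(2) Y(1) by (simp add: subspace_add subspace_scale)
    then have "d\<^sup>2 \<le> (norm (x - c))\<^sup>2" using dle d0 by (simp add: power_mono)
    moreover have "(norm (Y m - Y n))\<^sup>2 =
        2 * (norm (x - Y m))\<^sup>2 + 2 * (norm (x - Y n))\<^sup>2 - 4 * (norm (x - c))\<^sup>2"
      unfolding c_def power2_norm_eq_inner
      by (simp add: inner_simps inner_commute field_simps)
    ultimately show ?thesis using Y(2)[of m] Y(2)[of n] by simp
  qed
  have "Cauchy Y"
  proof (rule metric_CauchyI)
    fix e :: real assume "e > 0"
    then obtain N where N: "1 / Suc N < e\<^sup>2 / 4"
      using nat_approx_posE[of "e\<^sup>2 / 4"] by auto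
    have "dist (Y m) (Y n) < e" if "m \<ge> N" "n \<ge> N" for m n
    proof -
      have "2 / Suc m \<le> 2 / Suc N" "2 / Suc n \<le> 2 / Suc N"
        using that by (auto intro!: divide_left_mono)
      then have "(norm (Y m - Y n))\<^sup>2 < e\<^sup>2" using close[of m n] N by simp
      then show ?thesis using \<open>e > 0\<close> power_less_imp_less_base[of "norm (Y m - Y n)" 2 e]
        by (simp add: dist_norm)
    qed
    then show "\<exists>M. \<forall>m\<ge>M. \<forall>n\<ge>M. dist (Y m) (Y n) < e" by blast
  qed
  then obtain y where y: "Y \<longlonglongrightarrow> y"
    using Cauchy_convergent convergent_def by blast
  have yM: "y \<in> M" using closed_sequentially[OF assms(1) _ y] Y(1) by blast
  have "(norm (x - y))\<^sup>2 \<le> d\<^sup>2 + 0"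
  proof (rule LIMSEQ_le)
    show "(\<lambda>n. (norm (x - Y n))\<^sup>2) \<longlonglongrightarrow> (norm (x - y))\<^sup>2"
      by (intro tendsto_intros y)
    show "(\<lambda>n. d\<^sup>2 + 1 / Suc n) \<longlonglongrightarrow> d\<^sup>2 + 0"
      by (intro tendsto_intros LIMSEQ_Suc lim_1_over_n)
    show "\<exists>N. \<forall>n\<ge>N. (norm (x - Y n))\<^sup>2 \<le> d\<^sup>2 + 1 / Suc n"
      using Y(2) by (meson less_imp_le)
  qed
  then have min: "(norm (x - y))\<^sup>2 \<le> (norm (x - z))\<^sup>2" if "z \<in> M" for z
    using dle[OF that] d0 power_mono[of d "norm (x - z)" 2] by linarith
  have "inner (x - y) z = 0" if z: "z \<in> M" for z
  proof (cases "z = 0")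
    case False
    define t where "t = inner (x - y) z / (norm z)\<^sup>2"
    have tz: "t * (norm z)\<^sup>2 = inner (x - y) z" using False by (simp add: t_def)
    have "y + t *\<^sub>R z \<in> M" using assms(2) yM z by (simp add: subspace_add subspace_scale)
    from min[OF this] have "0 \<le> - 2 * t * inner (x - y) z + t * (t * (norm z)\<^sup>2)"
      unfolding power2_norm_eq_inner by (simp add: inner_simps inner_commute algebra_simps)
    then have "t * inner (x - y) z \<le> 0" unfolding tz by simp
    then have "(inner (x - y) z)\<^sup>2 \<le> 0"
      using False by (auto simp: t_def power2_eq_square divide_le_0_iff mult_le_0_iff)
    then show ?thesis by simp
  qed simp
  with yM that show thesis by blast
qed

lemma riesz_representation:
  fixes f :: "'a::{real_inner, complete_space} \<Rightarrow> real"
  assumes "bounded_linear f"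
  obtains y where "\<And>x. f x = inner x y"
proof (cases "\<forall>x. f x = 0")
  case True
  then show ?thesis using that[of 0] by simp
next
  case False
  interpret bounded_linear f by fact
  obtain x where x: "f x \<noteq> 0" using False by blast
  have closed: "closed {x. f x = 0}"
    by (intro closed_Collect_eq continuous_intros linear_continuous_on assms)
  have sub: "subspace {x. f x = 0}"
    by (auto simp: subspace_def zero add scaleR)
  obtain u where "u \<in> {x. f x = 0}" "\<And>z. z \<in> {x. f x = 0} \<Longrightarrow> inner (x - u) z = 0"
    using closed_subspace_projection[OF closed sub, of x] by metis
  then have u: "f u = 0" "\<And>z. f z = 0 \<Longrightarrow> inner (x - u) z = 0" by auto
  define v where "v = x - u"
  have v: "f v \<noteq> 0" "v \<noteq> 0" using x u by (auto simp: v_def diff zero)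
  have "f z = inner z ((f v / (norm v)\<^sup>2) *\<^sub>R v)" for z
  proof -
    have "f (f v *\<^sub>R z - f z *\<^sub>R v) = 0" by (simp add: diff scaleR)
    then have "inner v (f v *\<^sub>R z - f z *\<^sub>R v) = 0" using u(2) by (simp add: v_def)
    then show ?thesis using v by (simp add: inner_simps inner_commute power2_norm_eq_inner field_simps)
  qed
  then show ?thesis by (rule that)
qed

lemma closed_csubspace_imp_subspace: "closed_csubspace M \<Longrightarrow> subspace M"
  unfolding closed_csubspace_def subspace_def by (metis scaleC_of_real)

lemma csub_simps:
  assumes "closed_csubspace M"
  shows "0 \<in> M" "x \<in> M \<Longrightarrow> y \<in> M \<Longrightarrow> x + y \<in> M" "x \<in> M \<Longrightarrow> y \<in> M \<Longrightarrow> x - y \<in> M"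
    "x \<in> M \<Longrightarrow> - x \<in> M" "x \<in> M \<Longrightarrow> c *\<^sub>C x \<in> M" "x \<in> M \<Longrightarrow> r *\<^sub>R x \<in> M" "closed M"
  using assms subspace_diff[OF closed_csubspace_imp_subspace[OF assms]]
    subspace_neg[OF closed_csubspace_imp_subspace[OF assms]]
    subspace_scale[OF closed_csubspace_imp_subspace[OF assms]]
  by (auto simp: closed_csubspace_def)

lemma csub_sum:
  "closed_csubspace M \<Longrightarrow> (\<And>i. i \<in> I \<Longrightarrow> f i \<in> M) \<Longrightarrow> (\<Sum>i\<in>I. f i) \<in> M"
  by (induction I rule: infinite_finite_induct) (auto simp: csub_simps)

lemma closed_csubspace_UNIV [simp]: "closed_csubspace UNIV"
  by (simp add: closed_csubspace_def)

lemma closed_csubspace_Int: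
  "closed_csubspace M \<Longrightarrow> closed_csubspace N \<Longrightarrow> closed_csubspace (M \<inter> N)"
  by (auto simp: closed_csubspace_def)

lemma csub_decompose:
  fixes M :: "'a::chilbert_space set"
  assumes "closed_csubspace M"
  obtains y where "y \<in> M" "\<And>z. z \<in> M \<Longrightarrow> cinner (x - y) z = 0"
proof -
  obtain y where y: "y \<in> M" "\<And>z. z \<in> M \<Longrightarrow> inner (x - y) z = 0"
    using closed_subspace_projection[OF csub_simps(7)[OF assms]
        closed_csubspace_imp_subspace[OF assms], of x] by metis
  have "cinner (x - y) z = 0" if "z \<in> M" for z
  proof -
    have "inner (c *\<^sub>C (x - y)) z = 0" for c
      using y(2)[of "cnj c *\<^sub>C z"] that assms
      by (simp add: Re_cinner[symmetric] cinner_scaleC_right cinner_scaleC_left csub_simps)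
    then show ?thesis using cinner_eq_from_inner[of "x - y" z 0 0] by simp
  qed
  with y that show thesis by blast
qed

abbreviation bop :: "('a::complex_inner \<Rightarrow> 'a) \<Rightarrow> bool" where
  "bop \<equiv> bounded_op_on UNIV"

lemma bopI:
  assumes "\<And>x y. T (x + y) = T x + T y" "\<And>c x. T (c *\<^sub>C x) = c *\<^sub>C T x"
    "\<And>x. norm (T x) \<le> C * norm x"
  shows "bop T"
  using assms unfolding bounded_op_on_def clinear_on_def by auto

lemma
  assumes "bop T"
  shows bop_add: "T (x + y) = T x + T y"
    and bop_scaleC: "T (c *\<^sub>C x) = c *\<^sub>C T x"
    and bop_zero: "T 0 = 0"
    and bop_diff: "T (x - y) = T x - T y"
proof -
  have add: "T (x + y) = T x + T y" for x y
    using assms by (auto simp: bounded_op_on_def clinear_on_def)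
  have sc: "T (c *\<^sub>C x) = c *\<^sub>C T x" for c x
    using assms by (auto simp: bounded_op_on_def clinear_on_def)
  have minus: "T (- x) = - T x" for x using sc[of "- 1" x] by simp
  show "T (x + y) = T x + T y" "T (c *\<^sub>C x) = c *\<^sub>C T x"
    by (rule add sc)+
  show "T 0 = 0" using sc[of 0 0] by simp
  show "T (x - y) = T x - T y" using add[of x "- y"] minus by simp
qed

lemma bop_sum: "bop T \<Longrightarrow> T (\<Sum>i\<in>I. f i) = (\<Sum>i\<in>I. T (f i))"
  by (induction I rule: infinite_finite_induct) (auto simp: bop_zero bop_add)

lemma bop_bound:
  assumes "bop T"
  obtains C where "C \<ge> 0" "\<And>x. norm (T x) \<le> C * norm x"
proof -
  obtain C where C: "\<And>x. norm (T x) \<le> C * norm x"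
    using assms by (auto simp: bounded_op_on_def)
  have "norm (T x) \<le> \<bar>C\<bar> * norm x" for x
    using C[of x] by (meson abs_ge_self mult_right_mono norm_ge_zero order_trans)
  then show thesis using that[of "\<bar>C\<bar>"] by simp
qed

lemma bop_bounded_linear:
  assumes "bop T"
  shows "bounded_linear T"
proof -
  obtain C where "\<And>x. norm (T x) \<le> C * norm x" using bop_bound[OF assms] by blast
  then show ?thesis
    by (intro bounded_linear_intro[where K = C])
      (auto simp: bop_add[OF assms] bop_scaleC[OF assms] scaleC_of_real[symmetric] mult.commute)
qed

lemma bop_tendsto: "bop T \<Longrightarrow> (f \<longlongrightarrow> x) F \<Longrightarrow> ((\<lambda>t. T (f t)) \<longlongrightarrow> T x) F"
  using bop_bounded_linear bounded_linear.tendsto by blast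

lemma bop_continuous_on: "bop T \<Longrightarrow> continuous_on S T"
  using bop_bounded_linear linear_continuous_on by blast

lemma bop_id: "bop (\<lambda>x. x)"
  by (rule bopI[where C = 1]) auto

lemma bop_comp:
  assumes "bop S" "bop T"
  shows "bop (\<lambda>x. S (T x))"
proof -
  obtain C where C: "C \<ge> 0" "\<And>x. norm (S x) \<le> C * norm x" using bop_bound[OF assms(1)] by blast
  obtain D where D: "D \<ge> 0" "\<And>x. norm (T x) \<le> D * norm x" using bop_bound[OF assms(2)] by blast
  show ?thesis
  proof (rule bopI[where C = "C * D"])
    fix x
    have "norm (S (T x)) \<le> C * norm (T x)" by (rule C)
    also have "\<dots> \<le> C * (D * norm x)" by (intro mult_left_mono C D)
    finally show "norm (S (T x)) \<le> C * D * norm x" by simp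
  qed (simp_all add: bop_add[OF assms(1)] bop_add[OF assms(2)] bop_scaleC[OF assms(1)]
      bop_scaleC[OF assms(2)])
qed

lemma bop_plus:
  assumes "bop S" "bop T"
  shows "bop (\<lambda>x. S x + T x)"
proof -
  obtain C where C: "\<And>x. norm (S x) \<le> C * norm x" using bop_bound[OF assms(1)] by blast
  obtain D where D: "\<And>x. norm (T x) \<le> D * norm x" using bop_bound[OF assms(2)] by blast
  show ?thesis
  proof (rule bopI[where C = "C + D"])
    fix x
    show "norm (S x + T x) \<le> (C + D) * norm x"
      using norm_triangle_ineq[of "S x" "T x"] C[of x] D[of x] by (simp add: algebra_simps)
  qed (simp_all add: bop_add[OF assms(1)] bop_add[OF assms(2)] bop_scaleC[OF assms(1)]
      bop_scaleC[OF assms(2)] scaleC_add_right)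
qed

lemma bop_scale:
  assumes "bop T"
  shows "bop (\<lambda>x. c *\<^sub>C T x)"
proof -
  obtain D where D: "\<And>x. norm (T x) \<le> D * norm x" using bop_bound[OF assms(1)] by blast
  show ?thesis
  proof (rule bopI[where C = "cmod c * D"])
    fix x
    show "norm (c *\<^sub>C T x) \<le> cmod c * D * norm x"
      using mult_left_mono[OF D[of x], of "cmod c"] by (simp add: norm_scaleC)
  qed (simp_all add: bop_add[OF assms(1)] bop_scaleC[OF assms(1)] scaleC_add_right scaleC_scaleC
      mult.commute)
qed

lemma bop_minus_op:
  assumes "bop S" "bop T"
  shows "bop (\<lambda>x. S x - T x)"
  using bop_plus[OF assms(1) bop_scale[OF assms(2), of "- 1"]] by simp

lemma bop_sum_op: "(\<And>i. i \<in> I \<Longrightarrow> bop (T i)) \<Longrightarrow> bop (\<lambda>x. \<Sum>i\<in>I. T i x)"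
proof (induction I rule: infinite_finite_induct)
  case (insert i I)
  then show ?case using bop_plus[of "T i" "\<lambda>x. \<Sum>i\<in>I. T i x"] by simp
qed (auto intro: bopI[where C = 0])

lemma bop_funpow: "bop T \<Longrightarrow> bop (T ^^ n)"
proof (induction n)
  case (Suc n)
  then show ?case using bop_comp[of T "T ^^ n"] by (simp add: comp_def)
qed (simp add: bop_id id_def)

text \<open>Adjoints of operators on the whole space exist by the Riesz representation.\<close>

lemma adj_on_eqI:
  fixes M :: "'a::complex_inner set"
  assumes "closed_csubspace M" "y \<in> M" "\<And>z. z \<in> M \<Longrightarrow> cinner (T z) x = cinner z y"
  shows "adj_on M T x = y"
  unfolding adj_on_def
proof (rule the_equality)
  fix y' assume y': "y' \<in> M \<and> (\<forall>z\<in>M. cinner (T z) x = cinner z y')"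
  have "y' - y \<in> M" using y' assms by (simp add: csub_simps)
  then have "cinner (y' - y) (y' - y) = 0"
    using y' assms(3) by (simp add: cinner_diff_right)
  then show "y' = y" by simp
qed (use assms in auto)

lemma cinner_adj_right:
  fixes T :: "'a::chilbert_space \<Rightarrow> 'a"
  assumes "bop T"
  shows "cinner (T z) x = cinner z (adj T x)"
proof -
  have "bounded_linear (\<lambda>z. inner (T z) x)"
    by (intro bounded_linear_compose[OF bounded_linear_inner_left bop_bounded_linear[OF assms]])
  then obtain y where y: "\<And>z. inner (T z) x = inner z y"
    using riesz_representation by blast
  have c: "cinner (T z) x = cinner z y" for z
    by (rule cinner_eq_from_inner) (simp add: y bop_scaleC[OF assms, symmetric])
  then have "adj T x = y" by (intro adj_on_eqI) auto
  with c show ?thesis by simp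
qed

lemma cinner_adj_left:
  fixes T :: "'a::chilbert_space \<Rightarrow> 'a"
  assumes "bop T"
  shows "cinner (adj T x) z = cinner x (T z)"
  using arg_cong[OF cinner_adj_right[OF assms, of z x], of cnj]
  by (simp only: cinner_commute[symmetric])

lemma norm_le_from_cinner:
  fixes u :: "'a::complex_inner"
  assumes "\<And>v. cmod (cinner v u) \<le> c * norm v" "c \<ge> 0"
  shows "norm u \<le> c"
proof (cases "u = 0")
  case True
  then show ?thesis using assms(2) by simp
next
  case False
  have "norm u * norm u = cmod (cinner u u)"
    unfolding cinner_same norm_of_real by (simp add: power2_eq_square)
  also have "\<dots> \<le> c * norm u" by (rule assms(1))
  finally show ?thesis using False mult_right_le_imp_le[of "norm u" "norm u" c] by simp
qed

lemma adj_bound: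
  fixes T :: "'a::chilbert_space \<Rightarrow> 'a"
  assumes "bop T" "\<And>x. norm (T x) \<le> C * norm x" "C \<ge> 0"
  shows "norm (adj T x) \<le> C * norm x"
proof (rule norm_le_from_cinner)
  fix v
  have "cmod (cinner v (adj T x)) \<le> norm (T v) * norm x"
    using cmod_cinner_le[of "T v" x] by (simp add: cinner_adj_right[OF assms(1)])
  also have "\<dots> \<le> C * norm v * norm x" by (intro mult_right_mono assms) auto
  finally show "cmod (cinner v (adj T x)) \<le> C * norm x * norm v" by (simp add: ac_simps)
qed (use assms(3) in simp)

lemma bop_adj:
  fixes T :: "'a::chilbert_space \<Rightarrow> 'a"
  assumes "bop T"
  shows "bop (adj T)"
proof -
  obtain C where C: "C \<ge> 0" "\<And>x. norm (T x) \<le> C * norm x" using bop_bound[OF assms] by blast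
  show ?thesis
  proof (rule bopI[OF _ _ adj_bound[OF assms C(2,1)]])
    show "adj T (x + y) = adj T x + adj T y" for x y
      by (rule cinner_eqI) (simp add: cinner_adj_right[OF assms, symmetric] cinner_add_right)
    show "adj T (c *\<^sub>C x) = c *\<^sub>C adj T x" for c x
      by (rule cinner_eqI) (simp add: cinner_adj_right[OF assms, symmetric] cinner_scaleC_right)
  qed
qed

lemma adj_adj:
  fixes T :: "'a::chilbert_space \<Rightarrow> 'a"
  assumes "bop T"
  shows "adj (adj T) = T"
  by (rule ext, rule cinner_eqI)
    (simp add: cinner_adj_right[OF bop_adj[OF assms], symmetric] cinner_adj_left[OF assms])

lemma adj_commute:
  fixes S T :: "'a::chilbert_space \<Rightarrow> 'a"
  assumes "bop S" "bop T" "\<And>x. S (T x) = T (S x)"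
  shows "adj S (adj T x) = adj T (adj S x)"
  by (rule cinner_eqI)
    (simp add: cinner_adj_right[OF assms(1), symmetric] cinner_adj_right[OF assms(2), symmetric]
      assms(3))

lemma cinner_funpow_adj:
  fixes T :: "'a::chilbert_space \<Rightarrow> 'a"
  assumes "bop T"
  shows "cinner ((T ^^ n) x) y = cinner x ((adj T ^^ n) y)"
  by (induction n arbitrary: x) (simp_all add: cinner_adj_right[OF assms] funpow_swap1)

lemma funpow_commute:
  assumes "\<And>x. f (g x) = g (f x)"
  shows "(f ^^ m) ((g ^^ n) x) = (g ^^ n) ((f ^^ m) x)"
proof -
  have "f ((g ^^ n) x) = (g ^^ n) (f x)" for x
    by (induction n) (auto simp: assms)
  then show ?thesis by (induction m) auto
qed

text \<open>On a reducing subspace the adjoint of the restriction is the restriction of the adjoint.\<close>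

lemma adj_on_reduces:
  fixes T :: "'a::chilbert_space \<Rightarrow> 'a"
  assumes "reduces M T" "bop T" "x \<in> M"
  shows "adj_on M T x = adj T x"
  using assms by (intro adj_on_eqI) (auto simp: reduces_def cinner_adj_right)

lemma reduces_adj:
  fixes T :: "'a::chilbert_space \<Rightarrow> 'a"
  assumes "bop T"
  shows "reduces M (adj T) \<longleftrightarrow> reduces M T"
  using assms by (auto simp: reduces_def adj_adj)

lemma reduces_Int: "reduces M T \<Longrightarrow> reduces N T \<Longrightarrow> reduces (M \<inter> N) T"
  by (auto simp: reduces_def closed_csubspace_Int)

lemma closed_csubspace_Ker:
  assumes "bop T"
  shows "closed_csubspace (Ker T)"
proof -
  have "closed {x. T x = 0}"
    by (intro closed_Collect_eq bop_continuous_on assms continuous_intros)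
  then show ?thesis
    unfolding closed_csubspace_def Ker_def
    by (auto simp: bop_zero[OF assms] bop_add[OF assms] bop_scaleC[OF assms])
qed


section \<open>Geometry of the closed tetrablock\<close>

lemma tetrablock_swap: "(a, b, p) \<in> tetrablock \<Longrightarrow> (b, a, p) \<in> tetrablock"
  unfolding tetrablock_def
proof safe
  fix z w :: complex
  assume "\<forall>z\<in>cball 0 1. \<forall>w\<in>cball 0 1. 1 - z * a - w * b + z * w * p \<noteq> 0"
    "z \<in> cball 0 1" "w \<in> cball 0 1"
  then have "1 - w * a - z * b + w * z * p \<noteq> 0" by blast
  moreover assume "1 - z * b - w * a + z * w * p = 0"
  ultimately show False by (simp add: algebra_simps)
qed

text \<open>
  For a fixed \<open>w\<close> the defining expression is the affine function
  \<open>(1 - w b) - z (a - w p)\<close> of \<open>z\<close>, which has no zero in the closed unit disc exactly if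
  \<open>a - w p\<close> is smaller in modulus than \<open>1 - w b\<close>.
\<close>

lemma tetrablock_imp_less:
  assumes "(a, b, p) \<in> tetrablock" "cmod w \<le> 1"
  shows "cmod (a - w * p) < cmod (1 - w * b)"
proof (rule ccontr)
  assume not: "\<not> cmod (a - w * p) < cmod (1 - w * b)"
  have nz: "1 - z * a - w * b + z * w * p \<noteq> 0" if "cmod z \<le> 1" for z
    using assms that by (auto simp: tetrablock_def)
  have "1 - w * b \<noteq> 0" using nz[of 0] by simp
  with not have ap: "a - w * p \<noteq> 0" by auto
  define z where "z = (1 - w * b) / (a - w * p)"
  have "cmod z \<le> 1" using not ap by (simp add: z_def norm_divide)
  moreover have "z * (a - w * p) = 1 - w * b" using ap by (simp add: z_def)
  then have "1 - z * a - w * b + z * w * p = 0" by (simp add: algebra_simps)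
  ultimately show False using nz by blast
qed

lemma tetrablock_imp_less_1: "(a, b, p) \<in> tetrablock \<Longrightarrow> cmod b < 1"
proof (rule ccontr)
  assume *: "(a, b, p) \<in> tetrablock" "\<not> cmod b < 1"
  then have "b \<noteq> 0" "cmod (1 / b) \<le> 1" by (auto simp: norm_divide divide_le_eq_1)
  then show False using tetrablock_imp_less[OF *(1), of "1 / b"] by simp
qed

lemma closure_tetrablock_le:
  assumes "(a, b, p) \<in> closure tetrablock" "cmod w \<le> 1"
  shows "cmod (a - w * p) \<le> cmod (1 - w * b)" "cmod (b - w * p) \<le> cmod (1 - w * a)" "cmod b \<le> 1"
proof -
  let ?S = "{x. cmod (fst x - w * snd (snd x)) \<le> cmod (1 - w * fst (snd x)) \<and>
      cmod (fst (snd x) - w * snd (snd x)) \<le> cmod (1 - w * fst x) \<and> cmod (fst (snd x)) \<le> 1}"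
  have "closed ?S"
    by (intro closed_Collect_conj closed_Collect_le continuous_intros)
  moreover have "tetrablock \<subseteq> ?S"
    using tetrablock_imp_less tetrablock_swap tetrablock_imp_less_1 assms(2)
    by (fastforce intro: less_imp_le)
  ultimately have "closure tetrablock \<subseteq> ?S" by (rule closure_minimal[rotated])
  then show "cmod (a - w * p) \<le> cmod (1 - w * b)" "cmod (b - w * p) \<le> cmod (1 - w * a)" "cmod b \<le> 1"
    using assms by auto
qed

text \<open>
  Dilating by \<open>(a, b, p) \<mapsto> (r a, r b, r\<^sup>2 p)\<close> with \<open>r < 1\<close> amounts to evaluating the defining
  expression at \<open>(r z, r w)\<close>, hence moves a point of the right-hand side into the open tetrablock.
\<close>

lemma closure_tetrablock_iff:
  "(a, b, p) \<in> closure tetrablock \<longleftrightarrow>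
     (\<forall>z w. cmod z < 1 \<longrightarrow> cmod w < 1 \<longrightarrow> 1 - z * a - w * b + z * w * p \<noteq> 0)"
  (is "?L \<longleftrightarrow> ?R")
proof
  assume ?L
  show ?R
  proof (intro allI impI notI)
    fix z w :: complex
    assume z: "cmod z < 1" and w: "cmod w < 1" and eq: "1 - z * a - w * b + z * w * p = 0"
    note le = closure_tetrablock_le[OF \<open>?L\<close> less_imp_le[OF w]]
    have "cmod (w * b) \<le> cmod w * 1"
      using le(3) by (simp add: norm_mult mult_left_le)
    with w have "w * b \<noteq> 1" by auto
    then have pos: "cmod (1 - w * b) > 0" by simp
    have "1 - w * b = z * (a - w * p)" using eq by (simp add: algebra_simps)
    then have "cmod (1 - w * b) = cmod z * cmod (a - w * p)" by (metis norm_mult)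
    also have "\<dots> \<le> cmod z * cmod (1 - w * b)" using le(1) by (intro mult_left_mono) auto
    also have "\<dots> < cmod (1 - w * b)" using z pos by simp
    finally show False by simp
  qed
next
  assume R: ?R
  define r where "r n = complex_of_real (1 - 1 / real (Suc n))" for n
  have r1: "cmod (r n) < 1" for n
    by (simp only: r_def norm_of_real) (auto simp: field_simps)
  have lim: "r \<longlonglongrightarrow> complex_of_real (1 - 0)"
    unfolding r_def by (intro tendsto_intros LIMSEQ_Suc lim_1_over_n)
  have "(r n * a, r n * b, (r n)\<^sup>2 * p) \<in> tetrablock" for n
    unfolding tetrablock_def
  proof (safe)
    fix z w :: complex
    assume "z \<in> cball 0 1" "w \<in> cball 0 1"
    then have "cmod (r n * z) < 1" "cmod (r n * w) < 1"
      using r1[of n] by (simp_all add: norm_mult)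
        (metis mult.commute mult_left_le_one_le norm_ge_zero order_le_less_trans)+
    then have "1 - (r n * z) * a - (r n * w) * b + (r n * z) * (r n * w) * p \<noteq> 0"
      using R by blast
    moreover assume "1 - z * (r n * a) - w * (r n * b) + z * w * ((r n)\<^sup>2 * p) = 0"
    ultimately show False by (simp add: power2_eq_square ac_simps)
  qed
  moreover have "(\<lambda>n. (r n * a, r n * b, (r n)\<^sup>2 * p)) \<longlonglongrightarrow> (1 * a, 1 * b, 1\<^sup>2 * p)"
    using lim by (intro tendsto_intros) simp_all
  ultimately show ?L
    unfolding closure_sequential mult_1 power_one
    by (intro exI[of _ "\<lambda>n. (r n * a, r n * b, (r n)\<^sup>2 * p)"]) simp
qed

lemma closure_tetrablock_cnj:
  assumes "(a, b, p) \<in> closure tetrablock"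
  shows "(cnj a, cnj b, cnj p) \<in> closure tetrablock"
  unfolding closure_tetrablock_iff
proof (intro allI impI notI)
  fix z w
  assume *: "cmod z < 1" "cmod w < 1" and "1 - z * cnj a - w * cnj b + z * w * cnj p = 0"
  then have "cnj (1 - z * cnj a - w * cnj b + z * w * cnj p) = 0" by simp
  with * have "cmod (cnj z) < 1" "cmod (cnj w) < 1"
    "1 - cnj z * a - cnj w * b + cnj z * cnj w * p = 0"
    by simp_all
  then show False using assms unfolding closure_tetrablock_iff by blast
qed

lemma zero_in_tetrablock: "(0, 0, 0) \<in> tetrablock"
  by (simp add: tetrablock_def)


section \<open>Exactness of the Koszul complex\<close>

lemma
  assumes "closed_csubspace M" "clinear_on M T"
  shows clinear_on_add: "x \<in> M \<Longrightarrow> y \<in> M \<Longrightarrow> T (x + y) = T x + T y"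
    and clinear_on_scale: "x \<in> M \<Longrightarrow> T (c *\<^sub>C x) = c *\<^sub>C T x"
    and clinear_on_zero: "T 0 = 0"
    and clinear_on_minus: "x \<in> M \<Longrightarrow> T (- x) = - T x"
    and clinear_on_diff: "x \<in> M \<Longrightarrow> y \<in> M \<Longrightarrow> T (x - y) = T x - T y"
proof -
  have add: "T (x + y) = T x + T y" if "x \<in> M" "y \<in> M" for x y
    using assms that by (auto simp: clinear_on_def)
  have scale: "T (c *\<^sub>C x) = c *\<^sub>C T x" if "x \<in> M" for c x
    using assms that by (auto simp: clinear_on_def)
  have minus: "T (- x) = - T x" if "x \<in> M" for x
    using scale[OF that, of "- 1"] by simp
  show "x \<in> M \<Longrightarrow> y \<in> M \<Longrightarrow> T (x + y) = T x + T y" "x \<in> M \<Longrightarrow> T (c *\<^sub>C x) = c *\<^sub>C T x"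
    "x \<in> M \<Longrightarrow> T (- x) = - T x"
    by (fact add scale minus)+
  show "T 0 = 0" using scale[of 0 0] assms(1) by (simp add: csub_simps)
  show "T (x - y) = T x - T y" if "x \<in> M" "y \<in> M"
    using add[OF that(1), of "- y"] minus[OF that(2)] assms(1) that by (simp add: csub_simps)
qed

text \<open>
  If the ideal generated by the triple contains an invertible operator
  \<open>G = \<alpha> S\<^sub>1 + \<beta> S\<^sub>2 + \<gamma> S\<^sub>3\<close>, then contraction with \<open>(\<alpha>, \<beta>, \<gamma>)\<close> followed by \<open>G\<^sup>-\<^sup>1\<close> is a
  contracting homotopy of the Koszul complex.
\<close>

lemma koszul_exact_if_combination_bij:
  fixes M :: "'a::complex_inner set"
  assumes M: "closed_csubspace M"
    and S: "S\<^sub>1 ` M \<subseteq> M" "S\<^sub>2 ` M \<subseteq> M" "S\<^sub>3 ` M \<subseteq> M"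
      "clinear_on M S\<^sub>1" "clinear_on M S\<^sub>2" "clinear_on M S\<^sub>3"
    and comm: "\<And>x. x \<in> M \<Longrightarrow> S\<^sub>1 (S\<^sub>2 x) = S\<^sub>2 (S\<^sub>1 x)" "\<And>x. x \<in> M \<Longrightarrow> S\<^sub>1 (S\<^sub>3 x) = S\<^sub>3 (S\<^sub>1 x)"
      "\<And>x. x \<in> M \<Longrightarrow> S\<^sub>2 (S\<^sub>3 x) = S\<^sub>3 (S\<^sub>2 x)"
    and G: "\<And>x. x \<in> M \<Longrightarrow> G x = \<alpha> *\<^sub>C S\<^sub>1 x + \<beta> *\<^sub>C S\<^sub>2 x + \<gamma> *\<^sub>C S\<^sub>3 x"
    and bij: "\<And>y. y \<in> M \<Longrightarrow> \<exists>!x. x \<in> M \<and> G x = y"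
  shows "koszul_exact S\<^sub>1 S\<^sub>2 S\<^sub>3 M"
proof -
  note [simp] = csub_simps[OF M]
  have [simp]: "S\<^sub>1 x \<in> M" "S\<^sub>2 x \<in> M" "S\<^sub>3 x \<in> M" if "x \<in> M" for x
    using S that by auto
  note lin = clinear_on_add[OF M] clinear_on_scale[OF M] clinear_on_zero[OF M]
    clinear_on_minus[OF M] clinear_on_diff[OF M]
  note l = lin[OF S(4)] lin[OF S(5)] lin[OF S(6)] scaleC_algebra
  have GM: "G x \<in> M" if "x \<in> M" for x using that by (simp add: G)
  have cG: "S\<^sub>1 (G x) = G (S\<^sub>1 x)" "S\<^sub>2 (G x) = G (S\<^sub>2 x)" "S\<^sub>3 (G x) = G (S\<^sub>3 x)" if "x \<in> M" for x
    using that by (simp_all add: G l comm)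
  have Gadd: "G (x + y) = G x + G y" "G (x - y) = G x - G y" if "x \<in> M" "y \<in> M" for x y
    using that by (simp_all add: G l algebra_simps)
  have G0: "G 0 = 0" by (simp add: G l)
  define R where "R y = (THE x. x \<in> M \<and> G x = y)" for y
  have R: "R y \<in> M" "G (R y) = y" if "y \<in> M" for y
    using theI'[OF bij[OF that]] by (auto simp: R_def)
  have inj: "x = y" if "x \<in> M" "y \<in> M" "G x = G y" for x y
    using bij[OF GM[OF that(1)]] that by auto
  have "{x \<in> M. koszul0 S\<^sub>1 S\<^sub>2 S\<^sub>3 x = 0} = {0}"
  proof -
    have "x = 0" if "x \<in> M" "S\<^sub>1 x = 0" "S\<^sub>2 x = 0" "S\<^sub>3 x = 0" for x
      using that by - (rule inj, auto simp: G l)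
    then show ?thesis by (auto simp: koszul0_def zero_prod_def l)
  qed
  moreover have "{y \<in> M \<times> M \<times> M. koszul1 S\<^sub>1 S\<^sub>2 S\<^sub>3 y = 0} = koszul0 S\<^sub>1 S\<^sub>2 S\<^sub>3 ` M"
  proof (intro equalityI subsetI)
    fix y assume "y \<in> {y \<in> M \<times> M \<times> M. koszul1 S\<^sub>1 S\<^sub>2 S\<^sub>3 y = 0}"
    then obtain x1 x2 x3 where y: "y = (x1, x2, x3)" and x [simp]: "x1 \<in> M" "x2 \<in> M" "x3 \<in> M"
      and e: "S\<^sub>1 x2 = S\<^sub>2 x1" "S\<^sub>1 x3 = S\<^sub>3 x1" "S\<^sub>2 x3 = S\<^sub>3 x2"
      by (auto simp: koszul1_def zero_prod_def)
    define u where "u = \<alpha> *\<^sub>C x1 + \<beta> *\<^sub>C x2 + \<gamma> *\<^sub>C x3"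
    have u [simp]: "u \<in> M" by (simp add: u_def)
    have "S\<^sub>1 (R u) = x1" "S\<^sub>2 (R u) = x2" "S\<^sub>3 (R u) = x3"
      by (rule inj; simp add: R cG[symmetric]; simp add: u_def G l e)+
    then show "y \<in> koszul0 S\<^sub>1 S\<^sub>2 S\<^sub>3 ` M"
      unfolding y koszul0_def using R(1)[OF u] by (intro image_eqI[of _ _ "R u"]) auto
  next
    fix y assume "y \<in> koszul0 S\<^sub>1 S\<^sub>2 S\<^sub>3 ` M"
    then show "y \<in> {y \<in> M \<times> M \<times> M. koszul1 S\<^sub>1 S\<^sub>2 S\<^sub>3 y = 0}"
      by (auto simp: koszul0_def koszul1_def zero_prod_def comm)
  qed
  moreover have "{y \<in> M \<times> M \<times> M. koszul2 S\<^sub>1 S\<^sub>2 S\<^sub>3 y = 0} = koszul1 S\<^sub>1 S\<^sub>2 S\<^sub>3 ` (M \<times> M \<times> M)"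
  proof (intro equalityI subsetI)
    fix y assume "y \<in> {y \<in> M \<times> M \<times> M. koszul2 S\<^sub>1 S\<^sub>2 S\<^sub>3 y = 0}"
    then obtain y12 y13 y23 where y: "y = (y12, y13, y23)"
      and [simp]: "y12 \<in> M" "y13 \<in> M" "y23 \<in> M"
      and e: "S\<^sub>1 y23 - S\<^sub>2 y13 + S\<^sub>3 y12 = 0"
      by (auto simp: koszul2_def)
    have e1: "S\<^sub>3 y12 = S\<^sub>2 y13 - S\<^sub>1 y23"
      using e by (simp add: algebra_simps eq_neg_iff_add_eq_0 add_eq_0_iff)
    define u1 where "u1 = - (\<beta> *\<^sub>C y12) - \<gamma> *\<^sub>C y13"
    define u2 where "u2 = \<alpha> *\<^sub>C y12 - \<gamma> *\<^sub>C y23"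
    define u3 where "u3 = \<alpha> *\<^sub>C y13 + \<beta> *\<^sub>C y23"
    have [simp]: "u1 \<in> M" "u2 \<in> M" "u3 \<in> M" by (simp_all add: u1_def u2_def u3_def)
    have "S\<^sub>1 (R u2) - S\<^sub>2 (R u1) = y12" "S\<^sub>1 (R u3) - S\<^sub>3 (R u1) = y13"
      "S\<^sub>2 (R u3) - S\<^sub>3 (R u2) = y23"
      by (rule inj; simp add: R Gadd cG[symmetric]; simp add: u1_def u2_def u3_def G l e1)+
    then have "y = koszul1 S\<^sub>1 S\<^sub>2 S\<^sub>3 (R u1, R u2, R u3)" by (simp add: y koszul1_def)
    then show "y \<in> koszul1 S\<^sub>1 S\<^sub>2 S\<^sub>3 ` (M \<times> M \<times> M)"
      using R(1) by (intro image_eqI[of _ _ "(R u1, R u2, R u3)"]) auto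
  next
    fix y assume "y \<in> koszul1 S\<^sub>1 S\<^sub>2 S\<^sub>3 ` (M \<times> M \<times> M)"
    then show "y \<in> {y \<in> M \<times> M \<times> M. koszul2 S\<^sub>1 S\<^sub>2 S\<^sub>3 y = 0}"
      by (auto simp: koszul1_def koszul2_def comm l)
  qed
  moreover have "koszul2 S\<^sub>1 S\<^sub>2 S\<^sub>3 ` (M \<times> M \<times> M) = M"
  proof (intro equalityI subsetI)
    fix y assume y: "y \<in> M"
    have "koszul2 S\<^sub>1 S\<^sub>2 S\<^sub>3 (\<gamma> *\<^sub>C R y, - (\<beta> *\<^sub>C R y), \<alpha> *\<^sub>C R y) = G (R y)"
      using R(1)[OF y] by (simp add: koszul2_def G l)
    then show "y \<in> koszul2 S\<^sub>1 S\<^sub>2 S\<^sub>3 ` (M \<times> M \<times> M)"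
      using R[OF y] by (intro image_eqI[of _ _ "(\<gamma> *\<^sub>C R y, - (\<beta> *\<^sub>C R y), \<alpha> *\<^sub>C R y)"]) auto
  qed (auto simp: koszul2_def)
  ultimately show ?thesis by (simp add: koszul_exact_def)
qed

lemma commuting_triple_onD:
  assumes "commuting_triple_on M A B P"
  shows "closed_csubspace M"
    "A ` M \<subseteq> M" "B ` M \<subseteq> M" "P ` M \<subseteq> M"
    "clinear_on M A" "clinear_on M B" "clinear_on M P"
    "x \<in> M \<Longrightarrow> A (B x) = B (A x)" "x \<in> M \<Longrightarrow> A (P x) = P (A x)" "x \<in> M \<Longrightarrow> B (P x) = P (B x)"
  using assms by (auto simp: commuting_triple_on_def bounded_op_on_def)

lemma not_in_taylor_spectrum:
  fixes M :: "'a::complex_inner set"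
  assumes ct: "commuting_triple_on M A B P"
    and G: "\<And>x. x \<in> M \<Longrightarrow>
      G x = \<alpha> *\<^sub>C (A x - a *\<^sub>C x) + \<beta> *\<^sub>C (B x - b *\<^sub>C x) + \<gamma> *\<^sub>C (P x - p *\<^sub>C x)"
    and bij: "\<And>y. y \<in> M \<Longrightarrow> \<exists>!x. x \<in> M \<and> G x = y"
  shows "(a, b, p) \<notin> taylor_spectrum M A B P"
proof -
  note D = commuting_triple_onD[OF ct]
  note l = clinear_on_add[OF D(1)] clinear_on_scale[OF D(1)] clinear_on_diff[OF D(1)]
  note l = l[OF D(5)] l[OF D(6)] l[OF D(7)] scaleC_algebra csub_simps[OF D(1)]
  have [simp]: "A x \<in> M" "B x \<in> M" "P x \<in> M" if "x \<in> M" for x using that D by auto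
  have "koszul_exact (\<lambda>x. A x - a *\<^sub>C x) (\<lambda>x. B x - b *\<^sub>C x) (\<lambda>x. P x - p *\<^sub>C x) M"
  proof (rule koszul_exact_if_combination_bij[OF D(1) _ _ _ _ _ _ _ _ _ G bij])
    show "clinear_on M (\<lambda>x. A x - a *\<^sub>C x)" "clinear_on M (\<lambda>x. B x - b *\<^sub>C x)"
      "clinear_on M (\<lambda>x. P x - p *\<^sub>C x)"
      by (auto simp: clinear_on_def l mult.commute)
  qed (auto simp: l D(8-10) mult.commute)
  then show ?thesis by (simp add: taylor_spectrum_def)
qed


section \<open>Triples with Taylor spectrum in the closed tetrablock\<close>

lemma contraction_perturbation_bij:
  fixes M :: "'a::chilbert_space set"
  assumes M: "closed_csubspace M" and L: "L ` M \<subseteq> M"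
    and diff: "\<And>x y. x \<in> M \<Longrightarrow> y \<in> M \<Longrightarrow> L (x - y) = L x - L y"
    and q: "q < 1" "\<And>x. x \<in> M \<Longrightarrow> norm (L x) \<le> q * norm x" and y: "y \<in> M"
  shows "\<exists>!x. x \<in> M \<and> x - L x = y"
proof -
  have eq: "x - L x = y \<longleftrightarrow> y + L x = x" for x by (auto simp: algebra_simps)
  have q': "norm (L x) \<le> max q 0 * norm x" if "x \<in> M" for x
    using q(2)[OF that] mult_right_mono[of q "max q 0" "norm x"] by simp
  have "\<exists>!x\<in>M. y + L x = x"
  proof (rule Banach_fix[where c = "max q 0"])
    show "complete M" using M by (simp add: complete_eq_closed csub_simps)
    show "M \<noteq> {}" using y by auto
    show "(\<lambda>x. y + L x) ` M \<subseteq> M" using L y M by (auto simp: csub_simps)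
    show "dist (y + L u) (y + L v) \<le> max q 0 * dist u v" if "u \<in> M" "v \<in> M" for u v
      using q'[of "u - v"] that M diff[of u v] by (simp add: dist_norm csub_simps)
  qed (use q(1) in auto)
  then show ?thesis by (simp add: eq)
qed

text \<open>
  A point \<open>(a, b, p)\<close> off the closed tetrablock is a zero of \<open>1 - z x\<^sub>1 - w x\<^sub>2 + z w x\<^sub>3\<close> for some
  \<open>z, w\<close> in the open disc.  At the triple this polynomial is
  \<open>(1 - w B) - z (A - w P) = (1 - z (A - w P) (1 - w B)\<^sup>-\<^sup>1) (1 - w B)\<close>, which is invertible by
  two applications of the contraction principle, and it is a combination of \<open>A - a\<close>, \<open>B - b\<close>
  and \<open>P - p\<close>.
\<close>

lemma taylor_spectrum_subset_closure_tetrablock: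
  fixes M :: "'a::chilbert_space set"
  assumes ct: "commuting_triple_on M A B P"
    and B: "\<And>x. x \<in> M \<Longrightarrow> norm (B x) \<le> norm x"
    and le: "\<And>w x. cmod w < 1 \<Longrightarrow> x \<in> M \<Longrightarrow> norm (A x - w *\<^sub>C P x) \<le> norm (x - w *\<^sub>C B x)"
  shows "taylor_spectrum M A B P \<subseteq> closure tetrablock"
proof (clarify, rule ccontr)
  fix a b p
  assume spec: "(a, b, p) \<in> taylor_spectrum M A B P" and "(a, b, p) \<notin> closure tetrablock"
  then obtain z w where z: "cmod z < 1" and w: "cmod w < 1"
    and zero: "1 - z * a - w * b + z * w * p = 0"
    unfolding closure_tetrablock_iff by metis
  note D = commuting_triple_onD[OF ct]
  note m [simp] = csub_simps[OF D(1)]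
  note l = clinear_on_add[OF D(1)] clinear_on_scale[OF D(1)] clinear_on_diff[OF D(1)]
  note l = l[OF D(5)] l[OF D(6)] l[OF D(7)] scaleC_algebra
  have [simp]: "A x \<in> M" "B x \<in> M" "P x \<in> M" if "x \<in> M" for x using that D by auto
  have inv: "\<exists>!x. x \<in> M \<and> x - w *\<^sub>C B x = y" if y: "y \<in> M" for y
  proof (rule contraction_perturbation_bij[OF D(1) _ _ w _ y])
    show "norm (w *\<^sub>C B x) \<le> cmod w * norm x" if "x \<in> M" for x
      using B[OF that] by (simp add: norm_scaleC mult_left_mono)
  qed (auto simp: l)
  define R where "R y = (THE x. x \<in> M \<and> x - w *\<^sub>C B x = y)" for y
  have R [simp]: "R y \<in> M" and RB: "R y - w *\<^sub>C B (R y) = y" if "y \<in> M" for y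
    using theI'[OF inv[OF that]] by (auto simp: R_def)
  have Req: "R y = x" if "x \<in> M" "x - w *\<^sub>C B x = y" for x y
    unfolding R_def using that by (intro the1_equality inv) auto
  have Rdiff: "R (x - y) = R x - R y" if "x \<in> M" "y \<in> M" for x y
  proof (rule Req)
    have "R x - R y - w *\<^sub>C B (R x - R y) = (R x - w *\<^sub>C B (R x)) - (R y - w *\<^sub>C B (R y))"
      using that by (simp add: l)
    then show "R x - R y - w *\<^sub>C B (R x - R y) = x - y" by (simp only: RB that)
  qed (use that in simp)
  define L where "L y = z *\<^sub>C (A (R y) - w *\<^sub>C P (R y))" for y
  have bij: "\<exists>!v. v \<in> M \<and> v - L v = y" if y: "y \<in> M" for y
  proof (rule contraction_perturbation_bij[OF D(1) _ _ z _ y])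
    show "norm (L v) \<le> cmod z * norm v" if "v \<in> M" for v
      using le[OF w R[OF that]] RB[OF that] by (simp add: L_def norm_scaleC mult_left_mono)
  qed (auto simp: L_def Rdiff l)
  define G where "G x = (x - w *\<^sub>C B x) - z *\<^sub>C (A x - w *\<^sub>C P x)" for x
  have G_R: "G (R v) = v - L v" if "v \<in> M" for v
    using RB[OF that] by (simp add: G_def L_def)
  have "\<exists>!x. x \<in> M \<and> G x = y" if y: "y \<in> M" for y
  proof (rule ex_ex1I)
    obtain v where "v \<in> M" "v - L v = y" using bij[OF y] by blast
    then show "\<exists>x. x \<in> M \<and> G x = y" using G_R R by metis
  next
    fix x x' assume *: "x \<in> M \<and> G x = y" "x' \<in> M \<and> G x' = y"
    have v: "x - w *\<^sub>C B x \<in> M" "x' - w *\<^sub>C B x' \<in> M" using * by auto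
    have "R (x - w *\<^sub>C B x) = x" "R (x' - w *\<^sub>C B x') = x'" using * by (auto intro: Req)
    have uniq: "u = u'" if "u \<in> M" "u - L u = y" "u' \<in> M" "u' - L u' = y" for u u'
      using bij[OF y] that by blast
    have "x - w *\<^sub>C B x = x' - w *\<^sub>C B x'"
    proof (rule uniq[OF v(1) _ v(2)])
      show "x - w *\<^sub>C B x - L (x - w *\<^sub>C B x) = y"
        using G_R[OF v(1)] \<open>R (x - w *\<^sub>C B x) = x\<close> * by metis
      show "x' - w *\<^sub>C B x' - L (x' - w *\<^sub>C B x') = y"
        using G_R[OF v(2)] \<open>R (x' - w *\<^sub>C B x') = x'\<close> * by metis
    qed
    with \<open>R (x - w *\<^sub>C B x) = x\<close> \<open>R (x' - w *\<^sub>C B x') = x'\<close> show "x = x'" by metis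
  qed
  moreover have "G x = (- z) *\<^sub>C (A x - a *\<^sub>C x) + (- w) *\<^sub>C (B x - b *\<^sub>C x)
      + (z * w) *\<^sub>C (P x - p *\<^sub>C x)" for x
  proof -
    have "(1 - z * a - w * b + z * w * p) *\<^sub>C x = 0" using zero by simp
    then show ?thesis by (simp add: G_def scaleC_algebra) (simp add: algebra_simps)
  qed
  ultimately have "(a, b, p) \<notin> taylor_spectrum M A B P"
    by (intro not_in_taylor_spectrum[OF ct])
  with spec show False by contradiction
qed


section \<open>Polynomials in commuting operators\<close>

abbreviation mono3_op ::
    "('a::complex_inner \<Rightarrow> 'a) \<Rightarrow> ('a \<Rightarrow> 'a) \<Rightarrow> ('a \<Rightarrow> 'a) \<Rightarrow> nat \<times> nat \<times> nat \<Rightarrow> 'a \<Rightarrow> 'a" where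
  "mono3_op A B P m x \<equiv> (A ^^ fst m) ((B ^^ fst (snd m)) ((P ^^ snd (snd m)) x))"

lemma poly3_op_alt:
  assumes "finite F" "Poly_Mapping.keys f \<subseteq> F"
  shows "poly3_op f A B P x = (\<Sum>m\<in>F. Poly_Mapping.lookup f m *\<^sub>C mono3_op A B P m x)"
  unfolding poly3_op_def using assms
  by (intro sum.mono_neutral_cong_left) (auto simp: in_keys_iff split: prod.splits)

lemma poly3_eval_alt:
  assumes "finite F" "Poly_Mapping.keys f \<subseteq> F"
  shows "poly3_eval f (a, b, p) =
    (\<Sum>m\<in>F. Poly_Mapping.lookup f m * a ^ fst m * b ^ fst (snd m) * p ^ snd (snd m))"
  unfolding poly3_eval_def prod.case using assms
  by (intro sum.mono_neutral_cong_left) (auto simp: in_keys_iff split: prod.splits)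

lemmas poly3_op_keys = poly3_op_alt[OF finite_keys order_refl]
lemmas poly3_eval_keys = poly3_eval_alt[OF finite_keys order_refl]

definition affine3 :: "complex \<Rightarrow> complex \<Rightarrow> complex \<Rightarrow> complex \<Rightarrow> poly3" where
  "affine3 c\<^sub>0 c\<^sub>1 c\<^sub>2 c\<^sub>3 = Poly_Mapping.single (0, 0, 0) c\<^sub>0 + Poly_Mapping.single (1, 0, 0) c\<^sub>1 +
     Poly_Mapping.single (0, 1, 0) c\<^sub>2 + Poly_Mapping.single (0, 0, 1) c\<^sub>3"

lemma keys_affine3:
  "Poly_Mapping.keys (affine3 c\<^sub>0 c\<^sub>1 c\<^sub>2 c\<^sub>3) \<subseteq> {(0, 0, 0), (1, 0, 0), (0, 1, 0), (0, 0, 1)}"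
  unfolding affine3_def
  by (rule order_trans[OF keys_add] Un_least)+ (auto simp: keys_single split: if_splits)

lemma poly3_op_affine3:
  "poly3_op (affine3 c\<^sub>0 c\<^sub>1 c\<^sub>2 c\<^sub>3) A B P x = c\<^sub>0 *\<^sub>C x + c\<^sub>1 *\<^sub>C A x + c\<^sub>2 *\<^sub>C B x + c\<^sub>3 *\<^sub>C P x"
  by (subst poly3_op_alt[OF _ keys_affine3])
    (simp_all add: affine3_def lookup_add lookup_single when_def add.commute add.left_commute)

lemma poly3_eval_affine3:
  "poly3_eval (affine3 c\<^sub>0 c\<^sub>1 c\<^sub>2 c\<^sub>3) (a, b, p) = c\<^sub>0 + c\<^sub>1 * a + c\<^sub>2 * b + c\<^sub>3 * p"
  by (subst poly3_eval_alt[OF _ keys_affine3])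
    (simp_all add: affine3_def lookup_add lookup_single when_def add.commute add.left_commute)

lemma bop_poly3_op:
  assumes "bop A" "bop B" "bop P"
  shows "bop (poly3_op f A B P)"
proof -
  have "bop (mono3_op A B P m)" for m
    by (rule bop_comp[OF bop_funpow[OF assms(1)]
          bop_comp[OF bop_funpow[OF assms(2)] bop_funpow[OF assms(3)]]])
  then show ?thesis unfolding poly3_op_keys[abs_def]
    by (rule bop_sum_op[OF bop_scale])
qed

lemma poly3_op_commute:
  assumes "bop S" "\<And>x. S (A x) = A (S x)" "\<And>x. S (B x) = B (S x)" "\<And>x. S (P x) = P (S x)"
  shows "S (poly3_op f A B P x) = poly3_op f A B P (S x)"
proof -
  have pow: "S ((T ^^ n) x) = (T ^^ n) (S x)" if "\<And>x. S (T x) = T (S x)" for T n x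
    by (induction n) (auto simp: that)
  show ?thesis
    by (simp add: poly3_op_keys bop_sum[OF assms(1)] bop_scaleC[OF assms(1)] pow assms(2-4))
qed

lemma poly3_op_commute_poly3_op:
  assumes "bop A" "bop B" "bop P"
    and "\<And>x. A (B x) = B (A x)" "\<And>x. A (P x) = P (A x)" "\<And>x. B (P x) = P (B x)"
  shows "poly3_op f A B P (poly3_op g A B P x) = poly3_op g A B P (poly3_op f A B P x)"
  by (rule poly3_op_commute[OF bop_poly3_op[OF assms(1-3)]];
      rule poly3_op_commute[symmetric]; simp add: assms)

lemma poly3_op_invariant:
  assumes "closed_csubspace M" "A ` M \<subseteq> M" "B ` M \<subseteq> M" "P ` M \<subseteq> M" "x \<in> M"
  shows "poly3_op f A B P x \<in> M"
proof -
  have "(T ^^ n) y \<in> M" if "T ` M \<subseteq> M" "y \<in> M" for T n y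
    using that by (induction n) auto
  then show ?thesis
    unfolding poly3_op_keys using assms
    by (intro csub_sum csub_simps) auto
qed

definition cnj_poly3 :: "poly3 \<Rightarrow> poly3" where
  "cnj_poly3 f = Poly_Mapping.map cnj f"

lemma lookup_cnj_poly3 [simp]:
  "Poly_Mapping.lookup (cnj_poly3 f) m = cnj (Poly_Mapping.lookup f m)"
  by (cases "Poly_Mapping.lookup f m = 0") (auto simp: cnj_poly3_def map.rep_eq when_def)

lemma keys_cnj_poly3 [simp]: "Poly_Mapping.keys (cnj_poly3 f) = Poly_Mapping.keys f"
  by (auto simp: in_keys_iff)

lemma cnj_cnj_poly3 [simp]: "cnj_poly3 (cnj_poly3 f) = f"
  by (rule poly_mapping_eqI) simp

lemma poly3_eval_cnj_poly3:
  "poly3_eval (cnj_poly3 f) (a, b, p) = cnj (poly3_eval f (cnj a, cnj b, cnj p))"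
  by (simp add: poly3_eval_keys)

lemma cinner_poly3_op_adj:
  fixes A B P :: "'a::chilbert_space \<Rightarrow> 'a"
  assumes "bop A" "bop B" "bop P"
    and "\<And>x. A (B x) = B (A x)" "\<And>x. A (P x) = P (A x)" "\<And>x. B (P x) = P (B x)"
  shows "cinner (poly3_op f A B P x) y = cinner x (poly3_op (cnj_poly3 f) (adj A) (adj B) (adj P) y)"
proof -
  note c = funpow_commute[of "adj A" "adj B", OF adj_commute[OF assms(1,2,4)]]
    funpow_commute[of "adj A" "adj P", OF adj_commute[OF assms(1,3,5)]]
    funpow_commute[of "adj B" "adj P", OF adj_commute[OF assms(2,3,6)]]
  have "cinner (mono3_op A B P m x) y = cinner x (mono3_op (adj A) (adj B) (adj P) m y)" for m
    by (simp only: cinner_funpow_adj[OF assms(1)] cinner_funpow_adj[OF assms(2)]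
        cinner_funpow_adj[OF assms(3)] c)
  then show ?thesis
    by (simp add: poly3_op_keys cinner_sum_left cinner_sum_right cinner_scaleC_left
        cinner_scaleC_right)
qed


section \<open>Tetrablock contractions\<close>

text \<open>
  The part of the spectral set condition that concerns rational functions.  It is separated from the
  condition on the Taylor spectrum because it implies the latter.
\<close>

definition von_neumann_on ::
    "'a::complex_inner set \<Rightarrow> ('a \<Rightarrow> 'a) \<Rightarrow> ('a \<Rightarrow> 'a) \<Rightarrow> ('a \<Rightarrow> 'a) \<Rightarrow> bool" where
  "von_neumann_on M A B P \<longleftrightarrow>
     (\<forall>f g. (\<forall>z\<in>closure tetrablock. poly3_eval g z \<noteq> 0) \<longrightarrow>
        bij_betw (poly3_op g A B P) M M \<and>
        (\<forall>x\<in>M. norm (poly3_op f A B P (inv_into M (poly3_op g A B P) x))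
           \<le> (SUP z\<in>closure tetrablock. cmod (poly3_eval f z / poly3_eval g z)) * norm x))"

lemma E_contraction_imp:
  assumes "E_contraction M A B P"
  shows "commuting_triple_on M A B P" "von_neumann_on M A B P" "compact (closure tetrablock)"
  using assms by (auto simp: E_contraction_def spectral_set_on_def von_neumann_on_def)

lemma von_neumann_on_le:
  assumes vN: "von_neumann_on M A B P" and x: "x \<in> M"
    and g: "\<And>z. z \<in> closure tetrablock \<Longrightarrow> poly3_eval g z \<noteq> 0"
    and le: "\<And>z. z \<in> closure tetrablock \<Longrightarrow> cmod (poly3_eval f z) \<le> cmod (poly3_eval g z)"
  shows "norm (poly3_op f A B P x) \<le> norm (poly3_op g A B P x)"
proof -
  let ?G = "poly3_op g A B P" and ?s = "SUP z\<in>closure tetrablock. cmod (poly3_eval f z / poly3_eval g z)"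
  have bij: "bij_betw ?G M M"
    and bound: "\<And>y. y \<in> M \<Longrightarrow> norm (poly3_op f A B P (inv_into M ?G y)) \<le> ?s * norm y"
    using vN g unfolding von_neumann_on_def by auto
  have "?s \<le> 1"
    using zero_in_tetrablock closure_subset[of tetrablock]
    by (intro cSUP_least) (use g le in \<open>auto simp: norm_divide divide_le_eq_1\<close>)
  have Gx: "?G x \<in> M" "inv_into M ?G (?G x) = x"
    using bij x by (auto simp: bij_betw_def)
  have "norm (poly3_op f A B P x) \<le> ?s * norm (?G x)" using bound[OF Gx(1)] Gx(2) by simp
  also have "\<dots> \<le> norm (?G x)" using \<open>?s \<le> 1\<close> mult_right_mono[of ?s 1 "norm (?G x)"] by simp
  finally show ?thesis .
qed

lemma von_neumann_on_affine:
  assumes vN: "von_neumann_on M A B P" and x: "x \<in> M"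
  shows "norm (B x) \<le> norm x"
    and "cmod w < 1 \<Longrightarrow> norm (A x - w *\<^sub>C P x) \<le> norm (x - w *\<^sub>C B x)"
    and "cmod w < 1 \<Longrightarrow> norm (B x - w *\<^sub>C P x) \<le> norm (x - w *\<^sub>C A x)"
proof -
  have bound: "cmod b \<le> 1" "cmod a \<le> 1" if "(a, b, p) \<in> closure tetrablock" for a b p
    using closure_tetrablock_le(3)[OF that, of 0] closure_tetrablock_le(2)[OF that, of 0]
      closure_tetrablock_le(1)[OF that, of 0] by simp_all
  have nz: "w * b \<noteq> 1" if "cmod w < 1" "cmod b \<le> 1" for w b
  proof
    assume "w * b = 1"
    then have "cmod w * cmod b = 1" by (metis norm_mult norm_one)
    with that show False using mult_left_le[of "cmod b" "cmod w"] by simp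
  qed
  show "norm (B x) \<le> norm x"
    using von_neumann_on_le[OF vN x, of "affine3 1 0 0 0" "affine3 0 0 1 0"] bound
    by (auto simp: poly3_op_affine3 poly3_eval_affine3)
  assume w: "cmod w < 1"
  show "norm (A x - w *\<^sub>C P x) \<le> norm (x - w *\<^sub>C B x)"
    using von_neumann_on_le[OF vN x, of "affine3 1 0 (- w) 0" "affine3 0 1 0 (- w)"]
      bound nz[OF w] closure_tetrablock_le(1)[OF _ less_imp_le[OF w]]
    by (auto simp: poly3_op_affine3 poly3_eval_affine3)
  show "norm (B x - w *\<^sub>C P x) \<le> norm (x - w *\<^sub>C A x)"
    using von_neumann_on_le[OF vN x, of "affine3 1 (- w) 0 0" "affine3 0 0 1 (- w)"]
      bound nz[OF w] closure_tetrablock_le(2)[OF _ less_imp_le[OF w]]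
    by (auto simp: poly3_op_affine3 poly3_eval_affine3)
qed

text \<open>
  The condition on the Taylor spectrum follows from the von Neumann inequality, so that only the
  latter has to be transferred to restrictions and adjoints.
\<close>

lemma E_contractionI:
  fixes M :: "'a::chilbert_space set"
  assumes "compact (closure tetrablock)" "commuting_triple_on M A B P" "von_neumann_on M A B P"
  shows "E_contraction M A B P"
proof -
  have "taylor_spectrum M A B P \<subseteq> closure tetrablock"
    using von_neumann_on_affine[OF assms(3)]
    by (intro taylor_spectrum_subset_closure_tetrablock[OF assms(2)]) auto
  then show ?thesis
    using assms by (auto simp: E_contraction_def spectral_set_on_def von_neumann_on_def)
qed

lemma commuting_triple_on_UNIV_iff:
  "commuting_triple_on UNIV A B P \<longleftrightarrow> bop A \<and> bop B \<and> bop P \<and>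
     (\<forall>x. A (B x) = B (A x) \<and> A (P x) = P (A x) \<and> B (P x) = P (B x))"
  by (simp add: commuting_triple_on_def)

lemma bounded_op_on_restrict: "bop T \<Longrightarrow> T ` M \<subseteq> M \<Longrightarrow> bounded_op_on M T"
  using bop_bound[of T] unfolding bounded_op_on_def clinear_on_def by (metis UNIV_I)

lemma commuting_triple_on_restrict:
  assumes "commuting_triple_on UNIV A B P" "closed_csubspace M"
    "A ` M \<subseteq> M" "B ` M \<subseteq> M" "P ` M \<subseteq> M"
  shows "commuting_triple_on M A B P"
  using assms
    bounded_op_on_restrict[of A M] bounded_op_on_restrict[of B M] bounded_op_on_restrict[of P M]
  unfolding commuting_triple_on_UNIV_iff by (simp add: commuting_triple_on_def)

text \<open>
  A polynomial \<open>G\<close> in the triple and its adjoint leave \<open>M\<close> invariant; if \<open>G x \<in> M\<close> and \<open>n\<close> is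
  the component of \<open>x\<close> orthogonal to \<open>M\<close>, then \<open>G n\<close> lies both in \<open>M\<close> and in its
  orthogonal complement, and \<open>n = 0\<close>.
\<close>

lemma E_contraction_restrict:
  fixes M :: "'a::chilbert_space set"
  assumes E: "E_contraction UNIV A B P" and red: "reduces M A" "reduces M B" "reduces M P"
  shows "E_contraction M A B P"
proof (rule E_contractionI)
  have M: "closed_csubspace M" and inv: "A ` M \<subseteq> M" "B ` M \<subseteq> M" "P ` M \<subseteq> M"
    "adj A ` M \<subseteq> M" "adj B ` M \<subseteq> M" "adj P ` M \<subseteq> M"
    using red by (auto simp: reduces_def)
  show "compact (closure tetrablock)" by (rule E_contraction_imp[OF E])
  show "commuting_triple_on M A B P"
    by (rule commuting_triple_on_restrict[OF E_contraction_imp(1)[OF E] M inv(1-3)])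
  have bop: "bop A" "bop B" "bop P"
    and comm: "\<And>x. A (B x) = B (A x)" "\<And>x. A (P x) = P (A x)" "\<And>x. B (P x) = P (B x)"
    using E_contraction_imp(1)[OF E] by (auto simp: commuting_triple_on_UNIV_iff)
  show "von_neumann_on M A B P"
    unfolding von_neumann_on_def
  proof (intro allI impI)
    fix f g :: poly3
    assume nz: "\<forall>z\<in>closure tetrablock. poly3_eval g z \<noteq> 0"
    let ?G = "poly3_op g A B P"
    have bij: "bij ?G"
      and bound: "\<And>y. norm (poly3_op f A B P (inv ?G y)) \<le>
        (SUP z\<in>closure tetrablock. cmod (poly3_eval f z / poly3_eval g z)) * norm y"
      using E_contraction_imp(2)[OF E] nz unfolding von_neumann_on_def by auto
    note bopG = bop_poly3_op[OF bop, of g]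
    have "x \<in> M" if Gx: "?G x \<in> M" for x
    proof -
      obtain m where m: "m \<in> M" "\<And>z. z \<in> M \<Longrightarrow> cinner (x - m) z = 0"
        using csub_decompose[OF M, of x] by metis
      have "?G (x - m) \<in> M"
        using Gx poly3_op_invariant[OF M inv(1-3) m(1)] M by (simp add: bop_diff[OF bopG] csub_simps)
      then have "cinner (?G (x - m)) (?G (x - m)) = 0"
        unfolding cinner_poly3_op_adj[OF bop comm]
        by (intro m(2) poly3_op_invariant[OF M inv(4-6)])
      then have "?G (x - m) = ?G 0" by (simp add: bop_zero[OF bopG])
      then have "x - m = 0" using bij by (simp add: bij_is_inj inj_eq)
      with m(1) show ?thesis by simp
    qed
    then have "M \<subseteq> ?G ` M" using bij_is_surj[OF bij] by (fastforce simp: surj_def)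
    then have bijM: "bij_betw ?G M M"
      using poly3_op_invariant[OF M inv(1-3)] bij
      by (auto simp: bij_betw_def bij_is_inj inj_on_subset)
    moreover have "inv_into M ?G y = inv ?G y" if "y \<in> M" for y
      using bij_betw_inv_into_right[OF bijM that] inv_f_f[OF bij_is_inj[OF bij]] by metis
    ultimately show "bij_betw ?G M M \<and> (\<forall>x\<in>M. norm (poly3_op f A B P (inv_into M ?G x))
        \<le> (SUP z\<in>closure tetrablock. cmod (poly3_eval f z / poly3_eval g z)) * norm x)"
      using bound by simp
  qed
qed

text \<open>
  \<open>f(A\<^sup>*, B\<^sup>*, P\<^sup>*)\<close> is the adjoint of \<open>f\<^sup>\<sim>(A, B, P)\<close>, where \<open>f\<^sup>\<sim>\<close> has the conjugate
  coefficients, and the closed tetrablock is invariant under complex conjugation.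
\<close>

lemma E_contraction_adj:
  fixes A B P :: "'a::chilbert_space \<Rightarrow> 'a"
  assumes E: "E_contraction UNIV A B P"
  shows "E_contraction UNIV (adj A) (adj B) (adj P)"
proof (rule E_contractionI)
  show "compact (closure tetrablock)" by (rule E_contraction_imp[OF E])
  have bop: "bop A" "bop B" "bop P"
    and comm: "\<And>x. A (B x) = B (A x)" "\<And>x. A (P x) = P (A x)" "\<And>x. B (P x) = P (B x)"
    using E_contraction_imp(1)[OF E] by (auto simp: commuting_triple_on_UNIV_iff)
  show "commuting_triple_on UNIV (adj A) (adj B) (adj P)"
    unfolding commuting_triple_on_UNIV_iff
    using bop comm by (auto intro: bop_adj adj_commute)
  show "von_neumann_on UNIV (adj A) (adj B) (adj P)"
    unfolding von_neumann_on_def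
  proof (intro allI impI)
    fix f g :: poly3
    assume nz: "\<forall>z\<in>closure tetrablock. poly3_eval g z \<noteq> 0"
    define F where "F = poly3_op f (adj A) (adj B) (adj P)"
    define G where "G = poly3_op g (adj A) (adj B) (adj P)"
    define F' where "F' = poly3_op (cnj_poly3 f) A B P"
    define G' where "G' = poly3_op (cnj_poly3 g) A B P"
    have adjF: "cinner (F' x) y = cinner x (F y)" and adjG: "cinner (G' x) y = cinner x (G y)" for x y
      by (simp_all add: F_def G_def F'_def G'_def cinner_poly3_op_adj[OF bop comm])
    define s where "s h = (SUP z\<in>closure tetrablock. cmod (poly3_eval h z / poly3_eval (cnj_poly3 g) z))"
      for h
    have nz': "poly3_eval (cnj_poly3 g) z \<noteq> 0" if "z \<in> closure tetrablock" for z
    proof -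
      obtain a b p where z: "z = (a, b, p)" by (cases z)
      show ?thesis
        using nz closure_tetrablock_cnj[of a b p] that by (auto simp: z poly3_eval_cnj_poly3)
    qed
    have bij: "bij G'" and bound: "\<And>h y. norm (poly3_op h A B P (inv G' y)) \<le> s h * norm y"
      using E_contraction_imp(2)[OF E] nz' unfolding von_neumann_on_def G'_def s_def by auto
    have "bop G'" unfolding G'_def by (rule bop_poly3_op[OF bop])
    define R where "R = inv G'"
    have GR: "G' (R x) = x" and RG: "R (G' x) = x" for x
      using bij by (simp_all add: R_def bij_is_surj surj_f_inv_f bij_is_inj)
    have "bop R"
    proof (rule bopI)
      show "norm (R x) \<le> s (affine3 1 0 0 0) * norm x" for x
        using bound[of "affine3 1 0 0 0" x] by (simp add: poly3_op_affine3 R_def)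
      show "R (x + y) = R x + R y" for x y
        by (metis GR RG bop_add[OF \<open>bop G'\<close>])
      show "R (c *\<^sub>C x) = c *\<^sub>C R x" for c x
        by (metis GR RG bop_scaleC[OF \<open>bop G'\<close>])
    qed
    have "G (adj R y) = y" for y
      by (rule cinner_eqI) (simp add: adjG[symmetric] cinner_adj_right[OF \<open>bop R\<close>, symmetric] RG)
    moreover have "inj G"
    proof (rule injI)
      fix x y assume "G x = G y"
      then have "cinner (G' z) x = cinner (G' z) y" for z by (simp add: adjG)
      then have "cinner z x = cinner z y" for z by (metis GR)
      then show "x = y" by (rule cinner_eqI)
    qed
    ultimately have bijG: "bij G" by (metis bijI surjI)
    have comm': "F' (G' v) = G' (F' v)" for v
      unfolding F'_def G'_def by (rule poly3_op_commute_poly3_op[OF bop comm])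
    have norm: "norm (F (inv G x)) \<le> s (cnj_poly3 f) * norm x" for x
    proof (rule norm_le_from_cinner)
      fix v
      have Gx: "G (inv G x) = x" using bijG by (simp add: bij_is_surj surj_f_inv_f)
      have "F' v = G' (F' (R v))" by (metis comm' GR)
      then have "cinner v (F (inv G x)) = cinner (F' (R v)) x"
        by (simp add: adjF[symmetric] adjG Gx)
      also have "cmod \<dots> \<le> norm (F' (R v)) * norm x" by (rule cmod_cinner_le)
      also have "\<dots> \<le> s (cnj_poly3 f) * norm v * norm x"
        using bound[of "cnj_poly3 f" v] by (intro mult_right_mono) (simp_all add: F'_def R_def)
      finally show "cmod (cinner v (F (inv G x))) \<le> s (cnj_poly3 f) * norm x * norm v"
        by (simp add: ac_simps)
    next
      show "0 \<le> s (cnj_poly3 f) * norm x"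
        using bound[of "cnj_poly3 f" x] norm_ge_zero order_trans by blast
    qed
    have "s (cnj_poly3 f) = (SUP z\<in>closure tetrablock. cmod (poly3_eval f z / poly3_eval g z))"
    proof -
      let ?c = "\<lambda>(a, b, p). (cnj a, cnj b, cnj p)"
      have eq: "cmod (poly3_eval (cnj_poly3 f) z / poly3_eval (cnj_poly3 g) z) =
          cmod (poly3_eval f (?c z) / poly3_eval g (?c z))" for z
        by (cases z) (simp add: poly3_eval_cnj_poly3 norm_divide)
      have c: "?c ` closure tetrablock = closure tetrablock"
      proof
        show *: "?c ` closure tetrablock \<subseteq> closure tetrablock"
          using closure_tetrablock_cnj by auto
        show "closure tetrablock \<subseteq> ?c ` closure tetrablock"
        proof
          fix z assume "z \<in> closure tetrablock"
          then have "?c z \<in> closure tetrablock" using * by blast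
          then show "z \<in> ?c ` closure tetrablock"
            by (intro image_eqI[of _ _ "?c z"]) (auto split: prod.splits)
        qed
      qed
      have "s (cnj_poly3 f) = (SUP z\<in>closure tetrablock. cmod (poly3_eval f (?c z) / poly3_eval g (?c z)))"
        unfolding s_def eq ..
      also have "\<dots> = (SUP z\<in>?c ` closure tetrablock. cmod (poly3_eval f z / poly3_eval g z))"
        by (simp only: image_image)
      finally show ?thesis unfolding c .
    qed
    with bijG norm show "bij_betw (poly3_op g (adj A) (adj B) (adj P)) UNIV UNIV \<and>
        (\<forall>x\<in>UNIV. norm (poly3_op f (adj A) (adj B) (adj P)
            (inv_into UNIV (poly3_op g (adj A) (adj B) (adj P)) x))
          \<le> (SUP z\<in>closure tetrablock. cmod (poly3_eval f z / poly3_eval g z)) * norm x)"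
      unfolding F_def G_def by simp
  qed
qed


section \<open>The asymptotic limit of a contraction\<close>

locale asymptotic_limit =
  fixes P T :: "'a::chilbert_space \<Rightarrow> 'a"
  assumes bop_P: "bop P"
    and norm_P: "norm (P x) \<le> norm x"
    and lim: "(\<lambda>k. (adj P ^^ k) ((P ^^ k) x)) \<longlonglongrightarrow> T x"
begin

lemma norm_adj_P: "norm (adj P x) \<le> norm x"
  using adj_bound[OF bop_P, of 1 x] norm_P by simp

lemma norm_funpow_P: "norm ((P ^^ k) x) \<le> norm x"
  by (induction k) (auto intro: order_trans[OF norm_P])

lemma norm_funpow_adj_P: "norm ((adj P ^^ k) x) \<le> norm x"
  by (induction k) (auto intro: order_trans[OF norm_adj_P])

lemma norm_T: "norm (T x) \<le> norm x"
proof (rule tendsto_upperbound[OF tendsto_norm[OF lim]])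
  show "\<forall>\<^sub>F k in sequentially. norm ((adj P ^^ k) ((P ^^ k) x)) \<le> norm x"
    by (intro always_eventually allI order_trans[OF norm_funpow_adj_P norm_funpow_P])
qed simp

lemma bop_T: "bop T"
proof (rule bopI)
  note pow = bop_funpow[OF bop_P] bop_funpow[OF bop_adj[OF bop_P]]
  show "T (x + y) = T x + T y" for x y
    using LIMSEQ_unique[OF lim[of "x + y"]] tendsto_add[OF lim[of x] lim[of y]]
    by (simp add: bop_add[OF pow(1)] bop_add[OF pow(2)])
  show "T (c *\<^sub>C x) = c *\<^sub>C T x" for c x
    using LIMSEQ_unique[OF lim[of "c *\<^sub>C x"]] bop_tendsto[OF bop_scale[OF bop_id] lim[of x], of c]
    by (simp add: bop_scaleC[OF pow(1)] bop_scaleC[OF pow(2)])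
  show "norm (T x) \<le> 1 * norm x" for x using norm_T by simp
qed

lemma cinner_funpow_P_lim: "(\<lambda>k. cinner ((P ^^ k) x) ((P ^^ k) y)) \<longlonglongrightarrow> cinner x (T y)"
  using tendsto_cinner[OF tendsto_const[of x] lim[of y]]
  by (simp add: cinner_funpow_adj[OF bop_P])

lemma T_selfadjoint: "cinner (T x) y = cinner x (T y)"
proof -
  have "(\<lambda>k. cnj (cinner ((P ^^ k) y) ((P ^^ k) x))) \<longlonglongrightarrow> cnj (cinner y (T x))"
    by (intro tendsto_cnj cinner_funpow_P_lim)
  then have "(\<lambda>k. cinner ((P ^^ k) x) ((P ^^ k) y)) \<longlonglongrightarrow> cinner (T x) y"
    by (simp only: cinner_commute[symmetric])
  then show ?thesis using LIMSEQ_unique cinner_funpow_P_lim by blast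
qed

lemma norm_funpow_P_lim: "(\<lambda>k. (norm ((P ^^ k) x))\<^sup>2) \<longlonglongrightarrow> Re (cinner x (T x))"
  using tendsto_Re[OF cinner_funpow_P_lim[of x x]] by (simp add: cinner_same)

lemma adj_P_T_P: "adj P (T (P x)) = T x"
proof -
  have "(\<lambda>k. (adj P ^^ Suc k) ((P ^^ Suc k) x)) \<longlonglongrightarrow> adj P (T (P x))"
    using bop_tendsto[OF bop_adj[OF bop_P] lim[of "P x"]] by (simp add: funpow_swap1)
  then show ?thesis using LIMSEQ_unique LIMSEQ_Suc[OF lim[of x]] by blast
qed

lemma T_eq_0_iff: "T x = 0 \<longleftrightarrow> (\<lambda>k. norm ((P ^^ k) x)) \<longlonglongrightarrow> 0"
proof
  assume "T x = 0"
  then have "(\<lambda>k. sqrt ((norm ((P ^^ k) x))\<^sup>2)) \<longlonglongrightarrow> sqrt 0"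
    using norm_funpow_P_lim[of x] by (intro tendsto_real_sqrt) simp
  then show "(\<lambda>k. norm ((P ^^ k) x)) \<longlonglongrightarrow> 0" by simp
next
  assume "(\<lambda>k. norm ((P ^^ k) x)) \<longlonglongrightarrow> 0"
  then have "(\<lambda>k. (adj P ^^ k) ((P ^^ k) x)) \<longlonglongrightarrow> 0"
    by (rule Lim_null_comparison[rotated]) (simp add: norm_funpow_adj_P)
  then show "T x = 0" using LIMSEQ_unique lim by blast
qed

lemma
  assumes "T x = x"
  shows fixed_norm: "norm ((P ^^ k) x) = norm x"
    and fixed_adj_P_P: "(adj P ^^ k) ((P ^^ k) x) = x"
    and fixed_P: "T (P x) = P x"
proof -
  have norm: "norm ((P ^^ k) x) = norm x" for k
  proof -
    have "(\<lambda>n. (norm ((P ^^ (n + k)) x))\<^sup>2) \<longlonglongrightarrow> Re (cinner x (T x))"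
      by (rule LIMSEQ_ignore_initial_segment[OF norm_funpow_P_lim])
    then have "(norm x)\<^sup>2 \<le> (norm ((P ^^ k) x))\<^sup>2"
      using assms norm_funpow_P[of _ "(P ^^ k) x"]
      by (intro tendsto_upperbound[where F = sequentially])
        (auto simp: cinner_same funpow_add intro!: power_mono always_eventually)
    then have "norm x \<le> norm ((P ^^ k) x)" by (rule power2_le_imp_le) simp
    then show ?thesis using norm_funpow_P[of k x] by simp
  qed
  show "norm ((P ^^ k) x) = norm x" by (rule norm)
  \<comment> \<open>a contraction \<open>C\<close> with \<open>\<parallel>C x\<parallel> = \<parallel>x\<parallel>\<close> satisfies \<open>C\<^sup>* C x = x\<close>\<close>
  have "(norm ((adj P ^^ k) ((P ^^ k) x) - x))\<^sup>2 \<le> 0"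
    using norm_funpow_adj_P[of k "(P ^^ k) x"] norm[of k]
      power_mono[of "norm ((adj P ^^ k) ((P ^^ k) x))" "norm x" 2]
    unfolding norm_diff_sq Re_cinner_commute[of _ x] cinner_funpow_adj[OF bop_P, symmetric]
    by (simp add: cinner_same)
  then show "(adj P ^^ k) ((P ^^ k) x) = x" by simp
  have "Re (cinner (T (P x)) (P x)) = (norm x)\<^sup>2"
    using adj_P_T_P[of x] assms
    by (simp add: Re_cinner_commute[of "T (P x)"] cinner_adj_right[OF bop_P] cinner_same)
  then have "(norm (T (P x) - P x))\<^sup>2 \<le> 0"
    using norm_T[of "P x"] norm[of 1] power_mono[of "norm (T (P x))" "norm x" 2]
    unfolding norm_diff_sq by simp
  then show "T (P x) = P x" by simp
qed

lemma Ker_T_invariant: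
  assumes S: "bop S" "\<And>x. S (P x) = P (S x)" and x: "T x = 0"
  shows "T (S x) = 0"
proof -
  obtain C where C: "\<And>x. norm (S x) \<le> C * norm x" using bop_bound[OF S(1)] by blast
  have pow: "(P ^^ k) (S x) = S ((P ^^ k) x)" for k
    by (induction k) (simp_all add: S(2))
  have "(\<lambda>k. C * norm ((P ^^ k) x)) \<longlonglongrightarrow> 0"
    using x unfolding T_eq_0_iff by (rule tendsto_mult_right_zero)
  then have "(\<lambda>k. norm ((P ^^ k) (S x))) \<longlonglongrightarrow> 0"
    by (rule tendsto_sandwich[rotated -1, OF _ _ _ tendsto_const])
      (use C in \<open>auto simp: pow intro!: always_eventually\<close>)
  then show ?thesis unfolding T_eq_0_iff .
qed

text \<open>If \<open>T\<close> is a projection, its range is the orthogonal complement of its kernel.\<close>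

context
  assumes idem: "T \<circ> T = T"
begin

lemma T_T: "T (T x) = T x"
  using idem by (metis comp_apply)

lemma fixed_invariant_adj:
  assumes S: "bop S" "\<And>x. S (P x) = P (S x)" and x: "T x = x"
  shows "T (adj S x) = adj S x"
proof -
  define v where "v = adj S x - T (adj S x)"
  have v: "T v = 0" by (simp add: v_def bop_diff[OF bop_T] T_T)
  have "cinner (adj S x) v = cinner (T x) (S v)" by (simp add: cinner_adj_left[OF S(1)] x)
  also have "\<dots> = 0" by (simp add: T_selfadjoint Ker_T_invariant[OF S v])
  finally have "cinner (adj S x) v = 0" .
  moreover have "cinner (T (adj S x)) v = 0" by (simp add: T_selfadjoint v)
  ultimately have "cinner v v = 0" by (simp add: v_def cinner_diff_left)
  then show ?thesis by (simp add: v_def)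
qed

lemma Ker_T_invariant_adj:
  assumes S: "bop S" "\<And>x. T x = x \<Longrightarrow> T (S x) = S x" and x: "T x = 0"
  shows "T (adj S x) = 0"
proof -
  let ?u = "T (adj S x)"
  have "cinner ?u ?u = cinner x (T (S ?u))"
    using S(2)[of ?u] by (simp add: T_selfadjoint T_T cinner_adj_left[OF S(1)])
  also have "\<dots> = 0" by (simp add: T_selfadjoint[symmetric] x)
  finally show ?thesis by simp
qed

end

end


section \<open>Coinciding asymptotic limits\<close>

text \<open>
  With \<open>C = P\<^sup>* P\<close> the equations \<open>P\<^sup>* T P = T = P T P\<^sup>*\<close> give \<open>C T C = T\<close>, so \<open>C\<close> preserves the
  semi-inner product \<open>\<langle>T x, y\<rangle>\<close>.  Since \<open>C\<^sup>n (x - C x) \<rightarrow> 0\<close> for the positive contraction \<open>C\<close>,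
  the vector \<open>x - C x\<close> is null for it; that is, \<open>T C = T\<close>.  This makes \<open>T\<close> commute with \<open>P\<close>,
  and then \<open>T = P\<^sup>*\<^sup>k T P\<^sup>k = T P\<^sup>*\<^sup>k P\<^sup>k\<close> tends to \<open>T\<^sup>2\<close>.
\<close>

lemma idempotent_if_asymptotic_limits_coincide:
  assumes "asymptotic_limit P T" "asymptotic_limit (adj P) T"
  shows "T \<circ> T = T"
proof -
  interpret asymptotic_limit P T by fact
  interpret ad: asymptotic_limit "adj P" T by fact
  define C where "C x = adj P (P x)" for x
  have bop_C: "bop C" unfolding C_def by (intro bop_comp[OF bop_adj[OF bop_P] bop_P])
  have P_T_adj_P: "P (T (adj P x)) = T x" for x
    using ad.adj_P_T_P[of x] by (simp add: adj_adj[OF bop_P])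
  have C_self: "cinner (C x) y = cinner x (C y)" for x y
    by (simp add: C_def cinner_adj_left[OF bop_P] cinner_adj_right[OF bop_P])
  have CTC: "C (T (C x)) = T x" for x
    by (simp add: C_def P_T_adj_P adj_P_T_P)
  have T_form: "cinner (T ((C ^^ n) x)) ((C ^^ n) x) = cinner (T x) x" for n x
  proof (induction n)
    case (Suc n)
    have "cinner (T (C y)) (C y) = cinner (T y) y" for y
      by (metis C_self CTC)
    with Suc show ?case by simp
  qed simp
  have T_pos: "Re (cinner (T y) y) = 0 \<Longrightarrow> T y = 0" for y
  proof -
    assume "Re (cinner (T y) y) = 0"
    then have "(\<lambda>k. sqrt ((norm ((P ^^ k) y))\<^sup>2)) \<longlonglongrightarrow> sqrt 0"
      using norm_funpow_P_lim[of y] by (intro tendsto_real_sqrt) (simp add: T_selfadjoint)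
    then show ?thesis by (simp add: T_eq_0_iff)
  qed
  have TC: "T (C x) = T x" for x
  proof -
    define v where "v n = (C ^^ n) x" for n
    have step: "(norm (v n - v (Suc n)))\<^sup>2 \<le> (norm (v n))\<^sup>2 - (norm (v (Suc n)))\<^sup>2" for n
    proof -
      have "Re (cinner (v n) (C (v n))) = (norm (P (v n)))\<^sup>2"
        by (simp add: C_def cinner_adj_right[OF bop_P, symmetric] cinner_same)
      moreover have "(norm (C (v n)))\<^sup>2 \<le> (norm (P (v n)))\<^sup>2"
        unfolding C_def by (intro power_mono norm_adj_P) simp
      ultimately show ?thesis unfolding norm_diff_sq by (simp add: v_def)
    qed
    have "decseq (\<lambda>n. (norm (v n))\<^sup>2)"
    proof (rule decseq_SucI)
      fix n
      show "(norm (v (Suc n)))\<^sup>2 \<le> (norm (v n))\<^sup>2"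
        using step[of n] zero_le_power2[of "norm (v n - v (Suc n))"] by linarith
    qed
    then obtain l where l: "(\<lambda>n. (norm (v n))\<^sup>2) \<longlonglongrightarrow> l"
      by (rule decseq_convergent[where B = 0]) auto
    have "(\<lambda>n. (norm (v n))\<^sup>2 - (norm (v (Suc n)))\<^sup>2) \<longlonglongrightarrow> l - l"
      by (intro tendsto_diff l LIMSEQ_Suc)
    then have "(\<lambda>n. (norm (v n - v (Suc n)))\<^sup>2) \<longlonglongrightarrow> 0"
      using step by (intro Lim_null_comparison[of "\<lambda>n. (norm (v n - v (Suc n)))\<^sup>2"
          "\<lambda>n. (norm (v n))\<^sup>2 - (norm (v (Suc n)))\<^sup>2"]) (simp_all add: always_eventually)
    then have lim0: "(\<lambda>n. norm (v n - v (Suc n))) \<longlonglongrightarrow> 0"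
      using tendsto_real_sqrt[of "\<lambda>n. (norm (v n - v (Suc n)))\<^sup>2" 0 sequentially] by simp
    have vn: "v n - v (Suc n) = (C ^^ n) (x - C x)" for n
      by (simp add: v_def bop_diff[OF bop_funpow[OF bop_C]] funpow_swap1)
    define y where "y = x - C x"
    have y0: "(\<lambda>n. (C ^^ n) y) \<longlonglongrightarrow> 0"
      using lim0 unfolding vn y_def by (rule tendsto_norm_zero_cancel)
    have "(\<lambda>n. cinner (T ((C ^^ n) y)) ((C ^^ n) y)) \<longlonglongrightarrow> cinner (T 0) 0"
      by (intro tendsto_cinner bop_tendsto[OF bop_T] y0)
    then have "cinner (T y) y = 0" unfolding T_form by (simp add: LIMSEQ_const_iff)
    then have "T y = 0" using T_pos by simp
    then show ?thesis by (simp add: y_def bop_diff[OF bop_T])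
  qed
  have CT: "C (T x) = T x" for x
    by (rule cinner_eqI) (simp add: C_self[symmetric] T_selfadjoint[symmetric] TC)
  have TP: "adj P (T x) = T (adj P x)" for x
    using CT[of "adj P x"] by (simp add: C_def P_T_adj_P)
  have TPk: "(adj P ^^ k) (T x) = T ((adj P ^^ k) x)" for k x
    by (induction k) (simp_all add: TP)
  have adj_pow: "(adj P ^^ k) (T ((P ^^ k) x)) = T x" for k x
  proof (induction k)
    case (Suc k)
    have "(adj P ^^ Suc k) (T ((P ^^ Suc k) x)) = (adj P ^^ k) (adj P (T (P ((P ^^ k) x))))"
      by (simp add: funpow_swap1)
    then show ?case by (simp only: adj_P_T_P Suc.IH)
  qed simp
  have "T (T x) = T x" for x
  proof (rule LIMSEQ_unique)
    show "(\<lambda>k. T ((adj P ^^ k) ((P ^^ k) x))) \<longlonglongrightarrow> T (T x)"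
      by (intro bop_tendsto[OF bop_T] lim)
    show "(\<lambda>k. T ((adj P ^^ k) ((P ^^ k) x))) \<longlonglongrightarrow> T x"
      by (simp add: TPk[symmetric] adj_pow)
  qed
  then show ?thesis by auto
qed


section \<open>Where the contraction is isometric\<close>

lemma E_contraction_norm_le:
  assumes E: "E_contraction UNIV A B P" and w: "cmod w \<le> 1"
  shows "norm (A x - w *\<^sub>C P x) \<le> norm (x - w *\<^sub>C B x)"
    and "norm (B x - w *\<^sub>C P x) \<le> norm (x - w *\<^sub>C A x)"
proof -
  define r where "r n = 1 - 1 / real (Suc n)" for n
  have r: "cmod (complex_of_real (r n) * w) < 1" for n
  proof -
    have "\<bar>r n\<bar> < 1" by (auto simp: r_def field_simps)
    then have "\<bar>r n\<bar> * cmod w < 1"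
      using w mult_left_le[of "cmod w" "\<bar>r n\<bar>"] by simp
    then show ?thesis by (simp add: norm_mult)
  qed
  have "r \<longlonglongrightarrow> 1 - 0"
    unfolding r_def by (intro tendsto_intros LIMSEQ_Suc lim_1_over_n)
  then have lim: "(\<lambda>n. norm (u - (complex_of_real (r n) * w) *\<^sub>C v)) \<longlonglongrightarrow> norm (u - w *\<^sub>C v)" for u v :: 'a
    unfolding scaleC_scaleC[symmetric] scaleC_of_real
    using tendsto_norm[OF tendsto_diff[OF tendsto_const tendsto_scaleR[OF _ tendsto_const]]]
    by fastforce
  note le = von_neumann_on_affine[OF E_contraction_imp(2)[OF E] UNIV_I]
  show "norm (A x - w *\<^sub>C P x) \<le> norm (x - w *\<^sub>C B x)"
    by (rule LIMSEQ_le[OF lim lim]) (use le(2) r in blast)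
  show "norm (B x - w *\<^sub>C P x) \<le> norm (x - w *\<^sub>C A x)"
    by (rule LIMSEQ_le[OF lim lim]) (use le(3) r in blast)
qed

lemma E_contraction_norm_sq_le:
  assumes E: "E_contraction UNIV A B P"
  shows "(norm (A x))\<^sup>2 + (norm (P x))\<^sup>2 \<le> (norm x)\<^sup>2 + (norm (B x))\<^sup>2"
    and "(norm (B x))\<^sup>2 + (norm (P x))\<^sup>2 \<le> (norm x)\<^sup>2 + (norm (A x))\<^sup>2"
proof -
  have le: "(norm (A x - w *\<^sub>C P x))\<^sup>2 \<le> (norm (x - w *\<^sub>C B x))\<^sup>2"
      "(norm (B x - w *\<^sub>C P x))\<^sup>2 \<le> (norm (x - w *\<^sub>C A x))\<^sup>2" if "cmod w \<le> 1" for w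
    by (rule power_mono[OF E_contraction_norm_le(1)[OF E that] norm_ge_zero],
        rule power_mono[OF E_contraction_norm_le(2)[OF E that] norm_ge_zero])
  \<comment> \<open>averaging over \<open>w = 1\<close> and \<open>w = - 1\<close> cancels the mixed terms\<close>
  show "(norm (A x))\<^sup>2 + (norm (P x))\<^sup>2 \<le> (norm x)\<^sup>2 + (norm (B x))\<^sup>2"
    using le(1)[of 1] le(1)[of "- 1"]
    unfolding norm_diff_sq by (simp add: norm_scaleC cinner_scaleC_right)
  show "(norm (B x))\<^sup>2 + (norm (P x))\<^sup>2 \<le> (norm x)\<^sup>2 + (norm (A x))\<^sup>2"
    using le(2)[of 1] le(2)[of "- 1"]
    unfolding norm_diff_sq by (simp add: norm_scaleC cinner_scaleC_right)
qed

lemma E_contraction_norm_P_le: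
  assumes E: "E_contraction UNIV A B P"
  shows "norm (P x) \<le> norm x"
proof (rule power2_le_imp_le)
  show "(norm (P x))\<^sup>2 \<le> (norm x)\<^sup>2" using E_contraction_norm_sq_le[OF E, of x] by linarith
qed simp

text \<open>
  The positive operator \<open>D = R\<^sup>* R - L\<^sup>* L\<close> annihilates every vector at which its quadratic form
  vanishes, as one sees by testing positivity at \<open>x - t D x\<close> for small \<open>t > 0\<close>.
\<close>

lemma cinner_eq_of_norm_le:
  fixes L R :: "'a::chilbert_space \<Rightarrow> 'a"
  assumes bop: "bop L" "bop R" and le: "\<And>y. norm (L y) \<le> norm (R y)" and eq: "norm (L x) = norm (R x)"
  shows "cinner (L x) (L y) = cinner (R x) (R y)"
proof -
  define D where "D y = adj R (R y) - adj L (L y)" for y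
  have bopD: "bop D"
    unfolding D_def using bop by (intro bop_minus_op bop_comp[OF bop_adj]) auto
  have form: "cinner u (D v) = cinner (R u) (R v) - cinner (L u) (L v)" for u v
    by (simp add: D_def cinner_diff_right cinner_adj_right[OF bop(1)] cinner_adj_right[OF bop(2)])
  have form': "cinner (D u) v = cinner (R u) (R v) - cinner (L u) (L v)" for u v
    by (simp add: D_def cinner_diff_left cinner_adj_left[OF bop(1)] cinner_adj_left[OF bop(2)])
  have pos: "Re (cinner u (D u)) \<ge> 0" for u
    using power_mono[OF le[of u], of 2] by (simp add: form cinner_same)
  have zero: "cinner x (D x) = 0" by (simp add: form cinner_same eq)
  define c where "c = Re (cinner (D x) (D (D x)))"
  have c0: "c \<ge> 0" unfolding c_def by (rule pos)
  have sym: "cinner x (D (D x)) = cinner (D x) (D x)" using form[of x "D x"] form'[of x "D x"] by simp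
  have t: "2 * t * (norm (D x))\<^sup>2 \<le> t\<^sup>2 * c" for t
  proof -
    have "cinner (x - complex_of_real t *\<^sub>C D x) (D (x - complex_of_real t *\<^sub>C D x)) =
        complex_of_real (t\<^sup>2) * cinner (D x) (D (D x)) - complex_of_real (2 * t * (norm (D x))\<^sup>2)"
      by (simp add: bop_diff[OF bopD] bop_scaleC[OF bopD] cinner_algebra zero sym cinner_same
          power2_eq_square algebra_simps)
    then show ?thesis using pos[of "x - complex_of_real t *\<^sub>C D x"] by (simp add: c_def)
  qed
  define e where "e = (norm (D x))\<^sup>2"
  have "e = 0"
  proof (rule ccontr)
    assume "e \<noteq> 0"
    then have e: "e > 0" by (simp add: e_def)
    define r where "r = e / (c + 1)"
    have r: "r > 0" "r * c \<le> e" using e c0 by (simp_all add: r_def field_simps)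
    have "r * (2 * e) \<le> r * (r * c)"
      using t[of r] by (simp add: e_def power2_eq_square ac_simps)
    then have "2 * e \<le> r * c" using r(1) by simp
    with r(2) e show False by simp
  qed
  then have "D x = 0" by (simp add: e_def)
  then show ?thesis using form'[of x y] by simp
qed

text \<open>
  For \<open>|w| = 1\<close> the quadratic form \<open>\<parallel>y - w B y\<parallel>\<^sup>2 - \<parallel>A y - w P y\<parallel>\<^sup>2\<close> is positive.  At a vector
  \<open>x\<close> with \<open>\<parallel>P x\<parallel> = \<parallel>x\<parallel>\<close> it vanishes, because the same holds with \<open>A\<close> and \<open>B\<close> exchanged, and
  hence so does its polar form at \<open>(x, y)\<close> for every \<open>y\<close>.  Being a trigonometric polynomial in \<open>w\<close>,
  the polar form has vanishing coefficients.
\<close>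

lemma eq_adj_where_isometric:
  fixes A B P :: "'a::chilbert_space \<Rightarrow> 'a"
  assumes bop: "bop A" "bop B" "bop P"
    and le: "\<And>w y. cmod w = 1 \<Longrightarrow> norm (A y - w *\<^sub>C P y) \<le> norm (y - w *\<^sub>C B y)"
    and AB: "norm (A x) = norm (B x)" and x: "norm (P x) = norm x"
  shows "B x = adj A (P x)"
proof -
  have eq: "norm (A x - w *\<^sub>C P x) = norm (x - w *\<^sub>C B x)" if w: "cmod w = 1" for w
  proof -
    have "(norm (A x - w *\<^sub>C P x))\<^sup>2 \<le> (norm (x - w *\<^sub>C B x))\<^sup>2"
      using le[OF w] by (intro power_mono) auto
    moreover have "(norm (A x - (- w) *\<^sub>C P x))\<^sup>2 \<le> (norm (x - (- w) *\<^sub>C B x))\<^sup>2"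
      using le[of "- w"] w by (intro power_mono) auto
    ultimately have "(norm (A x - w *\<^sub>C P x))\<^sup>2 = (norm (x - w *\<^sub>C B x))\<^sup>2"
      unfolding norm_diff_sq using w x AB by (simp add: norm_scaleC cinner_scaleC_right)
    then show ?thesis by (metis norm_ge_zero power2_eq_iff_nonneg)
  qed
  have polar: "cinner (A x - w *\<^sub>C P x) (A y - w *\<^sub>C P y) = cinner (x - w *\<^sub>C B x) (y - w *\<^sub>C B y)"
    if w: "cmod w = 1" for w y
    by (rule cinner_eq_of_norm_le[OF bop_minus_op[OF bop(1) bop_scale[OF bop(3)]]
          bop_minus_op[OF bop_id bop_scale[OF bop(2)]] le[OF w] eq[OF w]])
  have "cinner (P x) (A y) = cinner (B x) y" for y
  proof -
    define s where "s = cinner (A x) (A y) + cinner (P x) (P y) - cinner x y - cinner (B x) (B y)"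
    define t where "t = cinner (P x) (A y) - cinner (B x) y"
    define u where "u = cinner (A x) (P y) - cinner x (B y)"
    have *: "s = w * t + cnj w * u" if w: "cmod w = 1" for w
    proof -
      have "w * cnj w = 1" using w by (simp add: complex_norm_square[symmetric])
      then have ww: "w * (cnj w * z) = z" for z by (simp add: mult.assoc[symmetric])
      show ?thesis
        using polar[OF w, of y] by (simp add: s_def t_def u_def cinner_algebra algebra_simps ww)
    qed
    have s1: "s = t + u" using *[of 1] by simp
    have s2: "s = - t - u" using *[of "- 1"] by simp
    have s3: "s = \<i> * (t - u)" using *[of \<i>] by (simp add: algebra_simps)
    have "s + s = 0" by (subst (1) s1, subst s2) simp
    then have "s = 0" by simp
    then have "t + u = 0" "t - u = 0" using s1 s3 by auto
    then have "t + t = 0" by (simp add: eq_iff_diff_eq_0[of t u, symmetric])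
    then have "t = 0" by simp
    then show ?thesis by (simp add: t_def)
  qed
  then have "cinner (A y) (P x) = cinner y (B x)" for y
    using cinner_commute[of "A y" "P x"] cinner_commute[of y "B x"] by simp
  then show ?thesis
    by - (rule cinner_eqI, simp add: cinner_adj_right[OF bop(1), symmetric])
qed

lemma E_contraction_eq_adj_where_isometric:
  fixes A B P :: "'a::chilbert_space \<Rightarrow> 'a"
  assumes E: "E_contraction UNIV A B P" and x: "norm (P x) = norm x"
  shows "B x = adj A (P x)" "A x = adj B (P x)"
proof -
  have bop: "bop A" "bop B" "bop P"
    using E_contraction_imp(1)[OF E] by (auto simp: commuting_triple_on_UNIV_iff)
  have "(norm (A x))\<^sup>2 = (norm (B x))\<^sup>2"
    using E_contraction_norm_sq_le[OF E, of x] x by simp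
  then have AB: "norm (A x) = norm (B x)" by (metis norm_ge_zero power2_eq_iff_nonneg)
  show "B x = adj A (P x)"
    by (rule eq_adj_where_isometric[OF bop _ AB x]) (simp add: E_contraction_norm_le(1)[OF E])
  show "A x = adj B (P x)"
    by (rule eq_adj_where_isometric[OF bop(2,1,3) _ AB[symmetric] x])
      (simp add: E_contraction_norm_le(2)[OF E])
qed


section \<open>Unitary triples\<close>

lemma unitary_perturbation_bij:
  fixes M :: "'a::chilbert_space set"
  assumes M: "closed_csubspace M" and P: "P ` M \<subseteq> M" "clinear_on M P"
    and Q: "Q ` M \<subseteq> M" "\<And>x. x \<in> M \<Longrightarrow> P (Q x) = x" "\<And>x. x \<in> M \<Longrightarrow> Q (P x) = x"
    and iso: "\<And>x. x \<in> M \<Longrightarrow> norm (P x) = norm x" and p: "cmod p \<noteq> 1" and y: "y \<in> M"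
  shows "\<exists>!x. x \<in> M \<and> P x - p *\<^sub>C x = y"
proof -
  note [simp] = csub_simps[OF M]
  have [simp]: "P x \<in> M" "Q x \<in> M" if "x \<in> M" for x using that P Q by auto
  note lin = clinear_on_scale[OF M P(2)] clinear_on_diff[OF M P(2)]
  have Qdiff: "Q (u - v) = Q u - Q v" if "u \<in> M" "v \<in> M" for u v
    using Q(3)[of "Q u - Q v"] that by (simp add: lin Q(2))
  have Qscale: "Q (c *\<^sub>C u) = c *\<^sub>C Q u" if "u \<in> M" for c u
    using Q(3)[of "c *\<^sub>C Q u"] that by (simp add: lin Q(2))
  have Qiso: "norm (Q x) = norm x" if "x \<in> M" for x
    using iso[of "Q x"] that by (simp add: Q(2))
  consider "cmod p < 1" | "cmod p > 1" using p by linarith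
  then show ?thesis
  proof cases
    case 1
    have "\<exists>!x. x \<in> M \<and> x - p *\<^sub>C Q x = Q y"
    proof (rule contraction_perturbation_bij[OF M _ _ 1])
      show "norm (p *\<^sub>C Q x) \<le> cmod p * norm x" if "x \<in> M" for x
        using that by (simp add: norm_scaleC Qiso)
    qed (auto simp: Qdiff scaleC_diff_right y)
    moreover have "P x - p *\<^sub>C x = y \<longleftrightarrow> x - p *\<^sub>C Q x = Q y" if x: "x \<in> M" for x
    proof
      assume "P x - p *\<^sub>C x = y"
      then have "Q (P x - p *\<^sub>C x) = Q y" by simp
      then show "x - p *\<^sub>C Q x = Q y" using x by (simp add: Qdiff Qscale Q(3))
    next
      assume "x - p *\<^sub>C Q x = Q y"
      then have "P (x - p *\<^sub>C Q x) = P (Q y)" by simp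
      then show "P x - p *\<^sub>C x = y" using x y by (simp add: lin Q(2))
    qed
    ultimately show ?thesis by (metis (no_types, lifting))
  next
    case 2
    have p0: "p \<noteq> 0" using 2 by auto
    have "\<exists>!x. x \<in> M \<and> x - (1 / p) *\<^sub>C P x = (- 1 / p) *\<^sub>C y"
    proof (rule contraction_perturbation_bij[OF M])
      show "norm ((1 / p) *\<^sub>C P x) \<le> cmod (1 / p) * norm x" if "x \<in> M" for x
        using that by (simp add: norm_scaleC iso)
      show "cmod (1 / p) < 1" using 2 by (simp add: norm_divide divide_less_eq)
    qed (auto simp: lin scaleC_diff_right y)
    moreover have "P x - p *\<^sub>C x = y \<longleftrightarrow> x - (1 / p) *\<^sub>C P x = (- 1 / p) *\<^sub>C y" for x
    proof
      assume *: "P x - p *\<^sub>C x = y"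
      show "x - (1 / p) *\<^sub>C P x = (- 1 / p) *\<^sub>C y"
        unfolding *[symmetric] using p0 by (simp add: scaleC_diff_right scaleC_scaleC)
    next
      assume "x - (1 / p) *\<^sub>C P x = (- 1 / p) *\<^sub>C y"
      then have "(- p) *\<^sub>C (x - (1 / p) *\<^sub>C P x) = (- p) *\<^sub>C ((- 1 / p) *\<^sub>C y)" by simp
      then show "P x - p *\<^sub>C x = y"
        using p0 by (simp add: scaleC_diff_right scaleC_scaleC)
    qed
    ultimately show ?thesis by simp
  qed
qed

text \<open>
  If \<open>P\<close> is unitary on \<open>M\<close> and \<open>A\<^sup>* = P\<^sup>-\<^sup>1 B\<close>, then \<open>A\<^sup>*\<close> commutes with \<open>A\<close> since \<open>P\<^sup>-\<^sup>1\<close> and \<open>B\<close> do.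
  The Taylor spectrum lies in the closed tetrablock by the norm estimates, and its third
  coordinate is unimodular because \<open>P - p\<close> is invertible for \<open>|p| \<noteq> 1\<close>.
\<close>

lemma E_unitaryI:
  fixes M :: "'a::chilbert_space set"
  assumes ct: "commuting_triple_on M A B P"
    and Q: "Q ` M \<subseteq> M" "\<And>x. x \<in> M \<Longrightarrow> P (Q x) = x" "\<And>x. x \<in> M \<Longrightarrow> Q (P x) = x"
    and adj: "\<And>x y. x \<in> M \<Longrightarrow> y \<in> M \<Longrightarrow> cinner (A x) y = cinner x (Q (B y))"
      "\<And>x y. x \<in> M \<Longrightarrow> y \<in> M \<Longrightarrow> cinner (B x) y = cinner x (Q (A y))"
      "\<And>x y. x \<in> M \<Longrightarrow> y \<in> M \<Longrightarrow> cinner (P x) y = cinner x (Q y)"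
    and B: "\<And>x. x \<in> M \<Longrightarrow> norm (B x) \<le> norm x"
    and le: "\<And>w x. cmod w < 1 \<Longrightarrow> x \<in> M \<Longrightarrow> norm (A x - w *\<^sub>C P x) \<le> norm (x - w *\<^sub>C B x)"
  shows "E_unitary M A B P"
proof -
  note D = commuting_triple_onD[OF ct]
  have [simp]: "A x \<in> M" "B x \<in> M" "P x \<in> M" "Q x \<in> M" if "x \<in> M" for x using that D Q by auto
  have QA: "Q (A x) = A (Q x)" if "x \<in> M" for x
    using D(9)[of "Q x"] Q(3)[of "A (Q x)"] Q(2)[of x] that by simp
  have QB: "Q (B x) = B (Q x)" if "x \<in> M" for x
    using D(10)[of "Q x"] Q(3)[of "B (Q x)"] Q(2)[of x] that by simp
  have adj_on: "adj_on M A x = Q (B x)" "adj_on M B x = Q (A x)" "adj_on M P x = Q x"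
    if "x \<in> M" for x
    using that by (auto intro!: adj_on_eqI[OF D(1)] adj)
  have "normal_on M A" "normal_on M B" "normal_on M P"
    unfolding normal_on_def by (auto simp: adj_on QA QB D(8) Q(2,3))
  moreover have "norm (P x) = norm x" if "x \<in> M" for x
  proof -
    have "cinner (P x) (P x) = cinner x x" using that by (simp add: adj(3) Q(3))
    then have "(norm (P x))\<^sup>2 = (norm x)\<^sup>2" unfolding cinner_same of_real_eq_iff .
    then show ?thesis by simp
  qed
  then have "(a, b, p) \<notin> taylor_spectrum M A B P" if "cmod p \<noteq> 1" for a b p
    using unitary_perturbation_bij[OF D(1,4,7) Q _ that]
    by (intro not_in_taylor_spectrum[OF ct, of "\<lambda>x. P x - p *\<^sub>C x" 0 a 0 b 1 p]) simp_all
  moreover have "taylor_spectrum M A B P \<subseteq> closure tetrablock"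
    by (rule taylor_spectrum_subset_closure_tetrablock[OF ct B le])
  ultimately show ?thesis
    using ct unfolding E_unitary_def tetrablock_bd_def by blast
qed


section \<open>Operators on square-summable bilateral sequences\<close>

lemma ell2_eqI: "(\<And>n. Rep_ell2 f n = Rep_ell2 h n) \<Longrightarrow> f = h"
  by (metis Rep_ell2_inject ext)

lemma norm_Rep_ell2_le: "norm (Rep_ell2 f n) \<le> norm f"
  using sum_norm_ell2_le[of "{n}" f] by simp

lemma Rep_ell2_sum: "Rep_ell2 (\<Sum>i\<in>I. f i) n = (\<Sum>i\<in>I. Rep_ell2 (f i) n)"
  by (induction I rule: infinite_finite_induct) (simp_all add: zero_ell2.rep_eq plus_ell2.rep_eq)

lemma bounded_linear_Rep_ell2: "bounded_linear (\<lambda>f. Rep_ell2 f n)"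
  by (rule bounded_linear_intro[where K = 1])
    (simp_all add: plus_ell2.rep_eq scaleR_ell2.rep_eq norm_Rep_ell2_le)

text \<open>
  The pointwise application of an operator \<open>a\<close>; the value \<open>0\<close> for an unbounded \<open>a\<close> only makes the
  definition total.
\<close>

lift_definition ell2_map :: "('a::complex_inner \<Rightarrow> 'a) \<Rightarrow> 'a ell2 \<Rightarrow> 'a ell2"
  is "\<lambda>a f n. if bop a then a (f n) else 0"
proof -
  fix a :: "'a \<Rightarrow> 'a" and f :: "int \<Rightarrow> 'a"
  assume f: "(\<lambda>n. (norm (f n))\<^sup>2) summable_on UNIV"
  show "(\<lambda>n. (norm (if bop a then a (f n) else 0))\<^sup>2) summable_on UNIV"
  proof (cases "bop a")
    case True
    then obtain C where C: "C \<ge> 0" "\<And>x. norm (a x) \<le> C * norm x" using bop_bound by blast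
    have "(\<lambda>n. C\<^sup>2 * (norm (f n))\<^sup>2) summable_on UNIV" by (intro summable_on_cmult_right f)
    then show ?thesis
      by (rule summable_on_comparison_test)
        (use True C power_mono[OF C(2) norm_ge_zero, of _ 2] in \<open>auto simp: power_mult_distrib\<close>)
  qed simp
qed

lemma Rep_ell2_map [simp]: "bop a \<Longrightarrow> Rep_ell2 (ell2_map a f) n = a (Rep_ell2 f n)"
  by (simp add: ell2_map.rep_eq)

lemma bop_ell2_map:
  assumes "bop a"
  shows "bop (ell2_map a)"
proof -
  obtain C where C: "C \<ge> 0" "\<And>x. norm (a x) \<le> C * norm x" using bop_bound[OF assms] by blast
  show ?thesis
  proof (rule bopI)
    show "ell2_map a (f + h) = ell2_map a f + ell2_map a h" for f h
      by (rule ell2_eqI) (simp add: assms plus_ell2.rep_eq bop_add[OF assms])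
    show "ell2_map a (c *\<^sub>C f) = c *\<^sub>C ell2_map a f" for c f
      by (rule ell2_eqI) (simp add: assms scaleC_ell2.rep_eq bop_scaleC[OF assms])
    fix f
    have "(norm (ell2_map a f))\<^sup>2 \<le> (C * norm f)\<^sup>2"
      unfolding norm_ell2_sq power_mult_distrib
    proof (rule summable_on_bound_finite)
      fix F :: "int set" assume F: "finite F"
      have "(\<Sum>n\<in>F. (norm (Rep_ell2 (ell2_map a f) n))\<^sup>2) \<le> (\<Sum>n\<in>F. C\<^sup>2 * (norm (Rep_ell2 f n))\<^sup>2)"
        using power_mono[OF C(2) norm_ge_zero, of _ 2]
        by (intro sum_mono) (simp add: assms power_mult_distrib)
      also have "\<dots> \<le> C\<^sup>2 * (norm f)\<^sup>2"
        unfolding sum_distrib_left[symmetric] by (intro mult_left_mono sum_norm_ell2_le F) simp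
      finally show "(\<Sum>n\<in>F. (norm (Rep_ell2 (ell2_map a f) n))\<^sup>2)
          \<le> C\<^sup>2 * (\<Sum>\<^sub>\<infinity>n. (norm (Rep_ell2 f n))\<^sup>2)"
        by (simp only: norm_ell2_sq)
    qed simp
    then show "norm (ell2_map a f) \<le> C * norm f"
      by (rule power2_le_imp_le) (use C(1) in simp)
  qed
qed

lemma cinner_ell2_map:
  assumes "bop a" "bop b" "\<And>n. cinner (a (Rep_ell2 f n)) (Rep_ell2 h n) = cinner (Rep_ell2 f n) (b (Rep_ell2 h n))"
  shows "cinner (ell2_map a f) h = cinner f (ell2_map b h)"
  by (simp add: cinner_ell2.rep_eq assms)

lemma bij_int_minus: "bij (\<lambda>n :: int. n - k)"
  by (rule bij_betw_byWitness[where f' = "\<lambda>n. n + k"]) auto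

lift_definition ell2_shift :: "int \<Rightarrow> 'a::complex_inner ell2 \<Rightarrow> 'a ell2" is "\<lambda>k f n. f (n - k)"
  by (subst summable_on_reindex_bij_betw[OF bij_int_minus])

lemmas Rep_ell2_shift [simp] = ell2_shift.rep_eq

lemma ell2_shift_shift: "ell2_shift j (ell2_shift k f) = ell2_shift (j + k) f"
  by (rule ell2_eqI) (simp add: algebra_simps)

lemma ell2_shift_0 [simp]: "ell2_shift 0 f = f"
  by (rule ell2_eqI) simp

lemma norm_ell2_shift [simp]: "norm (ell2_shift k f) = norm f"
proof -
  have "(norm (ell2_shift k f))\<^sup>2 = (norm f)\<^sup>2"
    unfolding norm_ell2_sq ell2_shift.rep_eq by (rule infsum_reindex_bij_betw[OF bij_int_minus])
  then show ?thesis by simp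
qed

lemma bop_ell2_shift: "bop (ell2_shift k)"
  by (rule bopI[where C = 1])
    (auto intro!: ell2_eqI simp: plus_ell2.rep_eq scaleC_ell2.rep_eq)

lemma cinner_ell2_shift: "cinner (ell2_shift k f) h = cinner f (ell2_shift (- k) h)"
proof -
  have "cinner (ell2_shift k f) h = (\<Sum>\<^sub>\<infinity>n. cinner (Rep_ell2 f (n - k)) (Rep_ell2 h ((n - k) + k)))"
    by (simp add: cinner_ell2.rep_eq)
  also have "\<dots> = (\<Sum>\<^sub>\<infinity>n. cinner (Rep_ell2 f n) (Rep_ell2 h (n + k)))"
    by (rule infsum_reindex_bij_betw[OF bij_int_minus])
  finally show ?thesis by (simp add: cinner_ell2.rep_eq)
qed

lift_definition ell2_single :: "int \<Rightarrow> 'a::complex_inner \<Rightarrow> 'a ell2" is "\<lambda>k x n. if n = k then x else 0"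
proof -
  fix k :: int and x :: 'a
  have "(\<lambda>n. (norm (if n = k then x else 0))\<^sup>2) summable_on {k}" by simp
  then show "(\<lambda>n. (norm (if n = k then x else 0))\<^sup>2) summable_on UNIV"
    by (rule summable_on_cong_neutral[THEN iffD1, rotated -1]) auto
qed

lemma ell2_finite_sums_tendsto:
  "((\<lambda>F. \<Sum>n\<in>F. ell2_single n (Rep_ell2 f n)) \<longlongrightarrow> f) (finite_subsets_at_top UNIV)"
proof -
  let ?g = "\<lambda>n. (norm (Rep_ell2 f n))\<^sup>2"
  have g: "?g summable_on UNIV" using Rep_ell2[of f] by simp
  have norm: "(norm ((\<Sum>n\<in>F. ell2_single n (Rep_ell2 f n)) - f))\<^sup>2 = infsum ?g UNIV - sum ?g F"
    if F: "finite F" for F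
  proof -
    have Rep: "Rep_ell2 ((\<Sum>n\<in>F. ell2_single n (Rep_ell2 f n)) - f) n = (if n \<in> F then 0 else - Rep_ell2 f n)" for n
      using F by (simp add: minus_ell2.rep_eq Rep_ell2_sum ell2_single.rep_eq)
    have "(norm ((\<Sum>n\<in>F. ell2_single n (Rep_ell2 f n)) - f))\<^sup>2 = infsum ?g (UNIV - F)"
      unfolding norm_ell2_sq Rep by (rule infsum_cong_neutral) auto
    also have "\<dots> = infsum ?g UNIV - infsum ?g F"
      using F g by (intro infsum_Diff) auto
    finally show ?thesis using F by simp
  qed
  have "((\<lambda>F. infsum ?g UNIV - sum ?g F) \<longlongrightarrow> infsum ?g UNIV - infsum ?g UNIV) (finite_subsets_at_top UNIV)"
    by (intro tendsto_diff tendsto_const infsum_tendsto g)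
  then have "((\<lambda>F. sqrt (infsum ?g UNIV - sum ?g F)) \<longlongrightarrow> sqrt 0) (finite_subsets_at_top UNIV)"
    by (intro tendsto_real_sqrt) simp
  moreover have "\<forall>\<^sub>F F in finite_subsets_at_top UNIV.
      sqrt (infsum ?g UNIV - sum ?g F) = norm ((\<Sum>n\<in>F. ell2_single n (Rep_ell2 f n)) - f)"
    by (rule eventually_finite_subsets_at_top_weakI) (simp add: norm[symmetric])
  ultimately have "((\<lambda>F. norm ((\<Sum>n\<in>F. ell2_single n (Rep_ell2 f n)) - f)) \<longlongrightarrow> 0) (finite_subsets_at_top UNIV)"
    using Lim_transform_eventually by fastforce
  then show ?thesis by (subst Lim_null) (rule tendsto_norm_zero_cancel)
qed


section \<open>The bilateral model of a pure isometric triple\<close>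

locale pure_isometric_triple =
  fixes A B P :: "'a::chilbert_space \<Rightarrow> 'a" and M :: "'a set"
  assumes E: "E_contraction UNIV A B P"
    and red: "reduces M A" "reduces M B" "reduces M P"
    and isometric: "x \<in> M \<Longrightarrow> adj P (P x) = x"
    and B_eq: "x \<in> M \<Longrightarrow> B x = adj A (P x)"
    and A_eq: "x \<in> M \<Longrightarrow> A x = adj B (P x)"
    and pure: "x \<in> M \<Longrightarrow> (\<lambda>k. norm ((adj P ^^ k) x)) \<longlonglongrightarrow> 0"
begin

lemma bop: "bop A" "bop B" "bop P"
  and comm: "A (B x) = B (A x)" "A (P x) = P (A x)" "B (P x) = P (B x)"
  using E_contraction_imp(1)[OF E] by (auto simp: commuting_triple_on_UNIV_iff)

lemmas bop_adjs = bop_adj[OF bop(1)] bop_adj[OF bop(2)] bop_adj[OF bop(3)]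

lemma M: "closed_csubspace M"
  using red by (simp add: reduces_def)

lemmas M_simps = csub_simps[OF M]

lemma M_invariant [simp]:
  assumes "x \<in> M"
  shows "A x \<in> M" "B x \<in> M" "P x \<in> M" "adj A x \<in> M" "adj B x \<in> M" "adj P x \<in> M"
  using red assms by (auto simp: reduces_def)

lemma pow_M [simp]:
  assumes "x \<in> M"
  shows "(P ^^ k) x \<in> M" "(adj P ^^ k) x \<in> M"
  using assms by (induction k) simp_all

lemma commuting_triple: "commuting_triple_on M A B P"
  by (rule commuting_triple_on_restrict[OF E_contraction_imp(1)[OF E] M]) auto

lemmas norm_le = von_neumann_on_affine[OF E_contraction_imp(2)[OF E] UNIV_I]

text \<open>
  On \<open>M\<close> the operator \<open>D = I - P P\<^sup>*\<close> is the orthogonal projection onto the wandering subspace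
  \<open>M \<ominus> P M = M \<inter> Ker P\<^sup>*\<close>.
\<close>

definition defect :: "'a \<Rightarrow> 'a" where
  "defect x = x - P (adj P x)"

definition wandering :: "'a set" where
  "wandering = M \<inter> Ker (adj P)"

lemma bop_defect: "bop defect"
  unfolding defect_def by (intro bop_minus_op bop_id bop_comp[OF bop(3) bop_adjs(3)])

lemma closed_wandering: "closed_csubspace wandering"
  unfolding wandering_def by (intro closed_csubspace_Int M closed_csubspace_Ker bop_adjs)

lemma wandering_M: "e \<in> wandering \<Longrightarrow> e \<in> M"
  by (simp add: wandering_def)

lemma defect_in_wandering [simp]: "x \<in> M \<Longrightarrow> defect x \<in> wandering"
  by (simp add: defect_def wandering_def Ker_def M_simps bop_diff[OF bop_adjs(3)] isometric)

lemma defect_P: "x \<in> M \<Longrightarrow> defect (P x) = 0"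
  by (simp add: defect_def isometric)

lemma defect_wandering: "e \<in> wandering \<Longrightarrow> defect e = e"
  by (simp add: defect_def wandering_def Ker_def bop_zero[OF bop(3)])

lemma cinner_defect_left: "e \<in> wandering \<Longrightarrow> cinner (defect x) e = cinner x e"
  by (simp add: defect_def wandering_def Ker_def cinner_diff_left cinner_adj_right[OF bop(3)])

lemma cinner_defect_right: "e \<in> wandering \<Longrightarrow> cinner e (defect x) = cinner e x"
  by (simp add: defect_def wandering_def Ker_def cinner_diff_right cinner_adj_left[OF bop(3), symmetric])

lemma norm_P: "x \<in> M \<Longrightarrow> norm (P x) = norm x"
proof -
  assume "x \<in> M"
  then have "cinner (P x) (P x) = cinner x x" by (simp add: cinner_adj_right[OF bop(3)] isometric)
  then have "(norm (P x))\<^sup>2 = (norm x)\<^sup>2" unfolding cinner_same of_real_eq_iff .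
  then show ?thesis by simp
qed

lemma norm_defect_sq: "x \<in> M \<Longrightarrow> (norm (defect x))\<^sup>2 = (norm x)\<^sup>2 - (norm (adj P x))\<^sup>2"
  unfolding defect_def norm_diff_sq cinner_adj_left[OF bop(3), symmetric]
  by (simp add: norm_P cinner_same)

text \<open>Telescoping gives the Wold decomposition \<open>\<Sum>\<^sub>k \<parallel>D P\<^sup>*\<^sup>k x\<parallel>\<^sup>2 = \<parallel>x\<parallel>\<^sup>2\<close>.\<close>

lemma wold_has_sum:
  assumes x: "x \<in> M"
  shows "((\<lambda>n :: int. (norm (if n \<ge> 0 then defect ((adj P ^^ nat n) x) else 0))\<^sup>2) has_sum (norm x)\<^sup>2) UNIV"
proof -
  let ?g = "\<lambda>k. (norm (defect ((adj P ^^ k) x)))\<^sup>2"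
  have "(\<Sum>k<n. ?g k) = (norm x)\<^sup>2 - (norm ((adj P ^^ n) x))\<^sup>2" for n
    by (induction n) (simp_all add: norm_defect_sq x)
  moreover have "(\<lambda>n. (norm x)\<^sup>2 - (norm ((adj P ^^ n) x))\<^sup>2) \<longlonglongrightarrow> (norm x)\<^sup>2 - 0\<^sup>2"
    by (intro tendsto_intros pure x)
  ultimately have "?g sums (norm x)\<^sup>2" by (simp add: sums_def)
  then have "(?g has_sum (norm x)\<^sup>2) UNIV" by (intro sums_nonneg_imp_has_sum) auto
  then have "((\<lambda>n. ?g (nat n)) has_sum (norm x)\<^sup>2) (int ` UNIV)"
    by (subst has_sum_reindex) (simp_all add: o_def)
  moreover have "n \<in> range int \<longleftrightarrow> n \<ge> 0" for n by (metis int_nat_eq of_nat_0_le_iff rangeE rangeI)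
  then have "((\<lambda>n. ?g (nat n)) has_sum (norm x)\<^sup>2) (range int) \<longleftrightarrow>
      ((\<lambda>n. (norm (if n \<ge> 0 then defect ((adj P ^^ nat n) x) else 0))\<^sup>2) has_sum (norm x)\<^sup>2) UNIV"
    by (intro has_sum_cong_neutral) auto
  ultimately show ?thesis by blast
qed

definition wold :: "'a \<Rightarrow> 'a ell2" where
  "wold x = Abs_ell2 (\<lambda>n. if n \<ge> 0 then defect ((adj P ^^ nat n) x) else 0)"

lemma Rep_wold: "x \<in> M \<Longrightarrow> Rep_ell2 (wold x) n = (if n \<ge> 0 then defect ((adj P ^^ nat n) x) else 0)"
  using wold_has_sum[of x] unfolding wold_def
  by (subst Abs_ell2_inverse) (auto dest: has_sum_imp_summable)

lemma norm_wold: "x \<in> M \<Longrightarrow> norm (wold x) = norm x"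
proof -
  assume x: "x \<in> M"
  have "(norm (wold x))\<^sup>2 = (norm x)\<^sup>2"
    unfolding norm_ell2_sq Rep_wold[OF x] by (rule infsumI[OF wold_has_sum[OF x]])
  then show ?thesis by simp
qed

lemma clinear_wold: "clinear_on M wold"
  unfolding clinear_on_def
  by (auto intro!: ell2_eqI simp: Rep_wold M_simps plus_ell2.rep_eq scaleC_ell2.rep_eq
      bop_add[OF bop_defect] bop_add[OF bop_funpow[OF bop_adjs(3)]]
      bop_scaleC[OF bop_defect] bop_scaleC[OF bop_funpow[OF bop_adjs(3)]])

text \<open>
  In the Wold decomposition \<open>A\<close> and \<open>B\<close> act on sequences as the Toeplitz operators with symbols
  \<open>D A + z D B\<^sup>*\<close> and \<open>D B + z D A\<^sup>*\<close>; the same symbols on bilateral sequences define the extension.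
\<close>

abbreviation U\<^sub>1 :: "'a ell2 \<Rightarrow> 'a ell2" where
  "U\<^sub>1 f \<equiv> ell2_map (\<lambda>x. defect (A x)) f + ell2_shift 1 (ell2_map (\<lambda>x. defect (adj B x)) f)"

abbreviation U\<^sub>2 :: "'a ell2 \<Rightarrow> 'a ell2" where
  "U\<^sub>2 f \<equiv> ell2_map (\<lambda>x. defect (B x)) f + ell2_shift 1 (ell2_map (\<lambda>x. defect (adj A x)) f)"

abbreviation U\<^sub>3 :: "'a ell2 \<Rightarrow> 'a ell2" where
  "U\<^sub>3 \<equiv> ell2_shift 1"

definition bilateral :: "'a ell2 set" where
  "bilateral = {f. \<forall>n. Rep_ell2 f n \<in> wandering}"

lemmas bop_coeffs = bop_comp[OF bop_defect bop(1)] bop_comp[OF bop_defect bop(2)]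
  bop_comp[OF bop_defect bop_adjs(1)] bop_comp[OF bop_defect bop_adjs(2)]

lemma bop_U: "bop U\<^sub>1" "bop U\<^sub>2"
  using bop_plus[OF bop_ell2_map bop_comp[OF bop_ell2_shift bop_ell2_map]] bop_coeffs by blast+

lemma Rep_U:
  "Rep_ell2 (U\<^sub>1 f) n = defect (A (Rep_ell2 f n)) + defect (adj B (Rep_ell2 f (n - 1)))"
  "Rep_ell2 (U\<^sub>2 f) n = defect (B (Rep_ell2 f n)) + defect (adj A (Rep_ell2 f (n - 1)))"
  by (simp_all add: plus_ell2.rep_eq bop_coeffs)

lemma shift_U:
  "ell2_shift k (U\<^sub>1 f) = U\<^sub>1 (ell2_shift k f)" "ell2_shift k (U\<^sub>2 f) = U\<^sub>2 (ell2_shift k f)"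
  "ell2_shift k (U\<^sub>3 f) = U\<^sub>3 (ell2_shift k f)"
proof -
  have e: "n - k - 1 = n - 1 - k" for n by simp
  show "ell2_shift k (U\<^sub>1 f) = U\<^sub>1 (ell2_shift k f)" "ell2_shift k (U\<^sub>2 f) = U\<^sub>2 (ell2_shift k f)"
    by (auto intro!: ell2_eqI simp: Rep_U e)
  show "ell2_shift k (U\<^sub>3 f) = U\<^sub>3 (ell2_shift k f)"
    by (simp add: ell2_shift_shift add.commute)
qed

lemma closed_bilateral: "closed_csubspace bilateral"
proof -
  have "bilateral = (\<Inter>n. (\<lambda>f. Rep_ell2 f n) -` wandering)"
    by (auto simp: bilateral_def)
  moreover have "closed ((\<lambda>f. Rep_ell2 f n) -` wandering)" for n
    using csub_simps(7)[OF closed_wandering] linear_continuous_on[OF bounded_linear_Rep_ell2]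
    by (intro closed_vimage) auto
  ultimately have "closed bilateral" by auto
  then show ?thesis
    unfolding closed_csubspace_def
    by (auto simp: bilateral_def zero_ell2.rep_eq plus_ell2.rep_eq scaleC_ell2.rep_eq
        csub_simps[OF closed_wandering])
qed

lemma bilateral_invariant:
  assumes "f \<in> bilateral"
  shows "U\<^sub>1 f \<in> bilateral" "U\<^sub>2 f \<in> bilateral" "ell2_shift k f \<in> bilateral"
proof -
  have w: "Rep_ell2 f n \<in> wandering" "Rep_ell2 f n \<in> M" for n
    using assms wandering_M by (auto simp: bilateral_def)
  show "U\<^sub>1 f \<in> bilateral" "U\<^sub>2 f \<in> bilateral"
    unfolding bilateral_def mem_Collect_eq Rep_U
    by (auto intro!: csub_simps(2)[OF closed_wandering] simp: w)
  show "ell2_shift k f \<in> bilateral" using w by (simp add: bilateral_def)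
qed

lemma wold_bilateral: "x \<in> M \<Longrightarrow> wold x \<in> bilateral"
  by (auto simp: bilateral_def Rep_wold csub_simps[OF closed_wandering])

text \<open>
  Since \<open>x - D x = P P\<^sup>* x\<close> and \<open>D P = 0\<close>, replacing \<open>x\<close> by \<open>D x\<close> costs nothing under an operator
  commuting with \<open>P\<close>, while \<open>B\<^sup>* P = A\<close> and \<open>A\<^sup>* P = B\<close> leave one extra term each.  It cancels
  the contribution of the next coefficient in the intertwining relations.
\<close>

lemma defect_collapse:
  assumes "x \<in> M"
  shows "defect (A (defect x)) = defect (A x)" "defect (B (defect x)) = defect (B x)"
    "defect (adj B (defect x)) = defect (adj B x) - defect (A (adj P x))"
    "defect (adj A (defect x)) = defect (adj A x) - defect (B (adj P x))"
  using assms
  by (simp_all add: defect_def[of x] bop_diff[OF bop(1)] bop_diff[OF bop(2)]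
      bop_diff[OF bop_adjs(1)] bop_diff[OF bop_adjs(2)] bop_diff[OF bop_defect] comm defect_P
      A_eq[symmetric] B_eq[symmetric])

lemma adj_pow_commute:
  "(adj P ^^ k) (adj A x) = adj A ((adj P ^^ k) x)" "(adj P ^^ k) (adj B x) = adj B ((adj P ^^ k) x)"
proof -
  have c: "adj P (adj A x) = adj A (adj P x)" "adj P (adj B x) = adj B (adj P x)" for x
    using adj_commute[OF bop(1,3)] adj_commute[OF bop(2,3)] comm by metis+
  show "(adj P ^^ k) (adj A x) = adj A ((adj P ^^ k) x)" "(adj P ^^ k) (adj B x) = adj B ((adj P ^^ k) x)"
    by (induction k) (simp_all add: c)
qed

lemma adj_pow_Suc:
  assumes "x \<in> M"
  shows "(adj P ^^ Suc k) (P x) = (adj P ^^ k) x"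
    "(adj P ^^ Suc k) (A x) = adj B ((adj P ^^ k) x)"
    "(adj P ^^ Suc k) (B x) = adj A ((adj P ^^ k) x)"
proof -
  show P: "(adj P ^^ Suc k) (P x) = (adj P ^^ k) x" for k
    using assms by (simp add: funpow_swap1 isometric)
  show "(adj P ^^ Suc k) (A x) = adj B ((adj P ^^ k) x)"
    "(adj P ^^ Suc k) (B x) = adj A ((adj P ^^ k) x)"
    unfolding A_eq[OF assms] B_eq[OF assms] adj_pow_commute P by simp_all
qed

lemma wold_intertwines:
  assumes x: "x \<in> M"
  shows "wold (A x) = U\<^sub>1 (wold x)" "wold (B x) = U\<^sub>2 (wold x)" "wold (P x) = U\<^sub>3 (wold x)"
proof -
  have int_cases: "n < 0 \<or> n = 0 \<or> (\<exists>k. n = int (Suc k))" for n :: int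
    by (metis linorder_neqE_linordered_idom not0_implies_Suc of_nat_0 zero_less_imp_eq_int less_irrefl)
  have zero: "defect 0 = 0" "A 0 = 0" "B 0 = 0" "adj A 0 = 0" "adj B 0 = 0"
    by (rule bop_zero; intro bop bop_adjs bop_defect)+
  have "Rep_ell2 (wold (A x)) n = Rep_ell2 (U\<^sub>1 (wold x)) n \<and>
      Rep_ell2 (wold (B x)) n = Rep_ell2 (U\<^sub>2 (wold x)) n \<and>
      Rep_ell2 (wold (P x)) n = Rep_ell2 (U\<^sub>3 (wold x)) n" for n
    using int_cases[of n]
  proof (elim disjE exE)
    assume "n < 0"
    then show ?thesis unfolding Rep_U Rep_ell2_shift using x by (simp add: Rep_wold zero)
  next
    assume "n = 0"
    then show ?thesis
      unfolding Rep_U Rep_ell2_shift using x by (simp add: Rep_wold zero defect_collapse defect_P)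
  next
    fix k assume n: "n = int (Suc k)"
    then have nat: "nat n = Suc k" "nat (n - 1) = k" "n \<ge> 0" "n - 1 \<ge> 0" by auto
    have "adj P ((adj P ^^ k) x) = (adj P ^^ Suc k) x" by simp
    then show ?thesis
      unfolding Rep_U Rep_ell2_shift Rep_wold[OF x] Rep_wold[OF M_invariant(1)[OF x]]
        Rep_wold[OF M_invariant(2)[OF x]] Rep_wold[OF M_invariant(3)[OF x]] nat adj_pow_Suc[OF x]
      using x nat by (simp add: defect_collapse)
  qed
  then show "wold (A x) = U\<^sub>1 (wold x)" "wold (B x) = U\<^sub>2 (wold x)" "wold (P x) = U\<^sub>3 (wold x)"
    by (auto intro: ell2_eqI)
qed

lemma wold_wandering:
  assumes e: "e \<in> wandering"
  shows "wold e = ell2_single 0 e"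
proof (rule ell2_eqI)
  fix n
  have "adj P e = 0" using e by (simp add: wandering_def Ker_def)
  then have "(adj P ^^ Suc k) e = 0" for k
    by (simp add: funpow_swap1 bop_zero[OF bop_funpow[OF bop_adjs(3)]])
  then have "(adj P ^^ nat n) e = 0" if "n > 0" for n
    using that gr0_implies_Suc[of "nat n"] by auto
  then show "Rep_ell2 (wold e) n = Rep_ell2 (ell2_single 0 e) n"
    using wandering_M[OF e] defect_wandering[OF e]
    by (auto simp: Rep_wold ell2_single.rep_eq bop_zero[OF bop_defect])
qed

text \<open>
  A finitely supported sequence becomes, after a shift, supported on the non-negative integers,
  and then it is the image of \<open>\<Sum>\<^sub>n P\<^sup>n f\<^sub>n\<close>.  So the shifts of \<open>wold ` M\<close> are dense.
\<close>

lemma bilateral_dense: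
  assumes Q: "closed Q" "\<And>x k. x \<in> M \<Longrightarrow> ell2_shift k (wold x) \<in> Q" and f: "f \<in> bilateral"
  shows "f \<in> Q"
proof -
  have "(\<Sum>n\<in>F. ell2_single n (Rep_ell2 f n)) \<in> Q" if F: "finite F" for F
  proof -
    define N where "N = (if F = {} then 0 else \<bar>Min F\<bar>)"
    have N: "n + N \<ge> 0" if "n \<in> F" for n
    proof -
      have "F \<noteq> {}" using that by auto
      then have "N = \<bar>Min F\<bar>" by (simp add: N_def)
      with Min_le[OF F that] show ?thesis by linarith
    qed
    have e: "Rep_ell2 f n \<in> wandering" "Rep_ell2 f n \<in> M" for n
      using f wandering_M by (auto simp: bilateral_def)
    have single: "wold ((P ^^ m) e) = ell2_single (int m) e" if "e \<in> wandering" for m e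
    proof (induction m)
      case (Suc m)
      have "wold ((P ^^ Suc m) e) = ell2_shift 1 (ell2_single (int m) e)"
        using Suc wold_intertwines(3)[of "(P ^^ m) e"] wandering_M[OF that] by simp
      also have "\<dots> = ell2_single (int (Suc m)) e"
        by (rule ell2_eqI) (auto simp: ell2_single.rep_eq)
      finally show ?case .
    qed (simp add: wold_wandering that)
    have shift_single: "ell2_shift j (ell2_single k e) = ell2_single (k + j) e" for j k e
      by (rule ell2_eqI) (auto simp: ell2_single.rep_eq)
    define x where "x F = (\<Sum>n\<in>F. (P ^^ nat (n + N)) (Rep_ell2 f n))" for F
    have xM: "x F \<in> M" for F
      unfolding x_def by (intro csub_sum[OF M]) (simp add: e)
    have "wold (x G) = (\<Sum>n\<in>G. ell2_single (n + N) (Rep_ell2 f n))" if "finite G" "G \<subseteq> F" for G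
      using that
    proof (induction G)
      case empty
      then show ?case by (simp add: x_def clinear_on_zero[OF M clinear_wold])
    next
      case (insert n G)
      have "x (insert n G) = (P ^^ nat (n + N)) (Rep_ell2 f n) + x G"
        using insert by (simp add: x_def)
      then have "wold (x (insert n G)) = wold ((P ^^ nat (n + N)) (Rep_ell2 f n)) + wold (x G)"
        using xM e by (simp add: clinear_on_add[OF M clinear_wold])
      then show ?case using insert N by (simp add: single e)
    qed
    from this[of F] have "wold (x F) = (\<Sum>n\<in>F. ell2_single (n + N) (Rep_ell2 f n))" using F by simp
    then have "ell2_shift (- N) (wold (x F)) = (\<Sum>n\<in>F. ell2_single n (Rep_ell2 f n))"
      by (simp add: bop_sum[OF bop_ell2_shift] shift_single)
    then show ?thesis using Q(2)[OF xM, of "- N" F] by simp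
  qed
  then show ?thesis
    by (intro Lim_in_closed_set[OF Q(1) _ _ ell2_finite_sums_tendsto])
      (auto intro: eventually_finite_subsets_at_top_weakI)
qed

text \<open>
  The commutation relation and the norm estimates hold on \<open>wold ` M\<close>, where the extension acts as
  \<open>A\<close>, \<open>B\<close>, \<open>P\<close>.  Being closed conditions that are invariant under shifts, they hold on the whole
  bilateral space by density.
\<close>

lemma E_unitary_bilateral: "E_unitary bilateral U\<^sub>1 U\<^sub>2 U\<^sub>3"
proof (rule E_unitaryI)
  have "U\<^sub>1 (U\<^sub>2 f) = U\<^sub>2 (U\<^sub>1 f)" if "f \<in> bilateral" for f
  proof -
    have "f \<in> {f. U\<^sub>1 (U\<^sub>2 f) = U\<^sub>2 (U\<^sub>1 f)}"
    proof (rule bilateral_dense[OF _ _ that])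
      show "closed {f. U\<^sub>1 (U\<^sub>2 f) = U\<^sub>2 (U\<^sub>1 f)}"
        by (intro closed_Collect_eq bop_continuous_on bop_comp[OF bop_U(1) bop_U(2)]
            bop_comp[OF bop_U(2) bop_U(1)])
      fix x k assume x: "x \<in> M"
      have "U\<^sub>1 (U\<^sub>2 (ell2_shift k (wold x))) = ell2_shift k (wold (A (B x)))"
        using x by (simp only: shift_U[symmetric] wold_intertwines M_invariant)
      moreover have "U\<^sub>2 (U\<^sub>1 (ell2_shift k (wold x))) = ell2_shift k (wold (B (A x)))"
        using x by (simp only: shift_U[symmetric] wold_intertwines M_invariant)
      ultimately show "ell2_shift k (wold x) \<in> {f. U\<^sub>1 (U\<^sub>2 f) = U\<^sub>2 (U\<^sub>1 f)}"
        by (simp only: mem_Collect_eq comm)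
    qed
    then show ?thesis by (simp only: mem_Collect_eq)
  qed
  then show "commuting_triple_on bilateral U\<^sub>1 U\<^sub>2 U\<^sub>3"
    unfolding commuting_triple_on_def
    using bilateral_invariant shift_U(1,2)[of 1] closed_bilateral
    by (auto intro!: bounded_op_on_restrict bop_U bop_ell2_shift)
  show "ell2_shift (- 1) ` bilateral \<subseteq> bilateral"
    using bilateral_invariant by blast
  show "U\<^sub>3 (ell2_shift (- 1) f) = f" "ell2_shift (- 1) (U\<^sub>3 f) = f" for f
    by (simp_all add: ell2_shift_shift)
  show "cinner (U\<^sub>3 f) h = cinner f (ell2_shift (- 1) h)" for f h
    by (rule cinner_ell2_shift)
  show "norm (U\<^sub>2 f) \<le> norm f" if "f \<in> bilateral" for f
  proof -
    have "f \<in> {f. norm (U\<^sub>2 f) \<le> norm f}"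
    proof (rule bilateral_dense[OF _ _ that])
      show "closed {f. norm (U\<^sub>2 f) \<le> norm f}"
        by (intro closed_Collect_le continuous_on_norm bop_continuous_on bop_U bop_id)
      fix x k assume x: "x \<in> M"
      have "norm (U\<^sub>2 (ell2_shift k (wold x))) = norm (B x)"
        using x by (simp only: shift_U[symmetric] wold_intertwines(2)[symmetric] norm_ell2_shift
            norm_wold M_invariant)
      then show "ell2_shift k (wold x) \<in> {f. norm (U\<^sub>2 f) \<le> norm f}"
        using norm_le(1)[of x] x by (simp only: mem_Collect_eq norm_ell2_shift norm_wold)
    qed
    then show ?thesis by (simp only: mem_Collect_eq)
  qed
  show "norm (U\<^sub>1 f - w *\<^sub>C U\<^sub>3 f) \<le> norm (f - w *\<^sub>C U\<^sub>2 f)" if w: "cmod w < 1" and f: "f \<in> bilateral" for w f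
  proof -
    have "f \<in> {f. norm (U\<^sub>1 f - w *\<^sub>C U\<^sub>3 f) \<le> norm (f - w *\<^sub>C U\<^sub>2 f)}"
    proof (rule bilateral_dense[OF _ _ f])
      show "closed {f. norm (U\<^sub>1 f - w *\<^sub>C U\<^sub>3 f) \<le> norm (f - w *\<^sub>C U\<^sub>2 f)}"
        by (intro closed_Collect_le continuous_on_norm bop_continuous_on
            bop_minus_op[OF bop_U(1) bop_scale[OF bop_ell2_shift]]
            bop_minus_op[OF bop_id bop_scale[OF bop_U(2)]])
      fix x k assume x: "x \<in> M"
      note lin = clinear_on_diff[OF M clinear_wold] clinear_on_scale[OF M clinear_wold]
        bop_diff[OF bop_ell2_shift] bop_scaleC[OF bop_ell2_shift]
      have "U\<^sub>1 (ell2_shift k (wold x)) - w *\<^sub>C U\<^sub>3 (ell2_shift k (wold x)) =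
          ell2_shift k (wold (A x)) - w *\<^sub>C ell2_shift k (wold (P x))"
        using x by (simp only: shift_U[symmetric] wold_intertwines)
      also have "\<dots> = ell2_shift k (wold (A x - w *\<^sub>C P x))"
        using x by (simp only: lin M_simps M_invariant)
      finally have L: "norm (U\<^sub>1 (ell2_shift k (wold x)) - w *\<^sub>C U\<^sub>3 (ell2_shift k (wold x))) =
          norm (A x - w *\<^sub>C P x)"
        using x by (simp only: norm_ell2_shift norm_wold M_simps M_invariant)
      have "ell2_shift k (wold x) - w *\<^sub>C U\<^sub>2 (ell2_shift k (wold x)) =
          ell2_shift k (wold x) - w *\<^sub>C ell2_shift k (wold (B x))"
        using x by (simp only: shift_U[symmetric] wold_intertwines)
      also have "\<dots> = ell2_shift k (wold (x - w *\<^sub>C B x))"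
        using x by (simp only: lin M_simps M_invariant)
      finally have R: "norm (ell2_shift k (wold x) - w *\<^sub>C U\<^sub>2 (ell2_shift k (wold x))) =
          norm (x - w *\<^sub>C B x)"
        using x by (simp only: norm_ell2_shift norm_wold M_simps M_invariant)
      show "ell2_shift k (wold x) \<in> {f. norm (U\<^sub>1 f - w *\<^sub>C U\<^sub>3 f) \<le> norm (f - w *\<^sub>C U\<^sub>2 f)}"
        unfolding mem_Collect_eq L R by (rule norm_le(2)[OF w])
    qed
    then show ?thesis by (simp only: mem_Collect_eq)
  qed
  fix f h assume f: "f \<in> bilateral" and h: "h \<in> bilateral"
  have w: "Rep_ell2 f n \<in> wandering" "Rep_ell2 h n \<in> wandering" for n
    using f h by (auto simp: bilateral_def)
  \<comment> \<open>compressed to the wandering space, \<open>D A\<close> and \<open>D A\<^sup>*\<close> are adjoint, and so are \<open>D B\<close> and \<open>D B\<^sup>*\<close>\<close>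
  let ?h = "ell2_shift (- 1) h"
  have coeff: "cinner (ell2_map (\<lambda>x. defect (A x)) f) h = cinner f (ell2_map (\<lambda>x. defect (adj A x)) h)"
    "cinner (ell2_map (\<lambda>x. defect (B x)) f) h = cinner f (ell2_map (\<lambda>x. defect (adj B x)) h)"
    "cinner (ell2_map (\<lambda>x. defect (adj A x)) f) ?h = cinner f (ell2_map (\<lambda>x. defect (A x)) ?h)"
    "cinner (ell2_map (\<lambda>x. defect (adj B x)) f) ?h = cinner f (ell2_map (\<lambda>x. defect (B x)) ?h)"
    using w
    by (auto intro!: cinner_ell2_map bop_coeffs simp: cinner_defect_left cinner_defect_right
        cinner_adj_left[OF bop(1)] cinner_adj_left[OF bop(2)] cinner_adj_right[OF bop(1)]
        cinner_adj_right[OF bop(2)])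
  have map_shift: "ell2_map a (ell2_shift k g) = ell2_shift k (ell2_map a g)" if "bop a" for a k g
    by (rule ell2_eqI) (simp add: that)
  have shift_add: "ell2_shift (- 1) (g + ell2_shift 1 g') = ell2_shift (- 1) g + g'" for g g'
    by (simp add: bop_add[OF bop_ell2_shift] ell2_shift_shift)
  show "cinner (U\<^sub>1 f) h = cinner f (ell2_shift (- 1) (U\<^sub>2 h))"
    unfolding shift_add
    by (simp add: cinner_add_left cinner_add_right cinner_ell2_shift coeff map_shift
        bop_coeffs)
  show "cinner (U\<^sub>2 f) h = cinner f (ell2_shift (- 1) (U\<^sub>1 h))"
    unfolding shift_add
    by (simp add: cinner_add_left cinner_add_right cinner_ell2_shift coeff map_shift
        bop_coeffs)
qed

lemma E_isometry: "E_isometry M A B P"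
  unfolding E_isometry_def
  using commuting_triple E_unitary_bilateral wold_bilateral clinear_wold norm_wold wold_intertwines
  by (intro conjI exI[of _ bilateral] exI[of _ U\<^sub>1] exI[of _ U\<^sub>2] exI[of _ U\<^sub>3] exI[of _ wold]) auto

end


section \<open>The decomposition of a tetrablock contraction\<close>

locale tetrablock_limits =
  fixes A B P T T\<^sub>s :: "'a::chilbert_space \<Rightarrow> 'a"
  assumes E: "E_contraction UNIV A B P"
    and limits: "asymptotic_limit P T" "asymptotic_limit (adj P) T\<^sub>s"
begin

sublocale forward: asymptotic_limit P T by (rule limits)
sublocale backward: asymptotic_limit "adj P" T\<^sub>s by (rule limits)

lemma bop: "bop A" "bop B" "bop P"
  and comm: "A (B x) = B (A x)" "A (P x) = P (A x)" "B (P x) = P (B x)"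
  using E_contraction_imp(1)[OF E] by (auto simp: commuting_triple_on_UNIV_iff)

lemma comm_adj:
  "adj A (adj P x) = adj P (adj A x)" "adj B (adj P x) = adj P (adj B x)"
  using adj_commute[OF bop(1,3) comm(2)] adj_commute[OF bop(2,3) comm(3)] .

lemma tetrablock_limits_adj: "tetrablock_limits (adj A) (adj B) (adj P) T\<^sub>s T"
  using E_contraction_adj[OF E] limits
  by (simp add: tetrablock_limits_def adj_adj[OF bop(3)])

lemma closed_Ker [simp]:
  "closed_csubspace (Ker T)" "closed_csubspace (Ker T\<^sub>s)"
  "closed_csubspace (Ker (\<lambda>x. x - T x))" "closed_csubspace (Ker (\<lambda>x. x - T\<^sub>s x))"
  by (intro closed_csubspace_Ker forward.bop_T backward.bop_T bop_minus_op bop_id)+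

lemma mem_Ker: "x \<in> Ker S \<longleftrightarrow> S x = 0"
  by (simp add: Ker_def)

lemma fixed_eqs:
  assumes "T x = x"
  shows "adj P (P x) = x" "B x = adj A (P x)" "A x = adj B (P x)"
  using forward.fixed_adj_P_P[OF assms, of 1] forward.fixed_norm[OF assms, of 1]
    E_contraction_eq_adj_where_isometric[OF E] by simp_all

lemma strongly_stable_adj_on:
  assumes "reduces M P" "M \<subseteq> Ker T\<^sub>s"
  shows "strongly_stable_on M (adj_on M P)"
  unfolding strongly_stable_on_def
proof
  fix x assume x: "x \<in> M"
  have "(adj_on M P ^^ k) x = (adj P ^^ k) x \<and> (adj P ^^ k) x \<in> M" for k
  proof (induction k)
    case (Suc k)
    then show ?case
      using assms(1) adj_on_reduces[OF assms(1) bop(3)] by (auto simp: reduces_def)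
  qed (use x in simp)
  then show "(\<lambda>k. norm ((adj_on M P ^^ k) x)) \<longlonglongrightarrow> 0"
    using x assms(2) backward.T_eq_0_iff[of x] by (auto simp: mem_Ker)
qed

context
  assumes idem: "T \<circ> T = T"
begin

text \<open>
  \<open>P\<close> maps the fixed space of \<open>T\<close> into itself, and the fixed space is invariant under the adjoints
  of all operators commuting with \<open>P\<close>; hence it contains \<open>A x = B\<^sup>* P x\<close> and \<open>B x = A\<^sup>* P x\<close>.
\<close>

lemma fixed_invariant:
  assumes "T x = x"
  shows "T (A x) = A x" "T (B x) = B x" "T (P x) = P x"
    "T (adj A x) = adj A x" "T (adj B x) = adj B x" "T (adj P x) = adj P x"
proof -
  have P: "T (P x) = P x" using forward.fixed_P[OF assms] .
  have adj: "T (adj S y) = adj S y" if "bop S" "\<And>x. S (P x) = P (S x)" "T y = y" for S y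
    using forward.fixed_invariant_adj[OF idem that] .
  show "T (A x) = A x" using adj[OF bop(2) comm(3) P] fixed_eqs(3)[OF assms] by simp
  show "T (B x) = B x" using adj[OF bop(1) comm(2) P] fixed_eqs(2)[OF assms] by simp
  show "T (P x) = P x" "T (adj A x) = adj A x" "T (adj B x) = adj B x" "T (adj P x) = adj P x"
    using P adj[OF bop(1) comm(2) assms] adj[OF bop(2) comm(3) assms] adj[OF bop(3) refl assms]
    by simp_all
qed

lemma reduces_Ker: "reduces (Ker T) A" "reduces (Ker T) B" "reduces (Ker T) P"
  using forward.Ker_T_invariant[OF bop(1) comm(2)] forward.Ker_T_invariant[OF bop(2) comm(3)]
    forward.Ker_T_invariant[OF bop(3) refl]
    forward.Ker_T_invariant_adj[OF idem bop(1) fixed_invariant(1)]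
    forward.Ker_T_invariant_adj[OF idem bop(2) fixed_invariant(2)]
    forward.Ker_T_invariant_adj[OF idem bop(3) fixed_invariant(3)]
  by (auto simp: reduces_def mem_Ker)

lemma strongly_stable_part: "strongly_stable_E_contraction (Ker T) A B P"
  using E_contraction_restrict[OF E reduces_Ker]
  by (auto simp: strongly_stable_E_contraction_def strongly_stable_on_def mem_Ker
      forward.T_eq_0_iff)

abbreviation "pure_part \<equiv> Ker (\<lambda>x. x - T x) \<inter> Ker T\<^sub>s"
abbreviation "unitary_part \<equiv> Ker (\<lambda>x. x - T x) \<inter> Ker (\<lambda>x. x - T\<^sub>s x)"

lemma pure_part_P:
  assumes "T x = x" "T\<^sub>s x = 0"
  shows "T\<^sub>s (P x) = 0"
proof -
  have "(adj P ^^ Suc k) (P x) = (adj P ^^ k) x" for k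
    by (simp add: funpow_swap1 fixed_eqs(1)[OF assms(1)])
  moreover have "(\<lambda>k. norm ((adj P ^^ k) x)) \<longlonglongrightarrow> 0"
    using assms(2) unfolding backward.T_eq_0_iff .
  ultimately have "(\<lambda>k. norm ((adj P ^^ Suc k) (P x))) \<longlonglongrightarrow> 0" by simp
  then show ?thesis unfolding backward.T_eq_0_iff by (rule LIMSEQ_imp_Suc)
qed

text \<open>
  \<open>Ker T\<^sub>s\<close> is invariant under \<open>A\<^sup>*\<close>, \<open>B\<^sup>*\<close>, \<open>P\<^sup>*\<close>, which commute with \<open>P\<^sup>*\<close>; invariance under \<open>A\<close>
  and \<open>B\<close> follows by \<open>A x = B\<^sup>* P x\<close> and \<open>B x = A\<^sup>* P x\<close>.
\<close>

lemma reduces_pure_part: "reduces pure_part A" "reduces pure_part B" "reduces pure_part P"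
proof -
  have adj: "T\<^sub>s (adj A x) = 0" "T\<^sub>s (adj B x) = 0" "T\<^sub>s (adj P x) = 0" if "T\<^sub>s x = 0" for x
    using backward.Ker_T_invariant[OF bop_adj[OF bop(1)] comm_adj(1) that]
      backward.Ker_T_invariant[OF bop_adj[OF bop(2)] comm_adj(2) that]
      backward.Ker_T_invariant[OF bop_adj[OF bop(3)] refl that] .
  have "T\<^sub>s (A x) = 0" "T\<^sub>s (B x) = 0" if "T x = x" "T\<^sub>s x = 0" for x
    using adj(2)[OF pure_part_P[OF that]] adj(1)[OF pure_part_P[OF that]] fixed_eqs[OF that(1)]
    by simp_all
  then show "reduces pure_part A" "reduces pure_part B" "reduces pure_part P"
    using adj fixed_invariant pure_part_P
    by (auto simp: reduces_def mem_Ker closed_csubspace_Int)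
qed

lemma pure_isometric_part: "pure_E_isometry pure_part A B P"
proof -
  interpret pure_isometric_triple A B P pure_part
  proof
    show "E_contraction UNIV A B P" by (rule E)
    show "reduces pure_part A" "reduces pure_part B" "reduces pure_part P"
      by (rule reduces_pure_part)+
  qed (auto simp: mem_Ker fixed_eqs backward.T_eq_0_iff)
  show ?thesis
    unfolding pure_E_isometry_def pure_E_contraction_def
    using E_isometry E_contraction_restrict[OF E reduces_pure_part]
      strongly_stable_adj_on[OF reduces_pure_part(3)] by auto
qed

lemma unitary_part_P_adj_P:
  assumes "T\<^sub>s x = x"
  shows "(P ^^ k) ((adj P ^^ k) x) = x"
  using backward.fixed_adj_P_P[OF assms, of k] by (simp add: adj_adj[OF bop(3)])

text \<open>
  The unitary part consists of the vectors of the fixed space of \<open>T\<close> that lie in the range of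
  every \<open>P\<^sup>k\<close>, and \<open>S x = S P\<^sup>k P\<^sup>*\<^sup>k x = P\<^sup>k S P\<^sup>*\<^sup>k x\<close> is in this range whenever \<open>x\<close> is.
\<close>

lemma unitary_part_invariant:
  assumes S: "\<And>x. S (P x) = P (S x)" "\<And>x. T x = x \<Longrightarrow> T (S x) = S x"
    and x: "T x = x" "T\<^sub>s x = x"
  shows "T\<^sub>s (S x) = S x"
proof -
  have "(P ^^ k) ((adj P ^^ k) (S x)) = S x" for k
  proof -
    have fixed: "T ((adj P ^^ k) x) = (adj P ^^ k) x"
      by (induction k) (simp_all add: x fixed_invariant(6))
    have "S ((P ^^ k) y) = (P ^^ k) (S y)" for y
      by (induction k) (simp_all add: S)
    then have Sx: "S x = (P ^^ k) (S ((adj P ^^ k) x))"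
      using unitary_part_P_adj_P[OF x(2), of k] by metis
    have "(adj P ^^ k) (S x) = S ((adj P ^^ k) x)"
      by (subst Sx) (rule forward.fixed_adj_P_P[OF S(2)[OF fixed]])
    with Sx show ?thesis by simp
  qed
  then have "(\<lambda>k. S x) \<longlonglongrightarrow> T\<^sub>s (S x)"
    using backward.lim[of "S x"] by (simp add: adj_adj[OF bop(3)])
  then show ?thesis by (simp add: LIMSEQ_const_iff)
qed

text \<open>Here \<open>x = P y\<close> with \<open>y = P\<^sup>* x\<close> in the fixed space of \<open>T\<close>, where \<open>A\<^sup>* P y = B y\<close>.\<close>

lemma unitary_part_adj:
  assumes x: "T x = x" "T\<^sub>s x = x"
  shows "adj A x = B (adj P x)" "adj B x = A (adj P x)"
    "adj P (B x) = B (adj P x)" "adj P (A x) = A (adj P x)"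
proof -
  have y: "T (adj P x) = adj P x" and Py: "P (adj P x) = x"
    using fixed_invariant(6)[OF x(1)] unitary_part_P_adj_P[OF x(2), of 1] by simp_all
  show "adj A x = B (adj P x)" "adj B x = A (adj P x)"
    using fixed_eqs(2,3)[OF y] Py by simp_all
  show "adj P (B x) = B (adj P x)" "adj P (A x) = A (adj P x)"
    using fixed_eqs(1)[OF fixed_invariant(2)[OF y]] fixed_eqs(1)[OF fixed_invariant(1)[OF y]]
    by (metis comm Py)+
qed

lemma reduces_unitary_part:
  "reduces unitary_part A" "reduces unitary_part B" "reduces unitary_part P"
proof -
  have inv: "T\<^sub>s (A x) = A x" "T\<^sub>s (B x) = B x" "T\<^sub>s (P x) = P x" if "T x = x" "T\<^sub>s x = x" for x
    using unitary_part_invariant[of A, OF comm(2) fixed_invariant(1) that]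
      unitary_part_invariant[of B, OF comm(3) fixed_invariant(2) that]
      unitary_part_invariant[of P, OF refl fixed_invariant(3) that] by blast+
  have adj_P: "T\<^sub>s (adj P x) = adj P x" if "T\<^sub>s x = x" for x
    using backward.fixed_P[OF that] .
  have "T\<^sub>s (adj A x) = adj A x" "T\<^sub>s (adj B x) = adj B x" if "T x = x" "T\<^sub>s x = x" for x
    using inv[OF fixed_invariant(6)[OF that(1)] adj_P[OF that(2)]] unitary_part_adj[OF that]
    by simp_all
  then show "reduces unitary_part A" "reduces unitary_part B" "reduces unitary_part P"
    using inv adj_P fixed_invariant
    by (auto simp: reduces_def mem_Ker closed_csubspace_Int)
qed

lemma unitary_E_part: "E_unitary unitary_part A B P"
proof (rule E_unitaryI[where Q = "adj P"])
  have E': "E_contraction unitary_part A B P"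
    by (rule E_contraction_restrict[OF E reduces_unitary_part])
  show "commuting_triple_on unitary_part A B P" by (rule E_contraction_imp(1)[OF E'])
  show "adj P ` unitary_part \<subseteq> unitary_part"
    using reduces_unitary_part(3) by (simp add: reduces_def)
  show "P (adj P x) = x" "adj P (P x) = x" if "x \<in> unitary_part" for x
    using that unitary_part_P_adj_P[of x 1] fixed_eqs(1)[of x] by (auto simp: mem_Ker)
  show "cinner (P x) y = cinner x (adj P y)" for x y by (rule cinner_adj_right[OF bop(3)])
  show "cinner (A x) y = cinner x (adj P (B y))" "cinner (B x) y = cinner x (adj P (A y))"
    if "y \<in> unitary_part" for x y
    using that unitary_part_adj[of y]
    by (auto simp: mem_Ker cinner_adj_right[OF bop(1)] cinner_adj_right[OF bop(2)])
  note le = von_neumann_on_affine[OF E_contraction_imp(2)[OF E']]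
  show "norm (B x) \<le> norm x" if "x \<in> unitary_part" for x using le(1)[OF that] .
  show "norm (A x - w *\<^sub>C P x) \<le> norm (x - w *\<^sub>C B x)"
    if "cmod w < 1" "x \<in> unitary_part" for w x using le(2)[OF that(2,1)] .
qed

end

text \<open>The adjoint triple has the asymptotic limits \<open>T\<^sub>s\<close> and \<open>T\<close> in this order.\<close>

lemma C00_part:
  assumes "T \<circ> T = T" "T\<^sub>s \<circ> T\<^sub>s = T\<^sub>s"
  shows "C00_E_contraction (Ker T \<inter> Ker T\<^sub>s) A B P"
proof -
  interpret ad: tetrablock_limits "adj A" "adj B" "adj P" T\<^sub>s T by (rule tetrablock_limits_adj)
  have red: "reduces (Ker T \<inter> Ker T\<^sub>s) A" "reduces (Ker T \<inter> Ker T\<^sub>s) B" "reduces (Ker T \<inter> Ker T\<^sub>s) P"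
    using reduces_Ker[OF assms(1)] ad.reduces_Ker[OF assms(2)]
    unfolding reduces_adj[OF bop(1)] reduces_adj[OF bop(2)] reduces_adj[OF bop(3)]
    by (auto intro: reduces_Int)
  then show ?thesis
    unfolding C00_E_contraction_def
    using E_contraction_restrict[OF E red] strongly_stable_adj_on[OF red(3)]
    by (auto simp: strongly_stable_on_def mem_Ker forward.T_eq_0_iff)
qed

lemma adjoint_pure_isometric_part:
  assumes "T\<^sub>s \<circ> T\<^sub>s = T\<^sub>s"
  shows "pure_E_isometry (Ker T \<inter> Ker (\<lambda>x. x - T\<^sub>s x)) (adj A) (adj B) (adj P)"
proof -
  interpret ad: tetrablock_limits "adj A" "adj B" "adj P" T\<^sub>s T by (rule tetrablock_limits_adj)
  show ?thesis using ad.pure_isometric_part[OF assms] by (simp add: Int_commute)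
qed

end

theorem theorem5p5:
  fixes A B P T T\<^sub>s :: "'a::chilbert_space \<Rightarrow> 'a"
  assumes "E_contraction UNIV A B P"
    and "strong_op_limit (\<lambda>k. (adj P ^^ k) \<circ> (P ^^ k)) T"
    and "strong_op_limit (\<lambda>k. (P ^^ k) \<circ> (adj P ^^ k)) T\<^sub>s"
  shows
    "(T \<circ> T = T \<longrightarrow>
        (\<forall>M \<in> {Ker T, Ker (\<lambda>x. x - T x) \<inter> Ker T\<^sub>s, Ker (\<lambda>x. x - T x) \<inter> Ker (\<lambda>x. x - T\<^sub>s x)}.
           reduces M A \<and> reduces M B) \<and>
        strongly_stable_E_contraction (Ker T) A B P \<and>
        pure_E_isometry (Ker (\<lambda>x. x - T x) \<inter> Ker T\<^sub>s) A B P \<and>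
        E_unitary (Ker (\<lambda>x. x - T x) \<inter> Ker (\<lambda>x. x - T\<^sub>s x)) A B P) \<and>
     (T \<circ> T = T \<and> T\<^sub>s \<circ> T\<^sub>s = T\<^sub>s \<longrightarrow>
        C00_E_contraction (Ker T \<inter> Ker T\<^sub>s) A B P \<and>
        pure_E_isometry (Ker T \<inter> Ker (\<lambda>x. x - T\<^sub>s x)) (adj A) (adj B) (adj P)) \<and>
     (T = T\<^sub>s \<longrightarrow>
        C00_E_contraction (Ker T) A B P \<and>
        E_unitary (Ker (\<lambda>x. x - T x)) A B P)"
proof -
  have bop_P: "bop P"
    using E_contraction_imp(1)[OF assms(1)] by (simp add: commuting_triple_on_UNIV_iff)
  have norm_P: "norm (P x) \<le> norm x" for x by (rule E_contraction_norm_P_le[OF assms(1)])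
  have lim: "asymptotic_limit P T"
    using assms(2) bop_P norm_P by (simp add: asymptotic_limit_def strong_op_limit_def)
  have lim_adj: "asymptotic_limit (adj P) T\<^sub>s"
    using assms(3) bop_adj[OF bop_P] adj_bound[OF bop_P, of 1] norm_P
    by (simp add: asymptotic_limit_def strong_op_limit_def adj_adj[OF bop_P])
  interpret tetrablock_limits A B P T T\<^sub>s
    by (rule tetrablock_limits.intro[OF assms(1) lim lim_adj])
  have idem: "T \<circ> T = T" if "T = T\<^sub>s"
    using idempotent_if_asymptotic_limits_coincide[OF limits(1)] limits(2) that by simp
  show ?thesis
  proof (intro conjI impI)
    assume *: "T \<circ> T = T"
    show "\<forall>M \<in> {Ker T, Ker (\<lambda>x. x - T x) \<inter> Ker T\<^sub>s, Ker (\<lambda>x. x - T x) \<inter> Ker (\<lambda>x. x - T\<^sub>s x)}.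
        reduces M A \<and> reduces M B"
      using reduces_Ker[OF *] reduces_pure_part[OF *] reduces_unitary_part[OF *] by simp
    show "strongly_stable_E_contraction (Ker T) A B P" by (rule strongly_stable_part[OF *])
    show "pure_E_isometry (Ker (\<lambda>x. x - T x) \<inter> Ker T\<^sub>s) A B P" by (rule pure_isometric_part[OF *])
    show "E_unitary (Ker (\<lambda>x. x - T x) \<inter> Ker (\<lambda>x. x - T\<^sub>s x)) A B P" by (rule unitary_E_part[OF *])
  next
    assume *: "T \<circ> T = T \<and> T\<^sub>s \<circ> T\<^sub>s = T\<^sub>s"
    show "C00_E_contraction (Ker T \<inter> Ker T\<^sub>s) A B P" using C00_part * by blast
    show "pure_E_isometry (Ker T \<inter> Ker (\<lambda>x. x - T\<^sub>s x)) (adj A) (adj B) (adj P)"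
      using adjoint_pure_isometric_part * by blast
  next
    assume eq: "T = T\<^sub>s"
    show "C00_E_contraction (Ker T) A B P" using C00_part idem[OF eq] eq by simp
    show "E_unitary (Ker (\<lambda>x. x - T x)) A B P" using unitary_E_part idem[OF eq] eq by simp
  qed
qed

end
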